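(* Let $\mathfrak{g}=\mathfrak{n}^-\oplus\mathfrak{h}\oplus\mathfrak{n}^+$ be the insertion-elimination Lie algebra over $\mathbb{C}$, and let $\eta:\mathfrak{n}^+\to\mathbb{C}$ be a non-zero, root-bounded Lie algebra homomorphism. Then the space of Whittaker vectors of type $\eta$ in the standard Whittaker module $M_\eta$ is one-dimensional, and $M_\eta$ is a simple $\mathfrak{g}$-module.
   Context: A rooted tree is a finite nonempty connected undirected graph without cycles, with a distinguished vertex called the root; $\mathbb{T}$ denotes the set of all rooted trees, up to isomorphism. For $t\in\mathbb{T}$, $V(t)$ and $E(t)$ are the sets of vertices and edges and $|t|=|V(t)|$. The root degree $\mathsf{rdeg}(t)$ is the number of edges incident on the root of $t$. For $s,t\in\mathbb{T}$ and $v\in V(s)$, $s\cup_v t$ is the rooted tree obtained by joining the root of $t$ to the vertex $v$ of $s$ by a new edge (its root is the root of $s$). For $e\in E(t)$, removing $e$ splits $t$ into two rooted trees: $R_e(t)$, the part containing the root of $t$, and $P_e(t)$, the other part, rooted at its endpoint of $e$. Put $\alpha(t_1,t_2,t_3)=|\{e\in E(t_2): R_e(t_2)=t_3,\ P_e(t_2)=t_1\}|$ and $\beta(t_1,t_2,t_3)=|\{v\in V(t_3): t_1=t_3\cup_v t_2\}|$ (equalities of trees are up to isomorphism). The insertion-elimination Lie algebra $\mathfrak{g}$ is the complex Lie algebra with basis $\{d\}\cup\{D_t^+,D_t^-: t\in\mathbb{T}\}$ and brackets, for $s,t\in\mathbb{T}$: $[D_s^+,D_t^+]=\sum_{r\in\mathbb{T}}(\beta(r,s,t)-\beta(r,t,s))D_r^+$;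 $[D_s^-,D_t^-]=\sum_{r\in\mathbb{T}}(\alpha(t,r,s)-\alpha(s,r,t))D_r^-$; $[D_s^-,D_t^+]=\sum_{r\in\mathbb{T}}\alpha(s,t,r)D_r^+ +\sum_{r\in\mathbb{T}}\beta(s,t,r)D_r^-$ for $s\neq t$; $[D_t^-,D_t^+]=d$; $[d,D_t^-]=-|t|D_t^-$; $[d,D_t^+]=|t|D_t^+$. Let $\mathfrak{n}^{\pm}$ be the span of the $D_t^{\pm}$ ($t\in\mathbb{T}$) and $\mathfrak{h}=\mathbb{C}d$. For a Lie algebra homomorphism $\eta:\mathfrak{n}^+\to\mathbb{C}$ let $\mathbb{C}_\eta$ be the one-dimensional $\mathfrak{n}^+$-module with $x\cdot 1=\eta(x)$. The standard Whittaker module is $M_\eta=U(\mathfrak{g})\otimes_{U(\mathfrak{n}^+)}\mathbb{C}_\eta$. A Whittaker vector of type $\eta$ in a $\mathfrak{g}$-module $V$ is a vector $v\in V$ with $x v=\eta(x)v$ for all $x\in\mathfrak{n}^+$. The homomorphism $\eta$ is root-bounded if there is a positive integer $M$ such that $\eta(D_t^+)=0$ whenever $\mathsf{rdeg}(t)\geq M$. *)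

theory Defs
  imports
    Complex_Main
    "HOL-Library.Poly_Mapping"
    "HOL-Library.Groups_Big_Fun"
    "HOL-Algebra.Module"
    "HOL-Algebra.QuotRing"
    "HOL-Algebra.Generated_Groups"
    "HOL-Algebra.Free_Abelian_Groups"
begin

section \<open>Rooted trees\<close>

record 'v rgraph =
  verts :: "'v set"
  edges :: "'v set set"
  rootv :: 'v

definition reach :: "'v set set \<Rightarrow> 'v \<Rightarrow> 'v set" where
  "reach E u = {w. (u, w) \<in> {(x, y). {x, y} \<in> E}\<^sup>*}"

definition cycle_in :: "'v set set \<Rightarrow> 'v list \<Rightarrow> bool" where
  "cycle_in E vs \<longleftrightarrow> 3 \<le> length vs \<and> distinct vs \<and>
     (\<forall>i<length vs. {vs ! i, vs ! (Suc i mod length vs)} \<in> E)"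

definition rooted_tree :: "'v rgraph \<Rightarrow> bool" where
  "rooted_tree G \<longleftrightarrow>
     finite (verts G) \<and> rootv G \<in> verts G \<and>
     (\<forall>e\<in>edges G. e \<subseteq> verts G \<and> card e = 2) \<and>
     (\<forall>u\<in>verts G. \<forall>w\<in>verts G. w \<in> reach (edges G) u) \<and>
     (\<nexists>vs. cycle_in (edges G) vs)"

definition rgraph_iso :: "'v rgraph \<Rightarrow> 'w rgraph \<Rightarrow> bool" where
  "rgraph_iso G H \<longleftrightarrow>
     (\<exists>f. bij_betw f (verts G) (verts H) \<and>
          edges H = (\<lambda>e. f ` e) ` edges G \<and> f (rootv G) = rootv H)"

definition graft :: "'v rgraph \<Rightarrow> 'v \<Rightarrow> 'w rgraph \<Rightarrow> ('v + 'w) rgraph" where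
  "graft G v H =
     \<lparr>verts = Inl ` verts G \<union> Inr ` verts H,
      edges = (\<lambda>e. Inl ` e) ` edges G \<union> (\<lambda>e. Inr ` e) ` edges H \<union> {{Inl v, Inr (rootv H)}},
      rootv = Inl (rootv G)\<rparr>"

definition root_part :: "'v rgraph \<Rightarrow> 'v set \<Rightarrow> 'v rgraph" where
  "root_part G e =
     (let V = reach (edges G - {e}) (rootv G)
      in \<lparr>verts = V, edges = {e' \<in> edges G - {e}. e' \<subseteq> V}, rootv = rootv G\<rparr>)"

definition pruned_part :: "'v rgraph \<Rightarrow> 'v set \<Rightarrow> 'v rgraph" where
  "pruned_part G e =
     (let W = verts G - verts (root_part G e)
      in \<lparr>verts = W, edges = {e' \<in> edges G - {e}. e' \<subseteq> W}, rootv = (THE w. w \<in> e \<inter> W)\<rparr>)"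

lemma rgraph_iso_refl: "rgraph_iso G G"
  unfolding rgraph_iso_def by (rule exI[of _ id]) simp

lemma rgraph_iso_trans:
  assumes "rgraph_iso G H" "rgraph_iso H K"
  shows "rgraph_iso G K"
proof -
  obtain f where f: "bij_betw f (verts G) (verts H)"
      "edges H = (\<lambda>e. f ` e) ` edges G" "f (rootv G) = rootv H"
    using assms(1) unfolding rgraph_iso_def by blast
  obtain g where g: "bij_betw g (verts H) (verts K)"
      "edges K = (\<lambda>e. g ` e) ` edges H" "g (rootv H) = rootv K"
    using assms(2) unfolding rgraph_iso_def by blast
  show ?thesis unfolding rgraph_iso_def
    using bij_betw_trans[OF f(1) g(1)] f(2,3) g(2,3)
    by (intro exI[of _ "g \<circ> f"]) (simp add: image_image image_comp)
qed

lemma rgraph_iso_sym: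
  assumes "rooted_tree G" "rgraph_iso G H"
  shows "rgraph_iso H G"
proof -
  obtain f where f: "bij_betw f (verts G) (verts H)"
      "edges H = (\<lambda>e. f ` e) ` edges G" "f (rootv G) = rootv H"
    using assms(2) unfolding rgraph_iso_def by blast
  let ?g = "inv_into (verts G) f"
  have inj: "inj_on f (verts G)" using f(1) by (simp add: bij_betw_def)
  have "?g ` f ` e = e" if "e \<in> edges G" for e
    using that assms(1) by (intro inv_into_image_cancel[OF inj]) (simp add: rooted_tree_def)
  then have "(\<lambda>e. ?g ` e) ` edges H = edges G"
    unfolding f(2) by (simp add: image_image)
  moreover have "?g (rootv H) = rootv G"
    using inj assms(1) f(3)[symmetric] by (simp add: rooted_tree_def)
  ultimately show ?thesis
    unfolding rgraph_iso_def using bij_betw_inv_into[OF f(1)] by (intro exI[of _ ?g]) simp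
qed

lemma rooted_tree_singleton: "rooted_tree \<lparr>verts = {v}, edges = {}, rootv = v\<rparr>"
proof -
  have "\<not> cycle_in {} vs" for vs :: "'a list"
    unfolding cycle_in_def by (cases vs) auto
  then show ?thesis by (simp add: rooted_tree_def reach_def)
qed

text \<open>Every finite rooted tree is isomorphic to one with vertices in \<^typ>\<open>nat\<close>, so the
  isomorphism classes of such trees form the set of all rooted trees up to isomorphism.\<close>

quotient_type rtree = "nat rgraph" / partial:
  "\<lambda>G H. rooted_tree G \<and> rooted_tree H \<and> rgraph_iso G H"
proof (rule part_equivpI)
  show "\<exists>G::nat rgraph. rooted_tree G \<and> rooted_tree G \<and> rgraph_iso G G"
    by (intro exI conjI) (rule rooted_tree_singleton[of 0] rgraph_iso_refl)+
  show "symp (\<lambda>G H::nat rgraph. rooted_tree G \<and> rooted_tree H \<and> rgraph_iso G H)"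
  proof (rule sympI, elim conjE, intro conjI)
    fix G H :: "nat rgraph"
    assume "rooted_tree G" "rgraph_iso G H"
    then show "rgraph_iso H G" by (rule rgraph_iso_sym)
  qed assumption+
  show "transp (\<lambda>G H::nat rgraph. rooted_tree G \<and> rooted_tree H \<and> rgraph_iso G H)"
  proof (rule transpI, elim conjE, intro conjI)
    fix G H K :: "nat rgraph"
    assume "rgraph_iso G H" "rgraph_iso H K"
    then show "rgraph_iso G K" by (rule rgraph_iso_trans)
  qed assumption+
qed

text \<open>The counts below are taken on an arbitrary representative \<^term>\<open>rep_rtree t\<close>;
  they do not depend on its choice.\<close>

definition tree_size :: "rtree \<Rightarrow> nat" where
  "tree_size t = card (verts (rep_rtree t))"

definition rdeg :: "rtree \<Rightarrow> nat" where
  "rdeg t = card {e \<in> edges (rep_rtree t). rootv (rep_rtree t) \<in> e}"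

definition alpha :: "rtree \<Rightarrow> rtree \<Rightarrow> rtree \<Rightarrow> nat" where
  "alpha t1 t2 t3 =
     card {e \<in> edges (rep_rtree t2).
             rgraph_iso (root_part (rep_rtree t2) e) (rep_rtree t3) \<and>
             rgraph_iso (pruned_part (rep_rtree t2) e) (rep_rtree t1)}"

definition beta :: "rtree \<Rightarrow> rtree \<Rightarrow> rtree \<Rightarrow> nat" where
  "beta t1 t2 t3 =
     card {v \<in> verts (rep_rtree t3).
             rgraph_iso (rep_rtree t1) (graft (rep_rtree t3) v (rep_rtree t2))}"


section \<open>The insertion-elimination Lie algebra\<close>

datatype ie_gen = Dgen | Plus rtree | Minus rtree

type_synonym ie = "ie_gen \<Rightarrow>\<^sub>0 complex"

abbreviation basis_vec :: "ie_gen \<Rightarrow> complex \<Rightarrow> ie" where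
  "basis_vec g c \<equiv> Poly_Mapping.single g c"

definition ie_scale :: "complex \<Rightarrow> ie \<Rightarrow> ie" where
  "ie_scale c x = Poly_Mapping.map ((*) c) x"

lemma lookup_ie_scale: "Poly_Mapping.lookup (ie_scale c x) g = c * Poly_Mapping.lookup x g"
  unfolding ie_scale_def by transfer (simp add: when_def)

interpretation ie: vector_space ie_scale
proof (rule vector_space.intro)
  fix a b :: complex and x y :: ie
  show "ie_scale a (x + y) = ie_scale a x + ie_scale a y"
    by (rule poly_mapping_eqI) (simp only: lookup_ie_scale lookup_add distrib_left)
  show "ie_scale (a + b) x = ie_scale a x + ie_scale b x"
    by (rule poly_mapping_eqI) (simp only: lookup_ie_scale lookup_add distrib_right)
  show "ie_scale a (ie_scale b x) = ie_scale (a * b) x"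
    by (rule poly_mapping_eqI) (simp only: lookup_ie_scale mult.assoc)
  show "ie_scale 1 x = x"
    by (rule poly_mapping_eqI) (simp only: lookup_ie_scale mult_1_left)
qed

text \<open>All sums over trees have finite support: \<^term>\<open>alpha t1 t2 t3\<close> and \<^term>\<open>beta t2 t1 t3\<close>
  vanish unless the size of the second tree is the sum of the sizes of the other two.\<close>

fun gen_bracket :: "ie_gen \<Rightarrow> ie_gen \<Rightarrow> ie" where
  "gen_bracket (Plus s) (Plus t) =
     Sum_any (\<lambda>r. basis_vec (Plus r) (of_nat (beta r s t) - of_nat (beta r t s)))"
| "gen_bracket (Minus s) (Minus t) =
     Sum_any (\<lambda>r. basis_vec (Minus r) (of_nat (alpha t r s) - of_nat (alpha s r t)))"
| "gen_bracket (Minus s) (Plus t) =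
     (if s = t then basis_vec Dgen 1
      else Sum_any (\<lambda>r. basis_vec (Plus r) (of_nat (alpha s t r)))
         + Sum_any (\<lambda>r. basis_vec (Minus r) (of_nat (beta s t r))))"
| "gen_bracket (Plus t) (Minus s) =
     - (if s = t then basis_vec Dgen 1
        else Sum_any (\<lambda>r. basis_vec (Plus r) (of_nat (alpha s t r)))
           + Sum_any (\<lambda>r. basis_vec (Minus r) (of_nat (beta s t r))))"
| "gen_bracket Dgen (Minus t) = basis_vec (Minus t) (- of_nat (tree_size t))"
| "gen_bracket Dgen (Plus t) = basis_vec (Plus t) (of_nat (tree_size t))"
| "gen_bracket (Minus t) Dgen = basis_vec (Minus t) (of_nat (tree_size t))"
| "gen_bracket (Plus t) Dgen = basis_vec (Plus t) (- of_nat (tree_size t))"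
| "gen_bracket Dgen Dgen = 0"

definition ie_bracket :: "ie \<Rightarrow> ie \<Rightarrow> ie" where
  "ie_bracket x y =
     (\<Sum>a\<in>Poly_Mapping.keys x. \<Sum>b\<in>Poly_Mapping.keys y.
        ie_scale (Poly_Mapping.lookup x a * Poly_Mapping.lookup y b) (gen_bracket a b))"

definition n_plus :: "ie set" where
  "n_plus = ie.span (range (\<lambda>t. basis_vec (Plus t) 1))"


section \<open>Universal enveloping algebras\<close>

datatype 'a fmon = FMon (letters: "'a list")

instantiation fmon :: (type) monoid_add
begin
definition "0 = FMon []"
definition "u + v = FMon (letters u @ letters v)"
instance
  by standard (simp_all add: zero_fmon_def plus_fmon_def)
end

definition free_algebra :: "'g set \<Rightarrow> ('g fmon \<Rightarrow>\<^sub>0 complex) ring" where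
  "free_algebra L =
     \<lparr>carrier = {p. \<forall>w\<in>Poly_Mapping.keys p. set (letters w) \<subseteq> L},
      monoid.mult = (*), one = 1, ring.zero = 0, add = (+)\<rparr>"

definition fgen :: "'g \<Rightarrow> 'g fmon \<Rightarrow>\<^sub>0 complex" where
  "fgen x = Poly_Mapping.single (FMon [x]) 1"

definition fconst :: "complex \<Rightarrow> 'g fmon \<Rightarrow>\<^sub>0 complex" where
  "fconst c = Poly_Mapping.single 0 c"

text \<open>Below, \<open>L\<close> is a Lie subalgebra of the type \<^typ>\<open>'g\<close> with scalar multiplication \<open>sc\<close> and
  bracket \<open>br\<close>.  The free algebra is generated by the \<^emph>\<open>set\<close> \<open>L\<close>; its quotient by the linearity
  relations (the first two families) is the tensor algebra of the vector space \<open>L\<close>.\<close>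

definition env_relations ::
  "(complex \<Rightarrow> 'g::ab_group_add \<Rightarrow> 'g) \<Rightarrow> ('g \<Rightarrow> 'g \<Rightarrow> 'g) \<Rightarrow> 'g set \<Rightarrow> ('g fmon \<Rightarrow>\<^sub>0 complex) set" where
  "env_relations sc br L =
     {fgen (x + y) - fgen x - fgen y | x y. x \<in> L \<and> y \<in> L} \<union>
     {fgen (sc c x) - fconst c * fgen x | c x. x \<in> L} \<union>
     {fgen x * fgen y - fgen y * fgen x - fgen (br x y) | x y. x \<in> L \<and> y \<in> L}"

definition env_ideal ::
  "(complex \<Rightarrow> 'g::ab_group_add \<Rightarrow> 'g) \<Rightarrow> ('g \<Rightarrow> 'g \<Rightarrow> 'g) \<Rightarrow> 'g set \<Rightarrow> ('g fmon \<Rightarrow>\<^sub>0 complex) set" where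
  "env_ideal sc br L = genideal (free_algebra L) (env_relations sc br L)"

type_synonym 'g env = "('g fmon \<Rightarrow>\<^sub>0 complex) set"

definition env ::
  "(complex \<Rightarrow> 'g::ab_group_add \<Rightarrow> 'g) \<Rightarrow> ('g \<Rightarrow> 'g \<Rightarrow> 'g) \<Rightarrow> 'g set \<Rightarrow> 'g env ring" where
  "env sc br L = free_algebra L Quot env_ideal sc br L"

definition env_class ::
  "(complex \<Rightarrow> 'g::ab_group_add \<Rightarrow> 'g) \<Rightarrow> ('g \<Rightarrow> 'g \<Rightarrow> 'g) \<Rightarrow> 'g set \<Rightarrow> ('g fmon \<Rightarrow>\<^sub>0 complex) \<Rightarrow> 'g env" where
  "env_class sc br L p = env_ideal sc br L +>\<^bsub>free_algebra L\<^esub> p"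

text \<open>The homomorphism \<open>U(N) \<rightarrow> U(L)\<close> induced by an inclusion \<open>N \<subseteq> L\<close>, on cosets.\<close>

definition env_incl ::
  "(complex \<Rightarrow> 'g::ab_group_add \<Rightarrow> 'g) \<Rightarrow> ('g \<Rightarrow> 'g \<Rightarrow> 'g) \<Rightarrow> 'g set \<Rightarrow> 'g env \<Rightarrow> 'g env" where
  "env_incl sc br L A = (\<Union>p\<in>A. env_class sc br L p)"

text \<open>A Lie algebra homomorphism from \<open>N\<close> to the abelian Lie algebra of complex numbers;
  values outside \<open>N\<close> are irrelevant.\<close>

definition lie_character ::
  "(complex \<Rightarrow> 'g::ab_group_add \<Rightarrow> 'g) \<Rightarrow> ('g \<Rightarrow> 'g \<Rightarrow> 'g) \<Rightarrow> 'g set \<Rightarrow> ('g \<Rightarrow> complex) \<Rightarrow> bool" where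
  "lie_character sc br N \<eta> \<longleftrightarrow>
     (\<forall>x\<in>N. \<forall>y\<in>N. \<eta> (x + y) = \<eta> x + \<eta> y) \<and>
     (\<forall>c. \<forall>x\<in>N. \<eta> (sc c x) = c * \<eta> x) \<and>
     (\<forall>x\<in>N. \<forall>y\<in>N. \<eta> (br x y) = 0)"

definition free_eval :: "('g \<Rightarrow> complex) \<Rightarrow> ('g fmon \<Rightarrow>\<^sub>0 complex) \<Rightarrow> complex" where
  "free_eval \<eta> p =
     (\<Sum>w\<in>Poly_Mapping.keys p. Poly_Mapping.lookup p w * prod_list (map \<eta> (letters w)))"

text \<open>The action of \<open>U(N)\<close> on the one-dimensional module given by \<open>\<eta>\<close>; if \<open>\<eta>\<close> is a character
  of \<open>N\<close>, \<^term>\<open>free_eval \<eta>\<close> is constant on each coset.\<close>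

definition char_act :: "('g \<Rightarrow> complex) \<Rightarrow> 'g env \<Rightarrow> complex \<Rightarrow> complex" where
  "char_act \<eta> A z = the_elem (free_eval \<eta> ` A) * z"


section \<open>Tensor products over a noncommutative ring\<close>

text \<open>\<open>A\<close> is a right and \<open>B\<close> a left module over a ring with carrier \<open>R\<close>, the actions being
  \<open>ra\<close> and \<open>la\<close>; only the additive structures of \<open>A\<close> and \<open>B\<close> are used.\<close>

definition tensor_relations ::
  "('a, 'x) ring_scheme \<Rightarrow> ('b, 'y) ring_scheme \<Rightarrow> 'r set \<Rightarrow> ('a \<Rightarrow> 'r \<Rightarrow> 'a) \<Rightarrow> ('r \<Rightarrow> 'b \<Rightarrow> 'b)
     \<Rightarrow> ('a \<times> 'b \<Rightarrow>\<^sub>0 int) set" where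
  "tensor_relations A B R ra la =
     {frag_of (a \<oplus>\<^bsub>A\<^esub> a', b) - frag_of (a, b) - frag_of (a', b) | a a' b.
        a \<in> carrier A \<and> a' \<in> carrier A \<and> b \<in> carrier B} \<union>
     {frag_of (a, b \<oplus>\<^bsub>B\<^esub> b') - frag_of (a, b) - frag_of (a, b') | a b b'.
        a \<in> carrier A \<and> b \<in> carrier B \<and> b' \<in> carrier B} \<union>
     {frag_of (ra a r, b) - frag_of (a, la r b) | a r b.
        a \<in> carrier A \<and> r \<in> R \<and> b \<in> carrier B}"

definition tensor_kernel ::
  "('a, 'x) ring_scheme \<Rightarrow> ('b, 'y) ring_scheme \<Rightarrow> 'r set \<Rightarrow> ('a \<Rightarrow> 'r \<Rightarrow> 'a) \<Rightarrow> ('r \<Rightarrow> 'b \<Rightarrow> 'b)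
     \<Rightarrow> ('a \<times> 'b \<Rightarrow>\<^sub>0 int) set" where
  "tensor_kernel A B R ra la =
     generate (free_Abelian_group (carrier A \<times> carrier B)) (tensor_relations A B R ra la)"

definition tensor_product ::
  "('a, 'x) ring_scheme \<Rightarrow> ('b, 'y) ring_scheme \<Rightarrow> 'r set \<Rightarrow> ('a \<Rightarrow> 'r \<Rightarrow> 'a) \<Rightarrow> ('r \<Rightarrow> 'b \<Rightarrow> 'b)
     \<Rightarrow> ('a \<times> 'b \<Rightarrow>\<^sub>0 int) set monoid" where
  "tensor_product A B R ra la =
     free_Abelian_group (carrier A \<times> carrier B) Mod tensor_kernel A B R ra la"

text \<open>The map induced by \<open>f\<close> acting on the left factor, \<open>a \<otimes> b \<mapsto> f a \<otimes> b\<close>, on cosets.\<close>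

definition tensor_map_left ::
  "('a, 'x) ring_scheme \<Rightarrow> ('b, 'y) ring_scheme \<Rightarrow> 'r set \<Rightarrow> ('a \<Rightarrow> 'r \<Rightarrow> 'a) \<Rightarrow> ('r \<Rightarrow> 'b \<Rightarrow> 'b)
     \<Rightarrow> ('a \<Rightarrow> 'a) \<Rightarrow> ('a \<times> 'b \<Rightarrow>\<^sub>0 int) set \<Rightarrow> ('a \<times> 'b \<Rightarrow>\<^sub>0 int) set" where
  "tensor_map_left A B R ra la f X =
     (\<Union>p\<in>X. tensor_kernel A B R ra la
        #>\<^bsub>free_Abelian_group (carrier A \<times> carrier B)\<^esub>
          frag_extend (\<lambda>(a, b). frag_of (f a, b)) p)"


section \<open>Modules over a complex Lie algebra\<close>

definition complex_ring :: "complex ring" where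
  "complex_ring = \<lparr>carrier = UNIV, monoid.mult = (*), one = 1, ring.zero = 0, add = (+)\<rparr>"

definition lie_module ::
  "(complex \<Rightarrow> 'g::ab_group_add \<Rightarrow> 'g) \<Rightarrow> ('g \<Rightarrow> 'g \<Rightarrow> 'g) \<Rightarrow> (complex, 'm) module
     \<Rightarrow> ('g \<Rightarrow> 'm \<Rightarrow> 'm) \<Rightarrow> bool" where
  "lie_module sc br M act \<longleftrightarrow>
     Module.module complex_ring M \<and>
     (\<forall>x. \<forall>m\<in>carrier M. act x m \<in> carrier M) \<and>
     (\<forall>x. \<forall>m\<in>carrier M. \<forall>m'\<in>carrier M. act x (m \<oplus>\<^bsub>M\<^esub> m') = act x m \<oplus>\<^bsub>M\<^esub> act x m') \<and>
     (\<forall>x c. \<forall>m\<in>carrier M. act x (c \<odot>\<^bsub>M\<^esub> m) = c \<odot>\<^bsub>M\<^esub> act x m) \<and>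
     (\<forall>x y. \<forall>m\<in>carrier M. act (x + y) m = act x m \<oplus>\<^bsub>M\<^esub> act y m) \<and>
     (\<forall>c x. \<forall>m\<in>carrier M. act (sc c x) m = c \<odot>\<^bsub>M\<^esub> act x m) \<and>
     (\<forall>x y. \<forall>m\<in>carrier M. act (br x y) m = act x (act y m) \<ominus>\<^bsub>M\<^esub> act y (act x m))"

definition lie_submodule :: "(complex, 'm) module \<Rightarrow> ('g \<Rightarrow> 'm \<Rightarrow> 'm) \<Rightarrow> 'm set \<Rightarrow> bool" where
  "lie_submodule M act S \<longleftrightarrow> submodule S complex_ring M \<and> (\<forall>x. \<forall>m\<in>S. act x m \<in> S)"

definition simple_lie_module ::
  "(complex \<Rightarrow> 'g::ab_group_add \<Rightarrow> 'g) \<Rightarrow> ('g \<Rightarrow> 'g \<Rightarrow> 'g) \<Rightarrow> (complex, 'm) module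
     \<Rightarrow> ('g \<Rightarrow> 'm \<Rightarrow> 'm) \<Rightarrow> bool" where
  "simple_lie_module sc br M act \<longleftrightarrow>
     lie_module sc br M act \<and> carrier M \<noteq> {\<zero>\<^bsub>M\<^esub>} \<and>
     (\<forall>S. lie_submodule M act S \<longrightarrow> S = {\<zero>\<^bsub>M\<^esub>} \<or> S = carrier M)"

definition whittaker_vectors ::
  "'g set \<Rightarrow> ('g \<Rightarrow> complex) \<Rightarrow> (complex, 'm) module \<Rightarrow> ('g \<Rightarrow> 'm \<Rightarrow> 'm) \<Rightarrow> 'm set" where
  "whittaker_vectors N \<eta> M act = {v \<in> carrier M. \<forall>x\<in>N. act x v = \<eta> x \<odot>\<^bsub>M\<^esub> v}"

definition one_dimensional :: "(complex, 'm) module \<Rightarrow> 'm set \<Rightarrow> bool" where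
  "one_dimensional M W \<longleftrightarrow>
     submodule W complex_ring M \<and> (\<exists>w\<in>W. w \<noteq> \<zero>\<^bsub>M\<^esub> \<and> W = {c \<odot>\<^bsub>M\<^esub> w | c. True})"


section \<open>The standard Whittaker module\<close>

text \<open>The tensor product of \<open>U(g)\<close>, as a right \<open>U(n\<^sup>+)\<close>-module, with the one-dimensional module
  given by \<open>\<eta>\<close>. It is a left \<open>U(g)\<close>-module via the left factor; scalars and elements of \<open>g\<close>
  act through their images in \<open>U(g)\<close>.\<close>

abbreviation U_g :: "ie env ring" where
  "U_g \<equiv> env ie_scale ie_bracket UNIV"

abbreviation U_n_plus :: "ie env ring" where
  "U_n_plus \<equiv> env ie_scale ie_bracket n_plus"

definition U_right_act :: "ie env \<Rightarrow> ie env \<Rightarrow> ie env" where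
  "U_right_act u a = u \<otimes>\<^bsub>U_g\<^esub> env_incl ie_scale ie_bracket UNIV a"

type_synonym whit = "(ie env \<times> complex \<Rightarrow>\<^sub>0 int) set"

definition whit_tensor :: "(ie \<Rightarrow> complex) \<Rightarrow> whit monoid" where
  "whit_tensor \<eta> =
     tensor_product U_g complex_ring (carrier U_n_plus) U_right_act (char_act \<eta>)"

definition whit_U_act :: "(ie \<Rightarrow> complex) \<Rightarrow> ie env \<Rightarrow> whit \<Rightarrow> whit" where
  "whit_U_act \<eta> u =
     tensor_map_left U_g complex_ring (carrier U_n_plus) U_right_act (char_act \<eta>)
       (\<lambda>a. u \<otimes>\<^bsub>U_g\<^esub> a)"

text \<open>The fields \<open>mult\<close> and \<open>one\<close> of the library's module record play no role for modules.\<close>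

definition whit_module :: "(ie \<Rightarrow> complex) \<Rightarrow> (complex, whit) module" where
  "whit_module \<eta> =
     \<lparr>carrier = carrier (whit_tensor \<eta>), monoid.mult = undefined, one = undefined,
      ring.zero = \<one>\<^bsub>whit_tensor \<eta>\<^esub>, add = monoid.mult (whit_tensor \<eta>),
      smult = (\<lambda>c. whit_U_act \<eta> (env_class ie_scale ie_bracket UNIV (fconst c)))\<rparr>"

definition whit_act :: "(ie \<Rightarrow> complex) \<Rightarrow> ie \<Rightarrow> whit \<Rightarrow> whit" where
  "whit_act \<eta> x = whit_U_act \<eta> (env_class ie_scale ie_bracket UNIV (fgen x))"

definition root_bounded :: "(ie \<Rightarrow> complex) \<Rightarrow> bool" where
  "root_bounded \<eta> \<longleftrightarrow> (\<exists>M::nat>0. \<forall>t. rdeg t \<ge> M \<longrightarrow> \<eta> (basis_vec (Plus t) 1) = 0)"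

end

theory Submission
  imports Defs "HOL-Library.Multiset_Order" "HOL-Library.Function_Algebras"
    "HOL-Computational_Algebra.Polynomial"
begin

text \<open>
  Write \<open>w\<close> for the generator of the module. It is spanned by the vectors
  \<open>D\<^sub>s\<^sup>- \<dots> D\<^sub>t\<^sup>- p(d) w\<close>, where \<open>p\<close> is a polynomial and the trees \<open>s, \<dots>, t\<close> are listed in a fixed
  order. If \<open>t\<close> is larger than the total size of the trees in such a monomial, then \<open>D\<^sub>t\<^sup>+\<close> can be
  moved to the right through it, and it turns into the operators of the trees obtained from \<open>t\<close> by
  cutting some of the listed trees off. Cutting a branch off at the root lowers the root degree by
  one and any other cut preserves it. So if \<open>t\<close> is a tree at which \<open>\<eta>\<close> does not vanish, of extremal
  root degree, with the branches of a leading monomial added at the root, then \<open>D\<^sub>t\<^sup>+\<close> maps a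
  combination of monomials to \<open>q(d) w\<close> with \<open>q \<noteq> 0\<close>, while \<open>\<eta>\<close> vanishes at \<open>t\<close>. Here
  "extremal" refers to the largest root degree that occurs for trees of unbounded size with
  \<open>\<eta> \<noteq> 0\<close>, or, if the sizes are bounded, to the largest root degree among the trees of largest size.
  The operators \<open>D\<^sub>t\<^sup>+ - \<eta>(D\<^sub>t\<^sup>+)\<close> lower the degree of \<open>q\<close> one by one, so every nonzero vector generates
  \<open>w\<close>, and every Whittaker vector is a multiple of \<open>w\<close>.

  It remains to see that \<open>w \<noteq> 0\<close>. Grafting and pruning make the span of all trees a module; there
  the positive part acts freely on the one-vertex tree, so the dual module contains a nonzero
  Whittaker vector of type \<open>\<eta>\<close>, and the standard module maps onto the submodule it generates.
\<close>

text \<open>The danger in the reduction is cancellation: different monomials, completed by different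
  trees with \<eta> \<noteq> 0, can contribute to the action of one and the same
  \<open>D\<^sub>t\<^sup>+\<close>. Reading a monomial as the multiset of its letters and \<eta> as
  a generating series over multisets of branches, the contributions are coefficients of a product of
  series, and a leading term of each factor gives a tree \<open>t\<close> at which only one pair
  survives.

  The coefficients are kept as formal polynomials in d, and the monomials are only shown to span. A
  combination with nonzero formal coefficients is still carried to a nonzero multiple of w, so
  linear independence becomes a consequence of w \<noteq> 0.

  The nonzero Whittaker vector is sought among all functions on trees because grafting raises the
  size: on finite combinations of trees \<open>D\<^sub>t\<^sup>+\<close> has no nonzero eigenvalue,
  whereas the conditions on a function with infinite support can be solved by recursion on the
  number of branches at the root.\<close>

section \<open>Trees as nested multisets\<close>

datatype rt = Node (branches: "rt multiset")

definition leaf :: rt where "leaf = Node {#}"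

definition attach :: "rt \<Rightarrow> rt \<Rightarrow> rt" (infixl "\<star>" 75) where
  "u \<star> x = Node (add_mset x (branches u))"

lemma attach_Node [simp]: "Node F \<star> x = Node (add_mset x F)"
  by (simp add: attach_def)

lemma branches_attach [simp]: "branches (u \<star> x) = add_mset x (branches u)"
  by (simp add: attach_def)

lemma branches_leaf [simp]: "branches leaf = {#}"
  by (simp add: leaf_def)

lemma attach_commute: "u \<star> x \<star> y = u \<star> y \<star> x"
  by (simp add: attach_def add_mset_commute)

text \<open>Isomorphism of rooted trees has become equality, and \<open>leaf\<close> and
  \<open>attach\<close> generate everything. Induction along \<open>attach\<close> has two
  hypotheses, one for each end of the new edge, so every sum over vertices or edges splits
  linearly.\<close>

lemma rt_induct [case_names leaf attach]:
  assumes "P leaf" "\<And>u x. P u \<Longrightarrow> P x \<Longrightarrow> P (u \<star> x)"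
  shows "P t"
proof (induction t)
  case (Node F)
  then show ?case
  proof (induction F)
    case empty
    then show ?case using assms(1) by (simp add: leaf_def)
  next
    case (add x F)
    then show ?case using assms(2)[of "Node F" x] by auto
  qed
qed

primrec rsize :: "rt \<Rightarrow> nat" where
  "rsize (Node F) = Suc (\<Sum>\<^sub># (image_mset rsize F))"

lemma rsize_leaf [simp]: "rsize leaf = 1"
  by (simp add: leaf_def)

lemma rsize_attach [simp]: "rsize (u \<star> x) = rsize u + rsize x"
  by (cases u) simp

lemma rsize_pos [simp]: "rsize u > 0"
  by (cases u) simp

text \<open>One entry for each vertex of the second argument, so that the multiplicities are the
  numbers \<open>beta\<close>. Likewise \<open>cuts\<close> below has one entry for each edge, the
  pair of pruned part and root part, and its multiplicities are the numbers
  \<open>alpha\<close>.\<close>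

function ins :: "rt \<Rightarrow> rt \<Rightarrow> rt multiset" where
  "ins t (Node F) = add_mset (Node (add_mset t F))
     (\<Sum>c\<in>#F. image_mset (\<lambda>c'. Node (add_mset c' (F - {#c#}))) (ins t c))"
  by pat_completeness auto
termination
  by (relation "measure (\<lambda>(t, u). rsize u)") (auto dest!: multi_member_split)

function cuts :: "rt \<Rightarrow> (rt \<times> rt) multiset" where
  "cuts (Node F) =
     (\<Sum>c\<in>#F. add_mset (c, Node (F - {#c#}))
        (image_mset (\<lambda>(p, q). (p, Node (add_mset q (F - {#c#})))) (cuts c)))"
  by pat_completeness auto
termination
  by (relation "measure rsize") (auto dest!: multi_member_split)

declare ins.simps [simp del] cuts.simps [simp del]

lemma ins_leaf: "ins t leaf = {#leaf \<star> t#}"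
  by (simp add: leaf_def ins.simps)

lemma cuts_leaf: "cuts leaf = {#}"
  by (simp add: leaf_def cuts.simps)

lemma add_mset_minus: "c \<in># F \<Longrightarrow> add_mset x F - {#c#} = add_mset x (F - {#c#})"
  by (auto dest!: multi_member_split)

lemma image_mset_sum_mset:
  "image_mset f (\<Sum>c\<in>#M. g c) = (\<Sum>c\<in>#M. image_mset f (g c))"
  by (induction M) auto

text \<open>The vertices of \<open>u \<star> x\<close> are those of \<open>u\<close> and those of
  \<open>x\<close>, so grafting obeys a Leibniz rule.\<close>

lemma ins_attach:
  "ins t (u \<star> x) = image_mset (\<lambda>a. a \<star> x) (ins t u) + image_mset (\<lambda>b. u \<star> b) (ins t x)"
proof (cases u)
  case (Node F)
  have "(\<Sum>c\<in>#F. image_mset (\<lambda>c'. Node (add_mset c' (add_mset x F - {#c#}))) (ins t c))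
      = (\<Sum>c\<in>#F. image_mset (\<lambda>a. a \<star> x) (image_mset (\<lambda>c'. Node (add_mset c' (F - {#c#}))) (ins t c)))"
    by (intro arg_cong[of _ _ sum_mset] image_mset_cong)
       (auto simp: add_mset_minus image_mset.compositionality comp_def add_mset_commute)
  moreover have "\<dots> = image_mset (\<lambda>a. a \<star> x)
      (\<Sum>c\<in>#F. image_mset (\<lambda>c'. Node (add_mset c' (F - {#c#}))) (ins t c))"
    by (simp add: image_mset_sum_mset)
  ultimately show ?thesis
    by (simp add: Node ins.simps[of t "add_mset x F"] ins.simps[of t F] add_mset_commute)
qed

text \<open>Besides the edges of \<open>u\<close> and of \<open>x\<close> there is the new one,
  whose removal separates \<open>x\<close> from \<open>u\<close>; this is the inhomogeneous
  term.\<close>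

lemma cuts_attach:
  "cuts (u \<star> x) = add_mset (x, u) (image_mset (\<lambda>(p, q). (p, q \<star> x)) (cuts u)
     + image_mset (\<lambda>(p, q). (p, u \<star> q)) (cuts x))"
proof (cases u)
  case (Node F)
  let ?g = "\<lambda>F c. add_mset (c, Node (F - {#c#}))
        (image_mset (\<lambda>(p, q). (p, Node (add_mset q (F - {#c#})))) (cuts c))"
  have "(\<Sum>c\<in>#F. ?g (add_mset x F) c)
      = (\<Sum>c\<in>#F. image_mset (\<lambda>(p, q). (p, q \<star> x)) (?g F c))"
    by (intro arg_cong[of _ _ sum_mset] image_mset_cong)
       (auto simp: add_mset_minus image_mset.compositionality comp_def add_mset_commute
         case_prod_unfold intro!: image_mset_cong)
  moreover have "\<dots> = image_mset (\<lambda>(p, q). (p, q \<star> x)) (\<Sum>c\<in>#F. ?g F c)"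
    by (simp only: image_mset_sum_mset)
  ultimately show ?thesis
    by (simp add: Node cuts.simps[of "add_mset x F"] cuts.simps[of F] ac_simps)
qed

text \<open>Sums over grafts are taken in continuation form, with an arbitrary summand: iterated
  operations become nested functionals, and one definition serves for numbers and for elements of
  the Lie algebra.\<close>

definition insum :: "rt \<Rightarrow> rt \<Rightarrow> (rt \<Rightarrow> 'a::comm_monoid_add) \<Rightarrow> 'a" where
  "insum t u \<phi> = (\<Sum>a\<in>#ins t u. \<phi> a)"

definition cutsum :: "rt \<Rightarrow> (rt \<Rightarrow> rt \<Rightarrow> 'a::comm_monoid_add) \<Rightarrow> 'a" where
  "cutsum u \<psi> = (\<Sum>(p, q)\<in>#cuts u. \<psi> p q)"

lemma cutsum_zero [simp]: "cutsum u (\<lambda>p q. 0) = 0"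
  by (simp add: cutsum_def case_prod_unfold)

lemma insum_leaf: "insum t leaf \<phi> = \<phi> (leaf \<star> t)"
  by (simp add: insum_def ins_leaf)

lemma insum_attach:
  "insum t (u \<star> x) \<phi> = insum t u (\<lambda>a. \<phi> (a \<star> x)) + insum t x (\<lambda>b. \<phi> (u \<star> b))"
  by (simp add: insum_def ins_attach image_mset.compositionality comp_def)

lemma cutsum_leaf: "cutsum leaf \<psi> = 0"
  by (simp add: cutsum_def cuts_leaf)

lemma cutsum_attach:
  "cutsum (u \<star> x) \<psi> = \<psi> x u + cutsum u (\<lambda>p q. \<psi> p (q \<star> x)) + cutsum x (\<lambda>p q. \<psi> p (u \<star> q))"
  by (simp add: cutsum_def cuts_attach image_mset.compositionality comp_def case_prod_unfold add.assoc)

lemma insum_add: "insum t u (\<lambda>a. \<phi> a + \<psi> a) = insum t u \<phi> + insum t u \<psi>"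
  by (simp add: insum_def sum_mset.distrib)

lemma cutsum_add: "cutsum u (\<lambda>p q. \<phi> p q + \<psi> p q) = cutsum u \<phi> + cutsum u \<psi>"
  by (simp add: cutsum_def sum_mset.distrib case_prod_unfold)

lemma insum_swap: "insum t u (\<lambda>a. insum s v (\<lambda>b. \<phi> a b)) = insum s v (\<lambda>b. insum t u (\<lambda>a. \<phi> a b))"
  unfolding insum_def by (rule sum_mset.swap)

lemma insum_cutsum_swap:
  "insum t u (\<lambda>a. cutsum v (\<lambda>p q. \<phi> a p q)) = cutsum v (\<lambda>p q. insum t u (\<lambda>a. \<phi> a p q))"
  unfolding insum_def cutsum_def case_prod_unfold by (rule sum_mset.swap)

lemma cutsum_swap:
  "cutsum u (\<lambda>a b. cutsum v (\<lambda>p q. \<phi> a b p q)) = cutsum v (\<lambda>p q. cutsum u (\<lambda>a b. \<phi> a b p q))"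
  unfolding cutsum_def case_prod_unfold by (rule sum_mset.swap)

section \<open>The quadratic identities of grafting and cutting\<close>

text \<open>Grafting \<open>t\<close> and then \<open>s\<close> puts both on vertices of
  \<open>u\<close>, which is symmetric, or puts \<open>s\<close> on a vertex of \<open>t\<close>.
  Adding the other nesting makes the sum symmetric. This is the pre-Lie law behind the bracket of
  two positive generators.\<close>

lemma pre_Lie:
  fixes \<phi> :: "rt \<Rightarrow> complex"
  shows "insum t u (\<lambda>a. insum s a \<phi>) + insum t s (\<lambda>r. insum r u \<phi>)
     = insum s u (\<lambda>a. insum t a \<phi>) + insum s t (\<lambda>r. insum r u \<phi>)"
proof (induction u arbitrary: \<phi> rule: rt_induct)
  case leaf
  show ?case
    by (simp add: insum_leaf insum_attach attach_commute ac_simps)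
next
  case (attach v x)
  show ?case
    using attach(1)[of "\<lambda>c. \<phi> (c \<star> x)"] attach(2)[of "\<lambda>c. \<phi> (v \<star> c)"]
    apply (simp only: insum_attach insum_add insum_swap[of t v s x "\<lambda>a b. \<phi> (a \<star> b)"] insum_swap[of s v t x "\<lambda>a b. \<phi> (a \<star> b)"])
    \<comment> \<open>A linear identity over the complex numbers, settled on real and imaginary
      parts, where \<open>linarith\<close> works.\<close>
    by (simp only: complex_eq_iff plus_complex.simps distrib_right) linarith
qed

text \<open>An edge of a graft of \<open>t\<close> on \<open>u\<close> is an edge of
  \<open>u\<close>, with \<open>t\<close> now on the root part or on the pruned part, or an edge of
  \<open>t\<close>, or the new edge. The new edge separates \<open>t\<close> from \<open>u\<close>,
  once for each vertex of \<open>u\<close>: this is where d comes from.\<close>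

lemma cutsum_insum:
  fixes \<psi> :: "rt \<Rightarrow> rt \<Rightarrow> complex"
  shows "insum t u (\<lambda>a. cutsum a \<psi>) =
    cutsum u (\<lambda>p q. insum t q (\<psi> p)) + cutsum u (\<lambda>p q. insum t p (\<lambda>r. \<psi> r q))
    + cutsum t (\<lambda>p q. insum q u (\<psi> p)) + of_nat (rsize u) * \<psi> t u"
proof (induction u arbitrary: \<psi> rule: rt_induct)
  case leaf
  show ?case
    by (simp add: insum_leaf cutsum_attach cutsum_leaf)
next
  case (attach v x)
  show ?case
    using attach(1)[of "\<lambda>p q. \<psi> p (q \<star> x)"] attach(2)[of "\<lambda>p q. \<psi> p (v \<star> q)"]
    apply (simp only: insum_attach cutsum_attach insum_add cutsum_add rsize_attach of_nat_add
      insum_cutsum_swap[of t v x "\<lambda>a p q. \<psi> p (a \<star> q)"] insum_cutsum_swap[of t x v "\<lambda>a p q. \<psi> p (q \<star> a)"])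
    by (simp only: complex_eq_iff plus_complex.simps distrib_right) linarith
qed

text \<open>Of two edges cut one after the other, the second in the root part left by the first,
  either neither lies below the other, and the order is immaterial, or the first lies below the
  second. The nested pairs are counted by cutting the pruned part again; adding them with the two
  pieces exchanged makes the sum symmetric.\<close>

lemma cutsum_cutsum:
  fixes \<psi> :: "rt \<Rightarrow> rt \<Rightarrow> rt \<Rightarrow> complex"
  shows "cutsum u (\<lambda>p q. cutsum q (\<psi> p)) + cutsum u (\<lambda>r q. cutsum r (\<lambda>a b. \<psi> b a q))
    = cutsum u (\<lambda>p q. cutsum q (\<lambda>p'. \<psi> p' p)) + cutsum u (\<lambda>r q. cutsum r (\<lambda>a b. \<psi> a b q))"
proof (induction u arbitrary: \<psi> rule: rt_induct)
  case leaf
  show ?case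
    by (simp add: cutsum_leaf)
next
  case (attach v x)
  show ?case
    using attach(1)[of "\<lambda>a b c. \<psi> a b (c \<star> x)"] attach(2)[of "\<lambda>a b c. \<psi> a b (v \<star> c)"]
    apply (simp only: cutsum_attach cutsum_add 
      cutsum_swap[of v x "\<lambda>a b p q. \<psi> a p (b \<star> q)"] cutsum_swap[of v x "\<lambda>a b p q. \<psi> p a (b \<star> q)"])
    by (simp only: complex_eq_iff plus_complex.simps distrib_right) linarith
qed

section \<open>The dual Whittaker functional\<close>

text \<open>In the tree \<open>Node F\<close> this is grafting at a vertex other than the root;
  \<open>insum_Node\<close> adds the root. It is the derivation on forests that extends grafting
  into a single tree.\<close>

definition inforest :: "rt \<Rightarrow> rt multiset \<Rightarrow> (rt multiset \<Rightarrow> 'a::comm_monoid_add) \<Rightarrow> 'a" where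
  "inforest t F \<phi> = (\<Sum>c\<in>#F. insum t c (\<lambda>c'. \<phi> (add_mset c' (F - {#c#}))))"

lemma sum_mset_cong: "(\<And>x. x \<in># M \<Longrightarrow> f x = g x) \<Longrightarrow> (\<Sum>x\<in>#M. f x) = (\<Sum>x\<in>#M. g x)"
  by (metis image_mset_cong)

lemma inforest_empty: "inforest t {#} \<phi> = 0"
  by (simp add: inforest_def)

lemma inforest_add:
  "inforest t (add_mset x F) \<phi> = insum t x (\<lambda>c. \<phi> (add_mset c F)) + inforest t F (\<lambda>H. \<phi> (add_mset x H))"
proof -
  have "(\<Sum>c\<in>#F. insum t c (\<lambda>c'. \<phi> (add_mset c' (add_mset x F - {#c#}))))
      = (\<Sum>c\<in>#F. insum t c (\<lambda>c'. \<phi> (add_mset x (add_mset c' (F - {#c#})))))"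
    by (intro sum_mset_cong) (simp add: add_mset_minus add_mset_commute)
  then show ?thesis
    by (simp add: inforest_def)
qed

lemma insum_Node: "insum t (Node F) \<phi> = \<phi> (Node (add_mset t F)) + inforest t F (\<lambda>H. \<phi> (Node H))"
proof (induction F arbitrary: \<phi>)
  case empty
  show ?case using insum_leaf[of t \<phi>] by (simp add: inforest_empty leaf_def)
next
  case (add x F)
  then show ?case
    using insum_attach[of t "Node F" x \<phi>] by (simp add: inforest_add add_mset_commute ac_simps)
qed

text \<open>Grafting into a forest keeps the number of its trees. \<open>whitl\<close> at level n is
  meant for forests of n trees, and this lemma is what lets it be unfolded under
  \<open>inforest\<close>.\<close>

lemma inforest_cong:
  assumes "\<And>H. size H = size F \<Longrightarrow> \<phi> H = \<psi> H"
  shows "inforest t F \<phi> = inforest t F \<psi>"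
  using assms
proof (induction F arbitrary: \<phi> \<psi>)
  case empty
  then show ?case by (simp add: inforest_empty)
next
  case (add x F)
  have "insum t x (\<lambda>c. \<phi> (add_mset c F)) = insum t x (\<lambda>c. \<psi> (add_mset c F))"
    by (auto simp: insum_def intro!: sum_mset_cong add.prems)
  moreover have "inforest t F (\<lambda>H. \<phi> (add_mset x H)) = inforest t F (\<lambda>H. \<psi> (add_mset x H))"
    by (intro add.IH add.prems) simp
  ultimately show ?case by (simp add: inforest_add)
qed

lemma insum_cmult: "insum t u (\<lambda>a. c * \<phi> a) = c * (insum t u \<phi> :: complex)"
  by (simp add: insum_def sum_mset_distrib_left)

lemma insum_multc: "insum t u (\<lambda>a. \<phi> a * c) = insum t u \<phi> * (c :: complex)"
  by (simp add: insum_def sum_mset_distrib_right)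

lemma insum_uminus: "insum t u (\<lambda>a. - \<phi> a) = - (insum t u \<phi> :: complex)"
  using insum_cmult[of t u "-1"] by simp

lemma insum_diff: "insum t u (\<lambda>a. \<phi> a - \<psi> a) = insum t u \<phi> - (insum t u \<psi> :: complex)"
  using insum_add[of t u \<phi> "\<lambda>a. - \<psi> a"] by (simp add: insum_uminus)

lemma inforest_plus:
  "inforest t F (\<lambda>a. \<phi> a + \<psi> a) = inforest t F \<phi> + (inforest t F \<psi> :: complex)"
  by (induction F arbitrary: \<phi> \<psi>) (simp_all add: inforest_empty inforest_add insum_add)

lemma inforest_cmult: "inforest t F (\<lambda>a. c * \<phi> a) = c * (inforest t F \<phi> :: complex)"
  by (induction F arbitrary: \<phi>) (simp_all add: inforest_empty inforest_add insum_cmult distrib_left)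

lemma inforest_diff:
  "inforest t F (\<lambda>a. \<phi> a - \<psi> a) = inforest t F \<phi> - (inforest t F \<psi> :: complex)"
  using inforest_plus[of t F \<phi> "\<lambda>a. - \<psi> a"] inforest_cmult[of t F "-1" \<psi>] by simp

lemma insum_inforest_swap:
  "insum t u (\<lambda>a. inforest s F (\<lambda>b. \<phi> a b)) = inforest s F (\<lambda>b. insum t u (\<lambda>a. \<phi> a b :: complex))"
proof (induction F arbitrary: \<phi>)
  case empty
  then show ?case by (simp add: inforest_empty insum_def)
next
  case (add x F)
  then show ?case by (simp add: inforest_add insum_add insum_swap[of t u s x])
qed

text \<open>Derivations that satisfy the pre-Lie relation on single trees satisfy it on forests,
  since graftings into different trees commute.\<close>

lemma pre_Lie_forest:
  fixes \<phi> :: "rt multiset \<Rightarrow> complex"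
  shows "inforest t F (\<lambda>H. inforest s H \<phi>) + insum t s (\<lambda>r. inforest r F \<phi>)
     = inforest s F (\<lambda>H. inforest t H \<phi>) + insum s t (\<lambda>r. inforest r F \<phi>)"
proof (induction F arbitrary: \<phi>)
  case empty
  show ?case
    by (simp add: inforest_empty insum_def)
next
  case (add x F)
  show ?case
    using add[of "\<lambda>H. \<phi> (add_mset x H)"] pre_Lie[of t x s "\<lambda>c. \<phi> (add_mset c F)"]
    apply (simp only: inforest_add insum_add inforest_plus
       insum_inforest_swap[of t x s F "\<lambda>c H. \<phi> (add_mset c H)"]
       insum_inforest_swap[of s x t F "\<lambda>c H. \<phi> (add_mset c H)"])
    by (simp only: complex_eq_iff plus_complex.simps) linarith
qed

text \<open>The span of all trees is a free module of rank one over the enveloping algebra of the positive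
  part, generated by \<open>leaf\<close>; so a character determines a functional on it, up to a scalar.  The
  recursion peels off one branch at a time, and \<open>whitl_add\<close> says that the choice of the branch
  does not matter.\<close>

primrec whitl :: "(rt \<Rightarrow> complex) \<Rightarrow> nat \<Rightarrow> rt multiset \<Rightarrow> complex" where
  "whitl \<eta> 0 = (\<lambda>F. 1)"
| "whitl \<eta> (Suc n) = (\<lambda>F. let t = (SOME t. t \<in># F); G = F - {#t#}
     in - \<eta> t * whitl \<eta> n G - inforest t G (whitl \<eta> n))"

lemma whitl_add:
  assumes "\<And>s t. insum s t \<eta> = insum t s \<eta>" "size G = n"
  shows "whitl \<eta> (Suc n) (add_mset t G) = - \<eta> t * whitl \<eta> n G - inforest t G (whitl \<eta> n)"
  using assms(2)
proof (induction n arbitrary: t G)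
  case 0
  then show ?case by (simp add: inforest_empty)
next
  case (Suc m)
  let ?f = "whitl \<eta> (Suc m)" and ?g = "whitl \<eta> m"
  define s where "s = (SOME s. s \<in># add_mset t G)"
  have s: "s \<in># add_mset t G"
    unfolding s_def by (rule someI[of _ t]) simp
  have def: "whitl \<eta> (Suc (Suc m)) (add_mset t G) = - \<eta> s * ?f (add_mset t G - {#s#})
      - inforest s (add_mset t G - {#s#}) ?f"
    unfolding whitl.simps(2)[of _ "Suc m"] Let_def s_def ..
  show ?case
  proof (cases "s = t")
    case True
    then show ?thesis using def by simp
  next
    case False
    then obtain H where H: "G = add_mset s H"
      using s by (metis insert_noteq_member multi_member_split)
    then have sz: "size H = m" using Suc.prems by simp
    \<comment> \<open>A second branch is unfolded: once both \<open>s\<close> and \<open>t\<close>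
      have been removed, the terms are symmetric in them by \<open>pre_Lie_forest\<close> and the
      symmetry of \<eta>, so either may be removed first.\<close>
    have exp: "inforest a (add_mset b H) ?f = - insum a b \<eta> * ?g H
        - insum a b (\<lambda>c. inforest c H ?g) - \<eta> b * inforest a H ?g
        - inforest a H (\<lambda>K. inforest b K ?g)" for a b
    proof -
      have "inforest a H (\<lambda>K. ?f (add_mset b K)) = inforest a H (\<lambda>K. - \<eta> b * ?g K - inforest b K ?g)"
        by (intro inforest_cong Suc.IH) (simp add: sz)
      moreover have "insum a b (\<lambda>c. ?f (add_mset c H)) = insum a b (\<lambda>c. - \<eta> c * ?g H - inforest c H ?g)"
        by (subst Suc.IH) (simp_all add: sz)
      ultimately show ?thesis
        unfolding inforest_add insum_diff inforest_diff inforest_cmult insum_multc insum_uminus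
        by simp
    qed
    have rem: "add_mset t G - {#s#} = add_mset t H"
      using False by (simp add: H)
    show ?thesis
      unfolding def rem unfolding H exp Suc.IH[OF sz]
      using pre_Lie_forest[of t H s ?g] assms(1)[of s t]
      by (simp add: algebra_simps)
  qed
qed

definition whitf :: "(rt \<Rightarrow> complex) \<Rightarrow> rt \<Rightarrow> complex" where
  "whitf \<eta> u = whitl \<eta> (size (branches u)) (branches u)"

text \<open>The graft at the root is evaluated by \<open>whitl_add\<close>, whose second term
  cancels all other grafts. In the dual action grafting carries a minus sign, so this is the
  Whittaker condition of type \<eta>.\<close>

lemma insum_whitf:
  assumes "\<And>s t. insum s t \<eta> = insum t s \<eta>"
  shows "insum t u (whitf \<eta>) = - \<eta> t * whitf \<eta> u"
proof (cases u)
  case (Node F)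
  have "inforest t F (\<lambda>H. whitf \<eta> (Node H)) = inforest t F (whitl \<eta> (size F))"
    by (rule inforest_cong) (simp add: whitf_def)
  then show ?thesis
    using whitl_add[of \<eta> F "size F" t] assms
    by (simp add: Node insum_Node whitf_def del: whitl.simps)
qed

lemma whitf_leaf: "whitf \<eta> leaf = 1"
  by (simp add: whitf_def)

section \<open>Joining graphs along an edge\<close>

text \<open>\<open>graft\<close> passes to a sum type; with both graphs on one vertex type,
  rearranging several joins is a literal equality.\<close>

definition join :: "'v rgraph \<Rightarrow> 'v \<Rightarrow> 'v rgraph \<Rightarrow> 'v rgraph" where
  "join G v H = \<lparr>verts = verts G \<union> verts H,
     edges = edges G \<union> edges H \<union> {{v, rootv H}}, rootv = rootv G\<rparr>"

lemma join_simps [simp]: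
  "verts (join G v H) = verts G \<union> verts H"
  "edges (join G v H) = edges G \<union> edges H \<union> {{v, rootv H}}"
  "rootv (join G v H) = rootv G"
  by (simp_all add: join_def)

lemma join_join_right: "join (join G v H) w K = join (join G w K) v H"
  by (auto simp: join_def)

lemma join_join_inner: "join G v (join H w K) = join (join G v H) w K"
  by (auto simp: join_def)

definition rename :: "('v \<Rightarrow> 'w) \<Rightarrow> 'v rgraph \<Rightarrow> 'w rgraph" where
  "rename f G = \<lparr>verts = f ` verts G, edges = (\<lambda>e. f ` e) ` edges G, rootv = f (rootv G)\<rparr>"

lemma rename_simps [simp]:
  "verts (rename f G) = f ` verts G"
  "edges (rename f G) = (\<lambda>e. f ` e) ` edges G"
  "rootv (rename f G) = f (rootv G)"
  by (simp_all add: rename_def)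

lemma rename_join: "rename f (join G v H) = join (rename f G) (f v) (rename f H)"
  by (auto simp: rename_def join_def)

lemma graft_eq_join: "graft G v H = join (rename Inl G) (Inl v) (rename Inr H)"
  by (simp add: graft_def join_def rename_def)

lemma rgraph_iso_iff_rename:
  "rgraph_iso G H \<longleftrightarrow> (\<exists>f. inj_on f (verts G) \<and> H = rename f G)"
  unfolding rgraph_iso_def rename_def bij_betw_def by (intro iff_exI, cases H) auto

section \<open>Reachability, cycles and joins\<close>

lemma reach_refl [simp]: "u \<in> reach E u"
  by (simp add: reach_def)

lemma reach_step: "w \<in> reach E u \<Longrightarrow> {w, z} \<in> E \<Longrightarrow> z \<in> reach E u"
  unfolding reach_def by (auto intro: rtrancl_into_rtrancl)

lemma reach_trans: "v \<in> reach E u \<Longrightarrow> w \<in> reach E v \<Longrightarrow> w \<in> reach E u"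
  unfolding reach_def by auto

lemma reach_sym: "w \<in> reach E u \<Longrightarrow> u \<in> reach E w"
proof -
  have "sym ({(x, y). {x, y} \<in> E})" by (auto simp: sym_def insert_commute)
  then show "w \<in> reach E u \<Longrightarrow> u \<in> reach E w"
    unfolding reach_def using symD[OF sym_rtrancl] by fastforce
qed

lemma reach_mono: "E \<subseteq> E' \<Longrightarrow> reach E u \<subseteq> reach E' u"
  unfolding reach_def using rtrancl_mono[of "{(x, y). {x, y} \<in> E}" "{(x, y). {x, y} \<in> E'}"] by blast

lemma reach_induct [consumes 1, case_names base step]:
  assumes "w \<in> reach E u" "P u" "\<And>y z. y \<in> reach E u \<Longrightarrow> P y \<Longrightarrow> {y, z} \<in> E \<Longrightarrow> P z"
  shows "P w"
proof -
  have "(u, w) \<in> {(x, y). {x, y} \<in> E}\<^sup>*" using assms(1) by (simp add: reach_def)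
  then show ?thesis
    by (induction rule: rtrancl_induct) (auto intro: assms(2,3) simp: reach_def)
qed

lemma rooted_treeD:
  assumes "rooted_tree G"
  shows "finite (verts G)" "rootv G \<in> verts G" "\<And>e. e \<in> edges G \<Longrightarrow> e \<subseteq> verts G"
    "\<And>e. e \<in> edges G \<Longrightarrow> card e = 2" "\<And>w. w \<in> verts G \<Longrightarrow> w \<in> reach (edges G) (rootv G)"
    "\<And>vs. \<not> cycle_in (edges G) vs" "finite (edges G)" "{} \<notin> edges G"
  using assms finite_subset[of "edges G" "Pow (verts G)"] unfolding rooted_tree_def by auto

lemma rooted_treeI:
  assumes "finite (verts G)" "rootv G \<in> verts G" "\<And>e. e \<in> edges G \<Longrightarrow> e \<subseteq> verts G \<and> card e = 2"
    "\<And>w. w \<in> verts G \<Longrightarrow> w \<in> reach (edges G) (rootv G)" "\<And>vs. \<not> cycle_in (edges G) vs"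
  shows "rooted_tree G"
  unfolding rooted_tree_def using assms reach_sym reach_trans by metis

text \<open>Otherwise the property would propagate from \<open>i\<close> all the way round.\<close>

lemma cyclic_crossing:
  fixes n :: nat
  assumes "i < n" "P i" "j < n" "\<not> P j"
  shows "\<exists>i<n. P i \<and> \<not> P (Suc i mod n)"
proof (rule ccontr)
  assume "\<not> ?thesis"
  then have step: "P (Suc i mod n)" if "P i" "i < n" for i using that by blast
  have "P ((i + k) mod n)" for k
  proof (induction k)
    case 0
    then show ?case using assms by simp
  next
    case (Suc k)
    then show ?case using step[OF Suc] assms(1) by (simp add: mod_Suc_eq)
  qed
  from this[of "n - i + j"] show False using assms by simp
qed

text \<open>A cycle that meets both sides must leave \<open>A\<close> and return to it, both times
  along the only joining edge. Since its vertices are distinct, the two crossings follow each other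
  in both directions, and the cycle would have length two.\<close>

lemma not_cycle_join:
  assumes "rooted_tree A" "rooted_tree B" "verts A \<inter> verts B = {}" "v \<in> verts A"
  shows "\<not> cycle_in (edges (join A v B)) vs"
proof
  let ?E = "edges (join A v B)" and ?n = "length vs"
  assume cyc: "cycle_in ?E vs"
  then have n: "3 \<le> ?n" and d: "distinct vs"
    and e: "\<And>i. i < ?n \<Longrightarrow> {vs ! i, vs ! (Suc i mod ?n)} \<in> ?E"
    by (auto simp: cycle_in_def)
  note A = rooted_treeD[OF assms(1)] and B = rooted_treeD[OF assms(2)]
  have inAB: "vs ! i \<in> verts A \<union> verts B" if "i < ?n" for i
    using e[OF that] A(2,3) B(2,3) assms(4) by (auto simp: doubleton_eq_iff)
  have AB: "vs ! i = v \<and> vs ! (Suc i mod ?n) = rootv B"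
    if "i < ?n" "vs ! i \<in> verts A" "vs ! (Suc i mod ?n) \<notin> verts A" for i
    using e[OF that(1)] that(2,3) A(3) B(2,3) assms(3,4) by (auto simp: doubleton_eq_iff)
  have BA: "vs ! i = rootv B \<and> vs ! (Suc i mod ?n) = v"
    if "i < ?n" "vs ! i \<notin> verts A" "\<not> vs ! (Suc i mod ?n) \<notin> verts A" for i
    using e[OF that(1)] that(2,3) A(3) B(2,3) assms(3,4) by (auto simp: doubleton_eq_iff)
  consider (a) "\<forall>i<?n. vs ! i \<in> verts A" | (b) "\<forall>i<?n. vs ! i \<notin> verts A"
    | (c) i j where "i < ?n" "j < ?n" "vs ! i \<in> verts A" "vs ! j \<notin> verts A" by blast
  then show False
  proof cases
    case a
    have "{vs ! i, vs ! (Suc i mod ?n)} \<in> edges A" if "i < ?n" for i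
    proof -
      have m: "Suc i mod ?n < ?n" using n by (intro mod_less_divisor) linarith
      then show ?thesis
        using e[OF that] a[rule_format, OF that] a[rule_format, OF m] B(2,3) assms(3,4)
        by (auto simp: doubleton_eq_iff)
    qed
    then have "cycle_in (edges A) vs" using n d by (simp add: cycle_in_def)
    then show False using A(6) by blast
  next
    case b
    have "{vs ! i, vs ! (Suc i mod ?n)} \<in> edges B" if "i < ?n" for i
    proof -
      have m: "Suc i mod ?n < ?n" using n by (intro mod_less_divisor) linarith
      then show ?thesis
        using e[OF that] b[rule_format, OF that] b[rule_format, OF m] A(2,3) assms(3,4)
        by (auto simp: doubleton_eq_iff)
    qed
    then have "cycle_in (edges B) vs" using n d by (simp add: cycle_in_def)
    then show False using B(6) by blast
  next
    case c
    obtain i' where i: "i' < ?n" "vs ! i' \<in> verts A" "vs ! (Suc i' mod ?n) \<notin> verts A"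
      using cyclic_crossing[of i ?n "\<lambda>i. vs ! i \<in> verts A" j] c by blast
    obtain j' where j: "j' < ?n" "vs ! j' \<notin> verts A" "\<not> vs ! (Suc j' mod ?n) \<notin> verts A"
      using cyclic_crossing[of j ?n "\<lambda>i. vs ! i \<notin> verts A" i] c by blast
    have mi: "Suc i' mod ?n < ?n" "Suc j' mod ?n < ?n" using n by (auto intro!: mod_less_divisor)
    have "Suc i' mod ?n = j'" "Suc j' mod ?n = i'"
      using AB[OF i] BA[OF j] d i(1) j(1) mi by (metis nth_eq_iff_index_eq)+
    then show False using n i(1) j(1) by (auto simp: mod_Suc split: if_splits)
  qed
qed

lemma rooted_tree_join:
  assumes "rooted_tree A" "rooted_tree B" "verts A \<inter> verts B = {}" "v \<in> verts A"
  shows "rooted_tree (join A v B)"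
proof (rule rooted_treeI)
  let ?E = "edges (join A v B)"
  note A = rooted_treeD[OF assms(1)] and B = rooted_treeD[OF assms(2)]
  show "finite (verts (join A v B))" "rootv (join A v B) \<in> verts (join A v B)" using A B by auto
  show "e \<subseteq> verts (join A v B) \<and> card e = 2" if "e \<in> edges (join A v B)" for e
  proof -
    have "v \<noteq> rootv B" using assms(3,4) B(2) by blast
    then show ?thesis using that A(3,4) B(2,3,4) assms(4) by auto
  qed
  have rA: "w \<in> reach ?E (rootv A)" if "w \<in> verts A" for w
    using A(5)[OF that] reach_mono[of "edges A" ?E] by auto
  have rB: "w \<in> reach ?E (rootv B)" if "w \<in> verts B" for w
    using B(5)[OF that] reach_mono[of "edges B" ?E] by auto
  have "rootv B \<in> reach ?E (rootv A)" by (rule reach_step[OF rA[OF assms(4)]]) simp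
  then show "w \<in> reach (edges (join A v B)) (rootv (join A v B))"
    if "w \<in> verts (join A v B)" for w
    using that rA reach_trans[OF _ rB] by (cases "w \<in> verts A") auto
  show "\<not> cycle_in (edges (join A v B)) vs" for vs by (rule not_cycle_join[OF assms])
qed

text \<open>The pieces come back as literal graphs, not just up to isomorphism, so they are
  determined by the graph and the edge; uniqueness of codes rests on this.\<close>

lemma join_parts:
  assumes "rooted_tree A" "rooted_tree B" "verts A \<inter> verts B = {}" "v \<in> verts A"
  shows "root_part (join A v B) {v, rootv B} = A" "pruned_part (join A v B) {v, rootv B} = B"
proof -
  note A = rooted_treeD[OF assms(1)] and B = rooted_treeD[OF assms(2)]
  let ?E = "edges (join A v B) - {{v, rootv B}}"
  have "{v, rootv B} \<notin> edges A" "{v, rootv B} \<notin> edges B"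
    using A(3) B(2,3) assms(3,4) by blast+
  then have E: "?E = edges A \<union> edges B" by auto
  have r: "reach ?E (rootv A) = verts A"
  proof
    show "reach ?E (rootv A) \<subseteq> verts A"
    proof
      fix w assume "w \<in> reach ?E (rootv A)"
      then show "w \<in> verts A"
      proof (induction rule: reach_induct)
        case base
        show ?case by (rule A(2))
      next
        case (step y z)
        then show ?case using A(3) B(3) assms(3) unfolding E by blast
      qed
    qed
    show "verts A \<subseteq> reach ?E (rootv A)"
      using A(5) reach_mono[of "edges A" ?E] unfolding E by blast
  qed
  have ne: "e \<notin> edges B" if "e \<subseteq> verts A" for e
  proof
    assume "e \<in> edges B"
    then have "e \<subseteq> verts A \<inter> verts B" "e \<noteq> {}" using that B(3,8) by auto
    then show False using assms(3) by simp
  qed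
  have ne': "e \<notin> edges A" if "e \<subseteq> verts B" for e
  proof
    assume "e \<in> edges A"
    then have "e \<subseteq> verts A \<inter> verts B" "e \<noteq> {}" using that A(3,8) by auto
    then show False using assms(3) by simp
  qed
  have eA: "{e' \<in> ?E. e' \<subseteq> verts A} = edges A"
    unfolding E by (intro equalityI subsetI) (use A(3) ne in auto)
  have eB: "{e' \<in> ?E. e' \<subseteq> verts B} = edges B"
    unfolding E by (intro equalityI subsetI) (use B(3) ne' in auto)
  show rp: "root_part (join A v B) {v, rootv B} = A"
    unfolding root_part_def Let_def join_simps(3) r eA by simp
  have W: "verts (join A v B) - verts A = verts B" using assms(3) by auto
  have "(THE w. w \<in> {v, rootv B} \<inter> verts B) = rootv B"
    using B(2) assms(3,4) by (intro the_equality) auto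
  then show "pruned_part (join A v B) {v, rootv B} = B"
    unfolding pruned_part_def Let_def rp W eB by simp
qed

section \<open>Coding rooted graphs by nested multisets\<close>

text \<open>A relation rather than a function, since a graph can be assembled from its branches in
  many orders; \<open>codes_exists\<close> and \<open>codes_unique\<close> supply existence and
  uniqueness.\<close>

inductive codes :: "'v rgraph \<Rightarrow> rt \<Rightarrow> bool" where
  leaf: "codes \<lparr>verts = {v}, edges = {}, rootv = v\<rparr> leaf"
| attach: "codes G u \<Longrightarrow> codes H x \<Longrightarrow> verts G \<inter> verts H = {} \<Longrightarrow> codes (join G (rootv G) H) (u \<star> x)"

lemma codes_rooted_tree: "codes G u \<Longrightarrow> rooted_tree G"
  by (induction rule: codes.induct)
     (auto intro: rooted_tree_singleton rooted_tree_join rooted_treeD(2))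

lemma codes_card: "codes G u \<Longrightarrow> card (verts G) = rsize u"
  by (induction rule: codes.induct)
     (auto simp: card_Un_disjoint rooted_treeD(1)[OF codes_rooted_tree])

lemma codes_rename: "codes G u \<Longrightarrow> inj_on f (verts G) \<Longrightarrow> codes (rename f G) u"
proof (induction rule: codes.induct)
  case (leaf v)
  then show ?case using codes.leaf[of "f v"] by (simp add: rename_def)
next
  case (attach G u H x)
  have inj: "inj_on f (verts G \<union> verts H)" using attach.prems by simp
  then have "inj_on f (verts G)" "inj_on f (verts H)" by (auto simp: inj_on_Un)
  moreover have "verts (rename f G) \<inter> verts (rename f H) = {}"
    using inj_on_image_Int[OF inj, of "verts G" "verts H"] attach.hyps by simp
  ultimately have "codes (join (rename f G) (rootv (rename f G)) (rename f H)) (u \<star> x)"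
    using attach.IH by (intro codes.attach)
  then show ?case by (simp add: rename_join)
qed

lemma codes_iso: "codes G u \<Longrightarrow> rgraph_iso G H \<Longrightarrow> codes H u"
  unfolding rgraph_iso_iff_rename using codes_rename by blast

text \<open>A step to a vertex that is already on the path truncates the path there.\<close>

lemma walk_distinct:
  assumes "w \<in> reach E u"
  shows "\<exists>vs. vs \<noteq> [] \<and> hd vs = u \<and> last vs = w \<and> distinct vs \<and>
    (\<forall>i. Suc i < length vs \<longrightarrow> {vs ! i, vs ! Suc i} \<in> E)"
  using assms
proof (induction rule: reach_induct)
  case base
  show ?case by (rule exI[of _ "[u]"]) simp
next
  case (step y z)
  then obtain vs where vs: "vs \<noteq> []" "hd vs = u" "last vs = y" "distinct vs"
    "\<forall>i. Suc i < length vs \<longrightarrow> {vs ! i, vs ! Suc i} \<in> E" by blast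
  show ?case
  proof (cases "z \<in> set vs")
    case True
    then obtain k where k: "k < length vs" "vs ! k = z" by (auto simp: in_set_conv_nth)
    show ?thesis
    proof (intro exI[of _ "take (Suc k) vs"] conjI)
      show "hd (take (Suc k) vs) = u" using vs by simp
      show "last (take (Suc k) vs) = z" using k by (simp add: take_Suc_conv_app_nth)
    qed (use vs k in auto)
  next
    case False
    have "{(vs @ [z]) ! i, (vs @ [z]) ! Suc i} \<in> E" if "Suc i < length (vs @ [z])" for i
    proof (cases "Suc i < length vs")
      case True
      then show ?thesis using vs(5) by (simp add: nth_append)
    next
      case False
      then have "i = length vs - 1" "length vs > 0" using that vs(1) by auto
      then show ?thesis using step.hyps(2) vs(1,3) by (simp add: nth_append last_conv_nth)
    qed
    then show ?thesis using vs False by (intro exI[of _ "vs @ [z]"]) simp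
  qed
qed

lemma cycle_in_mono: "cycle_in E vs \<Longrightarrow> E \<subseteq> E' \<Longrightarrow> cycle_in E' vs"
  unfolding cycle_in_def by blast

text \<open>A path between the ends that avoids the edge would close with it to a cycle. The path
  has at least three vertices, because the ends differ and a path of two vertices would be the
  removed edge itself.\<close>

lemma edge_is_bridge:
  assumes "rooted_tree G" "{a, b} \<in> edges G" "a \<noteq> b"
  shows "b \<notin> reach (edges G - {{a, b}}) a"
proof
  let ?E = "edges G - {{a, b}}"
  assume "b \<in> reach ?E a"
  then obtain vs where vs: "vs \<noteq> []" "hd vs = a" "last vs = b" "distinct vs"
    "\<forall>i. Suc i < length vs \<longrightarrow> {vs ! i, vs ! Suc i} \<in> ?E" using walk_distinct by metis
  have "length vs \<noteq> 1" using vs(1-3) assms(3) by (auto simp: length_Suc_conv)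
  moreover have "length vs \<noteq> 2"
    using vs(2,3,5) by (auto simp: length_Suc_conv numeral_2_eq_2)
  moreover have "length vs \<noteq> 0" using vs(1) by simp
  ultimately have n: "3 \<le> length vs" by linarith
  have "{vs ! i, vs ! (Suc i mod length vs)} \<in> edges G" if "i < length vs" for i
  proof (cases "Suc i < length vs")
    case True
    then show ?thesis using vs(5) by simp
  next
    case False
    then have i: "Suc i = length vs" "i = length vs - 1" using that by linarith+
    have "vs ! i = b" using vs(1,3) i(2) by (simp add: last_conv_nth)
    moreover have "vs ! (Suc i mod length vs) = a" using vs(1,2) i(1) by (simp add: hd_conv_nth)
    ultimately show ?thesis using assms(2) by (metis insert_commute)
  qed
  then have "cycle_in (edges G) vs" using n vs(4) by (simp add: cycle_in_def)
  then show False using rooted_treeD(6)[OF assms(1)] by blast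
qed

lemma rooted_tree_reach_part:
  assumes "rooted_tree G" "E \<subseteq> edges G" "r \<in> verts G"
  shows "rooted_tree \<lparr>verts = reach E r, edges = {e \<in> E. e \<subseteq> reach E r}, rootv = r\<rparr>"
    (is "rooted_tree ?A")
proof -
  note G = rooted_treeD[OF assms(1)]
  have sub: "reach E r \<subseteq> verts G"
  proof
    fix w assume "w \<in> reach E r"
    then show "w \<in> verts G"
      by (induction rule: reach_induct) (use assms(2,3) G(3) in blast)+
  qed
  show ?thesis
  proof (rule rooted_treeI)
    show "finite (verts ?A)" using sub G(1) finite_subset by simp
    show "rootv ?A \<in> verts ?A" by simp
    show "e \<subseteq> verts ?A \<and> card e = 2" if "e \<in> edges ?A" for e using that G(4) assms(2) by auto
    show "w \<in> reach (edges ?A) (rootv ?A)" if "w \<in> verts ?A" for w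
    proof -
      have "w \<in> reach E r" using that by simp
      then show ?thesis
      proof (induction rule: reach_induct)
        case base
        show ?case by simp
      next
        case (step y z)
        have "y \<in> reach E r" "z \<in> reach E r"
          using step.hyps reach_step by fast+
        then have "{y, z} \<in> edges ?A" using step.hyps by simp
        then show ?case by (rule reach_step[OF step.IH])
      qed
    qed
    show "\<not> cycle_in (edges ?A) vs" for vs
      using cycle_in_mono[of "edges ?A" vs "edges G"] G(6) assms(2) by auto
  qed
qed

text \<open>An edge at the root is a bridge, and the graph is the join, at the root, of the two
  components that its removal leaves; both are smaller. Without such an edge connectedness leaves a
  single vertex.\<close>

lemma codes_exists: "rooted_tree G \<Longrightarrow> \<exists>u. codes G u"
proof (induction "card (verts G)" arbitrary: G rule: less_induct)
  case less
  note G = rooted_treeD[OF less.prems]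
  show ?case
  proof (cases "\<exists>b. {rootv G, b} \<in> edges G")
    case False
    have "w = rootv G" if "w \<in> reach (edges G) (rootv G)" for w
      using that by (induction rule: reach_induct) (use False in auto)
    then have V: "verts G = {rootv G}" using G(2,5) by auto
    have "edges G = {}"
    proof (rule ccontr)
      assume "edges G \<noteq> {}"
      then obtain e where e: "e \<in> edges G" by blast
      then have "e \<subseteq> {rootv G}" "card e = 2" using G(3,4) V by blast+
      then show False using card_mono[of "{rootv G}" e] by simp
    qed
    then have "G = \<lparr>verts = {rootv G}, edges = {}, rootv = rootv G\<rparr>" using V by simp
    then show ?thesis using codes.leaf by metis
  next
    case True
    then obtain b where b: "{rootv G, b} \<in> edges G" by blast
    define r where "r = rootv G"
    have e: "{r, b} \<in> edges G" using b by (simp add: r_def)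
    have rb: "r \<noteq> b" using G(4)[OF e] by auto
    define E where "E = edges G - {{r, b}}"
    define A where "A = \<lparr>verts = reach E r, edges = {e \<in> E. e \<subseteq> reach E r}, rootv = r\<rparr>"
    define B where "B = \<lparr>verts = reach E b, edges = {e \<in> E. e \<subseteq> reach E b}, rootv = b\<rparr>"
    have bG: "b \<in> verts G" using G(3)[OF e] by simp
    have A: "rooted_tree A" and B: "rooted_tree B"
      unfolding A_def B_def using rooted_tree_reach_part[OF less.prems, of E] bG G(2)
      by (auto simp: E_def r_def)
    have disj: "verts A \<inter> verts B = {}"
      using edge_is_bridge[OF less.prems e rb] reach_sym reach_trans
      unfolding A_def B_def E_def by fastforce
    have all: "w \<in> reach E r \<union> reach E b" if "w \<in> reach (edges G) r" for w
      using that
    proof (induction rule: reach_induct)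
      case base
      show ?case by simp
    next
      case (step y z)
      show ?case
      proof (cases "{y, z} = {r, b}")
        case True
        then have "z = r \<or> z = b" by (auto simp: doubleton_eq_iff)
        then show ?thesis by auto
      next
        case False
        then have "{y, z} \<in> E" using step by (simp add: E_def)
        then show ?thesis using step reach_step by fast
      qed
    qed
    have VG: "verts G = verts A \<union> verts B"
    proof
      show "verts G \<subseteq> verts A \<union> verts B" using all G(5) by (auto simp: A_def B_def r_def)
      have "reach E r \<subseteq> verts G" "reach E b \<subseteq> verts G"
      proof -
        have "w \<in> verts G" if "w \<in> reach E a" "a \<in> verts G" for w a
          using that(1) by (induction rule: reach_induct) (use that(2) G(3) E_def in blast)+
        then show "reach E r \<subseteq> verts G" "reach E b \<subseteq> verts G" using bG G(2) r_def by auto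
      qed
      then show "verts A \<union> verts B \<subseteq> verts G" by (simp add: A_def B_def)
    qed
    have EG: "edges G = edges A \<union> edges B \<union> {{r, b}}"
    proof -
      have "f \<subseteq> reach E r \<or> f \<subseteq> reach E b" if f: "f \<in> E" for f
      proof -
        have "card f = 2" "f \<subseteq> verts G" using f G(3,4) by (auto simp: E_def)
        then obtain x y where xy: "f = {x, y}" "x \<in> verts G" by (auto simp: card_2_iff)
        then have "x \<in> reach E r \<union> reach E b" using all G(5) r_def by blast
        then show ?thesis using f xy reach_step[of x E _ y] by auto
      qed
      then show ?thesis using e by (auto simp: A_def B_def E_def)
    qed
    have Geq: "G = join A (rootv A) B"
      using VG EG by (simp add: join_def A_def B_def r_def)
    have "r \<in> verts A" "b \<in> verts B" by (auto simp: A_def B_def)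
    then have "verts A \<subset> verts G" "verts B \<subset> verts G"
      unfolding VG using disj by blast+
    then have "card (verts A) < card (verts G)" "card (verts B) < card (verts G)"
      by (simp_all only: psubset_card_mono[OF G(1)])
    then obtain u x where "codes A u" "codes B x" using less.hyps[OF _ A] less.hyps[OF _ B] by metis
    then have "codes G (u \<star> x)" unfolding Geq by (rule codes.attach[OF _ _ disj])
    then show ?thesis ..
  qed
qed

section \<open>Codes of the pieces at every edge and vertex\<close>

definition splits :: "'v rgraph \<Rightarrow> 'v set \<Rightarrow> 'v rgraph \<Rightarrow> 'v rgraph \<Rightarrow> bool" where
  "splits G e A B \<longleftrightarrow> (\<exists>v\<in>verts A. G = join A v B \<and> verts A \<inter> verts B = {} \<and> e = {v, rootv B})"

lemma splits_parts:
  assumes "splits G e A B" "codes A u" "codes B x"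
  shows "root_part G e = A" "pruned_part G e = B"
  using assms join_parts[OF codes_rooted_tree codes_rooted_tree] unfolding splits_def by metis+

lemma attach_disjoint_edges:
  assumes "codes G u" "codes H x" "verts G \<inter> verts H = {}"
  shows "edges G \<inter> edges H = {}" "{rootv G, rootv H} \<notin> edges G \<union> edges H"
proof -
  note G = rooted_treeD[OF codes_rooted_tree[OF assms(1)]]
    and H = rooted_treeD[OF codes_rooted_tree[OF assms(2)]]
  show "edges G \<inter> edges H = {}" using G(3,8) H(3) assms(3) by (metis disjoint_iff inf.bounded_iff subset_empty)
  show "{rootv G, rootv H} \<notin> edges G \<union> edges H" using G(2,3) H(2,3) assms(3) by blast
qed

text \<open>The labelling of edges is existential because codes of the pieces are not yet known to
  be unique. The clause on the edges at the root recovers the branches; it yields uniqueness and the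
  root degree.\<close>

lemma codes_cuts:
  assumes "codes G u"
  shows "\<exists>c. (\<forall>e\<in>edges G. \<exists>A B. splits G e A B \<and> codes B (fst (c e)) \<and> codes A (snd (c e)))
    \<and> image_mset c (mset_set (edges G)) = cuts u
    \<and> image_mset (\<lambda>e. fst (c e)) (mset_set {e \<in> edges G. rootv G \<in> e}) = branches u"
  using assms
proof (induction rule: codes.induct)
  case (leaf v)
  show ?case by (simp add: cuts_leaf)
next
  case (attach G u H x)
  let ?K = "join G (rootv G) H" and ?e = "{rootv G, rootv H}"
  note G = rooted_treeD[OF codes_rooted_tree[OF attach.hyps(1)]]
    and H = rooted_treeD[OF codes_rooted_tree[OF attach.hyps(2)]]
  note dj = attach_disjoint_edges[OF attach.hyps]
  obtain c where c: "\<And>e. e \<in> edges G \<Longrightarrow> \<exists>A B. splits G e A B \<and> codes B (fst (c e)) \<and> codes A (snd (c e))"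
    "image_mset c (mset_set (edges G)) = cuts u"
    "image_mset (\<lambda>e. fst (c e)) (mset_set {e \<in> edges G. rootv G \<in> e}) = branches u"
    using attach.IH(1) by blast
  obtain d where d: "\<And>e. e \<in> edges H \<Longrightarrow> \<exists>A B. splits H e A B \<and> codes B (fst (d e)) \<and> codes A (snd (d e))"
    "image_mset d (mset_set (edges H)) = cuts x" using attach.IH(2) by blast
  define k where "k = (\<lambda>e. if e \<in> edges G then (fst (c e), snd (c e) \<star> x)
    else if e \<in> edges H then (fst (d e), u \<star> snd (d e)) else (x, u))"
  have "\<exists>A B. splits ?K e A B \<and> codes B (fst (k e)) \<and> codes A (snd (k e))" if eK: "e \<in> edges ?K" for e
  proof -
    consider "e \<in> edges G" | "e \<in> edges H" | "e = ?e"
      using eK by auto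
    then show ?thesis
    proof cases
      case 1
      then obtain A B v where AB: "codes B (fst (c e))" "codes A (snd (c e))" "v \<in> verts A"
        "G = join A v B" "verts A \<inter> verts B = {}" "e = {v, rootv B}"
        using c(1) unfolding splits_def by blast
      have K: "?K = join (join A (rootv A) H) v B"
        by (simp only: AB(4) join_join_right join_simps)
      have VG: "verts G = verts A \<union> verts B" by (simp add: AB(4))
      have "splits ?K e (join A (rootv A) H) B"
        unfolding splits_def K using AB(3,5,6) attach.hyps(3) VG by (intro bexI[of _ v]) auto
      moreover have "codes (join A (rootv A) H) (snd (c e) \<star> x)"
        using AB(2) attach.hyps(2,3) VG by (intro codes.attach) auto
      ultimately show ?thesis using 1 AB(1) by (auto simp: k_def)
    next
      case 2
      then have nG: "e \<notin> edges G" using dj(1) by blast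
      obtain A B v where AB: "codes B (fst (d e))" "codes A (snd (d e))" "v \<in> verts A"
        "H = join A v B" "verts A \<inter> verts B = {}" "e = {v, rootv B}"
        using d(1)[OF 2] unfolding splits_def by blast
      have K: "?K = join (join G (rootv G) A) v B"
        by (simp only: AB(4) join_join_inner)
      have VH: "verts H = verts A \<union> verts B" by (simp add: AB(4))
      have "splits ?K e (join G (rootv G) A) B"
        unfolding splits_def K using AB(3,5,6) attach.hyps(3) VH by (intro bexI[of _ v]) auto
      moreover have "codes (join G (rootv G) A) (u \<star> snd (d e))"
        using AB(2) attach.hyps(1,3) VH by (intro codes.attach) auto
      ultimately show ?thesis using 2 nG AB(1) by (auto simp: k_def)
    next
      case 3
      then have "splits ?K e G H" unfolding splits_def using G(2) attach.hyps(3) by auto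
      then show ?thesis using 3 dj(2) attach.hyps by (auto simp: k_def)
    qed
  qed
  moreover have "image_mset k (mset_set (edges ?K)) = cuts (u \<star> x)"
  proof -
    have "image_mset k (mset_set (edges G)) = image_mset (\<lambda>(p, q). (p, q \<star> x)) (image_mset c (mset_set (edges G)))"
      unfolding image_mset.compositionality
      by (intro image_mset_cong) (use G(7) in \<open>auto simp: k_def case_prod_unfold\<close>)
    moreover have "image_mset k (mset_set (edges H)) = image_mset (\<lambda>(p, q). (p, u \<star> q)) (image_mset d (mset_set (edges H)))"
      unfolding image_mset.compositionality
      by (intro image_mset_cong) (use H(7) dj(1) in \<open>auto simp: k_def case_prod_unfold\<close>)
    moreover have "k ?e = (x, u)" using dj(2) by (auto simp: k_def)
    moreover have "mset_set (edges ?K) = add_mset ?e (mset_set (edges G) + mset_set (edges H))"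
      using G(7) H(7) dj by (simp add: mset_set_Union)
    ultimately show ?thesis using c(2) d(2) by (simp add: cuts_attach)
  qed
  moreover have "image_mset (\<lambda>e. fst (k e)) (mset_set {e \<in> edges ?K. rootv ?K \<in> e}) = branches (u \<star> x)"
  proof -
    let ?R = "{e \<in> edges G. rootv G \<in> e}"
    have "rootv G \<notin> e" if "e \<in> edges H" for e
      using H(3)[OF that] G(2) attach.hyps(3) by blast
    then have R: "{e \<in> edges ?K. rootv ?K \<in> e} = insert ?e ?R" by auto
    have "image_mset (\<lambda>e. fst (k e)) (mset_set ?R) = image_mset (\<lambda>e. fst (c e)) (mset_set ?R)"
      by (intro image_mset_cong) (use G(7) in \<open>auto simp: k_def\<close>)
    moreover have "?e \<notin> ?R" "k ?e = (x, u)" using dj(2) by (auto simp: k_def)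
    ultimately show ?thesis using c(3) G(7) unfolding R by simp
  qed
  ultimately show ?case by blast
qed

text \<open>The branches of a code are the codes of the parts pruned at the edges of the root. These
  parts depend on the graph alone and are smaller.\<close>

lemma codes_unique: "codes G u \<Longrightarrow> codes G w \<Longrightarrow> u = w"
proof (induction "card (verts G)" arbitrary: G u w rule: less_induct)
  case less
  let ?R = "{e \<in> edges G. rootv G \<in> e}"
  obtain c where c: "\<And>e. e \<in> edges G \<Longrightarrow> \<exists>A B. splits G e A B \<and> codes B (fst (c e)) \<and> codes A (snd (c e))"
    "image_mset (\<lambda>e. fst (c e)) (mset_set ?R) = branches u" using codes_cuts[OF less.prems(1)] by blast
  obtain d where d: "\<And>e. e \<in> edges G \<Longrightarrow> \<exists>A B. splits G e A B \<and> codes B (fst (d e)) \<and> codes A (snd (d e))"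
    "image_mset (\<lambda>e. fst (d e)) (mset_set ?R) = branches w" using codes_cuts[OF less.prems(2)] by blast
  note G = rooted_treeD[OF codes_rooted_tree[OF less.prems(1)]]
  have "fst (c e) = fst (d e)" if e: "e \<in> edges G" for e
  proof -
    obtain A B where AB: "splits G e A B" "codes A (snd (c e))" "codes B (fst (c e))" using c(1)[OF e] by blast
    obtain A' B' where AB': "splits G e A' B'" "codes A' (snd (d e))" "codes B' (fst (d e))" using d(1)[OF e] by blast
    have "B' = B" using splits_parts[OF AB] splits_parts[OF AB'] by simp
    moreover obtain v where v: "v \<in> verts A" "G = join A v B" "verts A \<inter> verts B = {}"
      using AB(1) unfolding splits_def by blast
    have "verts B \<subset> verts G" using v(1,3) by (subst v(2)) auto
    then have "card (verts B) < card (verts G)" by (rule psubset_card_mono[OF G(1)])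
    ultimately show ?thesis using less.hyps AB(3) AB'(3) by blast
  qed
  then have "image_mset (\<lambda>e. fst (c e)) (mset_set ?R) = image_mset (\<lambda>e. fst (d e)) (mset_set ?R)"
    using G(7) by (intro image_mset_cong) simp
  then have "branches u = branches w" using c(2) d(2) by simp
  then show ?case by (cases u; cases w) simp
qed

text \<open>The order of attachment can be changed: if another branch came last, \<open>x\<close>
  sits in the smaller graph, and the two are exchanged by \<open>join_join_right\<close>.\<close>

lemma codes_attachD:
  "codes G w \<Longrightarrow> w = u \<star> x \<Longrightarrow>
    \<exists>A B. G = join A (rootv A) B \<and> verts A \<inter> verts B = {} \<and> codes A u \<and> codes B x"
proof (induction arbitrary: u rule: codes.induct)
  case (leaf v)
  then show ?case by (metis branches_attach branches_leaf empty_not_add_mset)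
next
  case (attach G u' H x')
  have eq: "add_mset x' (branches u') = add_mset x (branches u)"
    using attach.prems by (metis branches_attach)
  show ?case
  proof (cases "x' = x")
    case True
    then have "u' = u" using eq by (cases u'; cases u) simp
    then show ?thesis using attach.hyps True by blast
  next
    case False
    then obtain K where K: "branches u' = add_mset x K" "branches u = add_mset x' K"
      using eq by (auto simp: add_eq_conv_ex)
    have u: "u' = Node K \<star> x" "u = Node K \<star> x'"
      using K by (cases u', simp) (use K in \<open>cases u, simp\<close>)
    then obtain A B where AB: "G = join A (rootv A) B" "verts A \<inter> verts B = {}"
        "codes A (Node K)" "codes B x"
      using attach.IH(1) by blast
    have VG: "verts G = verts A \<union> verts B" by (simp add: AB(1))
    have "join G (rootv G) H = join (join A (rootv A) H) (rootv (join A (rootv A) H)) B"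
      by (simp only: AB(1) join_join_right join_simps)
    moreover have "codes (join A (rootv A) H) (Node K \<star> x')"
      using AB(3) attach.hyps(2,3) VG by (intro codes.attach) auto
    moreover have "verts (join A (rootv A) H) \<inter> verts B = {}"
      using AB(2) attach.hyps(3) VG by auto
    ultimately show ?thesis using AB(4) u(2) by metis
  qed
qed

lemma rename_cong:
  assumes "rooted_tree G" "\<And>v. v \<in> verts G \<Longrightarrow> f v = g v"
  shows "rename f G = rename g G"
proof -
  note G = rooted_treeD[OF assms(1)]
  have "f ` e = g ` e" if "e \<in> edges G" for e
    using G(3)[OF that] assms(2) by (intro image_cong) auto
  then show ?thesis
    unfolding rename_def using assms(2) G(2) by (auto intro!: image_cong)
qed

lemma codes_leafD: "codes G w \<Longrightarrow> w = leaf \<Longrightarrow> \<exists>v. G = \<lparr>verts = {v}, edges = {}, rootv = v\<rparr>"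
  by (induction rule: codes.induct) (auto, metis branches_attach branches_leaf empty_not_add_mset)

lemma codes_imp_iso: "codes G u \<Longrightarrow> codes H u \<Longrightarrow> rgraph_iso G H"
proof (induction u arbitrary: G H rule: rt_induct)
  case leaf
  obtain v w where "G = \<lparr>verts = {v}, edges = {}, rootv = v\<rparr>" "H = \<lparr>verts = {w}, edges = {}, rootv = w\<rparr>"
    using leaf codes_leafD by metis
  then have "H = rename (\<lambda>_. w) G" "inj_on (\<lambda>_. w) (verts G)" by (simp_all add: rename_def)
  then show ?case unfolding rgraph_iso_iff_rename by blast
next
  case (attach u x)
  obtain A B where AB: "G = join A (rootv A) B" "verts A \<inter> verts B = {}" "codes A u" "codes B x"
    using codes_attachD[OF attach.prems(1) refl] by blast
  obtain C D where CD: "H = join C (rootv C) D" "verts C \<inter> verts D = {}" "codes C u" "codes D x"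
    using codes_attachD[OF attach.prems(2) refl] by blast
  obtain f where f: "inj_on f (verts A)" "C = rename f A"
    using attach.IH(1)[OF AB(3) CD(3)] unfolding rgraph_iso_iff_rename by blast
  obtain g where g: "inj_on g (verts B)" "D = rename g B"
    using attach.IH(2)[OF AB(4) CD(4)] unfolding rgraph_iso_iff_rename by blast
  define h where "h = (\<lambda>v. if v \<in> verts A then f v else g v)"
  have hA: "rename h A = C" and hB: "rename h B = D"
    unfolding f(2) g(2) using AB(2) codes_rooted_tree[OF AB(3)] codes_rooted_tree[OF AB(4)]
    by (auto intro!: rename_cong simp: h_def)
  have "h ` verts A = verts C" "h ` verts B = verts D" by (simp_all flip: hA hB)
  moreover have "inj_on h (verts A)" using f(1) by (auto simp: inj_on_def h_def)
  moreover have "inj_on h (verts B)" using g(1) AB(2) by (auto simp: inj_on_def h_def)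
  ultimately have "inj_on h (verts A \<union> verts B)"
    using CD(2) unfolding inj_on_Un by auto
  moreover have "H = rename h G"
    unfolding AB(1) rename_join hA hB CD(1) by (simp flip: hA)
  ultimately show ?case
    unfolding rgraph_iso_iff_rename using AB(1) join_simps(1) by metis
qed

lemma codes_nat_exists: "\<exists>G::nat rgraph. codes G u"
proof (induction u rule: rt_induct)
  case leaf
  show ?case by (rule exI, rule codes.leaf)
next
  case (attach u x)
  then obtain G H :: "nat rgraph" where GH: "codes G u" "codes H x" by blast
  \<comment> \<open>Even and odd numbers keep the two vertex sets disjoint.\<close>
  let ?G = "rename (\<lambda>n. 2 * n) G" and ?H = "rename (\<lambda>n. Suc (2 * n)) H"
  have "codes ?G u" "codes ?H x"
    using GH by (auto intro!: codes_rename inj_onI)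
  moreover have "verts ?G \<inter> verts ?H = {}" by auto presburger
  ultimately have "codes (join ?G (rootv ?G) ?H) (u \<star> x)" by (rule codes.attach)
  then show ?case by (rule exI)
qed

lemma codes_ins:
  assumes "codes G u" "codes H t" "verts G \<inter> verts H = {}"
  shows "\<exists>c. (\<forall>v\<in>verts G. codes (join G v H) (c v)) \<and> image_mset c (mset_set (verts G)) = ins t u"
  using assms(1,3)
proof (induction rule: codes.induct)
  case (leaf v)
  let ?G = "\<lparr>verts = {v}, edges = {}, rootv = v\<rparr>"
  have "codes (join ?G (rootv ?G) H) (leaf \<star> t)"
    using leaf by (intro codes.attach assms codes.leaf) auto
  then show ?case by (intro exI[of _ "\<lambda>_. leaf \<star> t"]) (auto simp: ins_leaf)
next
  case (attach G u K x)
  let ?J = "join G (rootv G) K"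
  note G = rooted_treeD[OF codes_rooted_tree[OF attach.hyps(1)]]
    and K = rooted_treeD[OF codes_rooted_tree[OF attach.hyps(2)]]
  have dj: "verts G \<inter> verts H = {}" "verts K \<inter> verts H = {}" using attach.prems by auto
  obtain c where c: "\<And>v. v \<in> verts G \<Longrightarrow> codes (join G v H) (c v)"
    "image_mset c (mset_set (verts G)) = ins t u" using attach.IH(1)[OF dj(1)] by blast
  obtain d where d: "\<And>v. v \<in> verts K \<Longrightarrow> codes (join K v H) (d v)"
    "image_mset d (mset_set (verts K)) = ins t x" using attach.IH(2)[OF dj(2)] by blast
  define k where "k = (\<lambda>v. if v \<in> verts G then c v \<star> x else u \<star> d v)"
  have "codes (join ?J v H) (k v)" if v: "v \<in> verts ?J" for v
  proof (cases "v \<in> verts G")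
    case True
    have "codes (join (join G v H) (rootv (join G v H)) K) (c v \<star> x)"
      using attach.hyps dj c(1)[OF True] by (intro codes.attach) auto
    then show ?thesis using True by (simp add: k_def join_join_right[of G "rootv G" K])
  next
    case False
    then have vK: "v \<in> verts K" using v by simp
    have "codes (join G (rootv G) (join K v H)) (u \<star> d v)"
      using attach.hyps dj d(1)[OF vK] by (intro codes.attach) auto
    then show ?thesis using False by (simp add: k_def join_join_inner)
  qed
  moreover have "image_mset k (mset_set (verts ?J)) = ins t (u \<star> x)"
  proof -
    have "image_mset k (mset_set (verts G)) = image_mset (\<lambda>a. a \<star> x) (image_mset c (mset_set (verts G)))"
      unfolding image_mset.compositionality
      by (intro image_mset_cong) (use G(1) in \<open>auto simp: k_def\<close>)
    moreover have "image_mset k (mset_set (verts K)) = image_mset (\<lambda>b. u \<star> b) (image_mset d (mset_set (verts K)))"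
      unfolding image_mset.compositionality
      by (intro image_mset_cong) (use K(1) attach.hyps(3) in \<open>auto simp: k_def\<close>)
    ultimately show ?thesis using c(2) d(2) G(1) K(1) attach.hyps(3)
      by (simp add: mset_set_Union ins_attach)
  qed
  ultimately show ?case by blast
qed

section \<open>Transfer between isomorphism classes and nested multisets\<close>

definition code :: "rtree \<Rightarrow> rt" where
  "code t = (THE u. codes (rep_rtree t) u)"

definition tr :: "rt \<Rightarrow> rtree" where
  "tr = inv_into UNIV code"

lemma rooted_tree_rep: "rooted_tree (rep_rtree t)"
  using Quotient3_rep_reflp[OF Quotient3_rtree] by blast

lemma codes_code: "codes (rep_rtree t) (code t)"
  unfolding code_def using codes_exists[OF rooted_tree_rep[of t]] codes_unique
  by (metis theI)

lemma code_eqI: "codes (rep_rtree t) u \<Longrightarrow> code t = u"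
  using codes_code codes_unique by blast

lemma bij_code: "bij code"
proof (rule bijI)
  show "inj code"
  proof (rule injI)
    fix s t assume "code s = code t"
    then have "rgraph_iso (rep_rtree s) (rep_rtree t)"
      using codes_code codes_imp_iso by metis
    then show "s = t"
      using Quotient3_rel_rep[OF Quotient3_rtree] rooted_tree_rep by blast
  qed
  have "u \<in> range code" for u
  proof -
    obtain G :: "nat rgraph" where G: "codes G u" using codes_nat_exists by blast
    have "rgraph_iso G (rep_rtree (abs_rtree G))"
      using rep_abs_rsp[OF Quotient3_rtree, of G G] codes_rooted_tree[OF G] rgraph_iso_refl by blast
    then have "codes (rep_rtree (abs_rtree G)) u" by (rule codes_iso[OF G])
    then show ?thesis using code_eqI by blast
  qed
  then show "surj code" by blast
qed

lemma bij_tr: "bij tr"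
  unfolding tr_def by (rule bij_imp_bij_inv[OF bij_code])

lemma code_tr [simp]: "code (tr u) = u"
  unfolding tr_def using bij_code by (simp add: surj_f_inv_f bij_is_surj)

lemma tr_code [simp]: "tr (code t) = t"
  unfolding tr_def using bij_code by (simp add: inv_f_f bij_is_inj)

lemma tr_eq_iff [simp]: "tr u = tr v \<longleftrightarrow> u = v"
  by (metis code_tr)

lemma codes_tr: "codes (rep_rtree (tr u)) u"
  using codes_code[of "tr u"] by simp

lemma iso_iff_code: "codes G u \<Longrightarrow> rgraph_iso G (rep_rtree (tr v)) \<longleftrightarrow> u = v"
  using codes_tr codes_iso codes_unique codes_imp_iso by metis

lemma iso_iff_code': "codes G u \<Longrightarrow> rgraph_iso (rep_rtree (tr v)) G \<longleftrightarrow> u = v"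
  using codes_tr codes_iso codes_unique codes_imp_iso by metis

lemma tree_size_tr [simp]: "tree_size (tr u) = rsize u"
  unfolding tree_size_def by (rule codes_card[OF codes_tr])

lemma count_image_mset_set: "finite A \<Longrightarrow> count (image_mset c (mset_set A)) y = card {x \<in> A. c x = y}"
proof (induction A rule: finite_induct)
  case (insert x A)
  have "{z \<in> insert x A. c z = y} = (if c x = y then insert x {z \<in> A. c z = y} else {z \<in> A. c z = y})"
    by auto
  then show ?case using insert by simp
qed simp

lemma rdeg_tr [simp]: "rdeg (tr u) = size (branches u)"
proof -
  obtain c :: "nat set \<Rightarrow> rt \<times> rt" where
    "image_mset (\<lambda>e. fst (c e)) (mset_set {e \<in> edges (rep_rtree (tr u)). rootv (rep_rtree (tr u)) \<in> e})
      = branches u"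
    using codes_cuts[OF codes_tr[of u]] by blast
  then show ?thesis unfolding rdeg_def by (metis size_image_mset size_mset_set)
qed

lemma beta_tr: "beta (tr a) (tr t) (tr u) = count (ins t u) a"
proof -
  let ?G = "rep_rtree (tr u)" and ?H = "rep_rtree (tr t)"
  let ?Gl = "rename Inl ?G :: (nat + nat) rgraph" and ?Hr = "rename Inr ?H :: (nat + nat) rgraph"
  have "codes ?Gl u" "codes ?Hr t" by (auto intro!: codes_rename codes_tr)
  moreover have "verts ?Gl \<inter> verts ?Hr = {}" by auto
  ultimately obtain c where c: "\<And>v. v \<in> verts ?Gl \<Longrightarrow> codes (join ?Gl v ?Hr) (c v)"
    "image_mset c (mset_set (verts ?Gl)) = ins t u" using codes_ins by blast
  have fin: "finite (verts ?G)" using rooted_treeD(1)[OF rooted_tree_rep] .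
  have "rgraph_iso (rep_rtree (tr a)) (graft ?G v ?H) \<longleftrightarrow> c (Inl v) = a" if "v \<in> verts ?G" for v
    unfolding graft_eq_join by (rule iso_iff_code'[OF c(1)]) (use that in simp)
  then have "beta (tr a) (tr t) (tr u) = card {v \<in> verts ?G. c (Inl v) = a}"
    unfolding beta_def by (intro arg_cong[of _ _ card]) auto
  also have "\<dots> = count (image_mset (c \<circ> Inl) (mset_set (verts ?G))) a"
    using fin by (simp add: count_image_mset_set)
  also have "image_mset (c \<circ> Inl) (mset_set (verts ?G)) = ins t u"
    using c(2) by (simp add: image_mset_mset_set flip: image_mset.compositionality)
  finally show ?thesis .
qed

lemma alpha_tr: "alpha (tr s) (tr u) (tr r) = count (cuts u) (s, r)"
proof -
  let ?G = "rep_rtree (tr u)"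
  obtain c where c: "\<And>e. e \<in> edges ?G \<Longrightarrow> \<exists>A B. splits ?G e A B \<and> codes B (fst (c e)) \<and> codes A (snd (c e))"
    "image_mset c (mset_set (edges ?G)) = cuts u" using codes_cuts[OF codes_tr[of u]] by blast
  have fin: "finite (edges ?G)" using rooted_treeD(7)[OF rooted_tree_rep] .
  have "(rgraph_iso (root_part ?G e) (rep_rtree (tr r)) \<and> rgraph_iso (pruned_part ?G e) (rep_rtree (tr s)))
      \<longleftrightarrow> c e = (s, r)" if e: "e \<in> edges ?G" for e
  proof -
    obtain A B where AB: "splits ?G e A B" "codes B (fst (c e))" "codes A (snd (c e))"
      using c(1)[OF e] by blast
    show ?thesis
      unfolding splits_parts[OF AB(1,3,2)] iso_iff_code[OF AB(2)] iso_iff_code[OF AB(3)]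
      by (auto simp: prod_eq_iff)
  qed
  then have "alpha (tr s) (tr u) (tr r) = card {e \<in> edges ?G. c e = (s, r)}"
    unfolding alpha_def by (intro arg_cong[of _ _ card]) auto
  then show ?thesis using fin c(2) by (metis count_image_mset_set)
qed

section \<open>Brackets in terms of grafting and cutting\<close>

abbreviation dplus :: "rt \<Rightarrow> ie" where "dplus t \<equiv> basis_vec (Plus (tr t)) 1"
abbreviation dminus :: "rt \<Rightarrow> ie" where "dminus t \<equiv> basis_vec (Minus (tr t)) 1"
abbreviation dgrad :: ie where "dgrad \<equiv> basis_vec Dgen 1"

lemma ins_imp_cut: "a \<in># ins t u \<Longrightarrow> (t, u) \<in># cuts a"
proof (induction u arbitrary: a rule: rt_induct)
  case leaf
  then show ?case by (simp add: ins_leaf cuts_attach)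
next
  case (attach v x)
  from attach.prems consider b where "b \<in># ins t v" "a = b \<star> x" | b where "b \<in># ins t x" "a = v \<star> b"
    by (auto simp: ins_attach)
  then show ?case
  proof cases
    case 1
    then show ?thesis using attach.IH(1)[of b] by (force simp: cuts_attach)
  next
    case 2
    then show ?thesis using attach.IH(2)[of b] by (force simp: cuts_attach)
  qed
qed

lemma attach_in_ins: "u \<star> x \<in># ins x u"
  by (cases u) (simp add: ins.simps)

text \<open>Together with \<open>ins_imp_cut\<close>: grafting and cutting have the same support.
  Their multiplicities differ by symmetries of the trees, so both counts are kept.\<close>

lemma cut_imp_ins: "(p, q) \<in># cuts u \<Longrightarrow> u \<in># ins p q"
  by (induction u arbitrary: p q rule: rt_induct)
     (auto simp: cuts_leaf ins_attach cuts_attach attach_in_ins)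

lemma rsize_ins: "a \<in># ins t u \<Longrightarrow> rsize a = rsize t + rsize u"
  by (induction u arbitrary: a rule: rt_induct) (auto simp: ins_leaf ins_attach)

lemma rsize_cuts: "(p, q) \<in># cuts u \<Longrightarrow> rsize u = rsize p + rsize q"
  using cut_imp_ins rsize_ins by blast

lemma single_eq_zero_iff: "Poly_Mapping.single g c = 0 \<longleftrightarrow> c = 0"
  by (metis lookup_single_eq lookup_zero single_zero)

lemma Sum_any_tr: "Sum_any f = Sum_any (\<lambda>u. f (tr u))"
  using Sum_any.reindex_cong[of tr f "\<lambda>u. f (tr u)"] bij_tr by (simp add: comp_def bij_def)

lemma Sum_any_count:
  "Sum_any (\<lambda>r. basis_vec (h r) (of_nat (count M r))) = (\<Sum>r\<in>#M. basis_vec (h r) 1 :: ie)"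
proof -
  have "Sum_any (\<lambda>r. basis_vec (h r) (of_nat (count M r))) =
     (\<Sum>r\<in>set_mset M. basis_vec (h r) (of_nat (count M r)) :: ie)"
    by (rule Sum_any.expand_superset) (auto simp: single_eq_zero_iff)
  also have "\<dots> = (\<Sum>r\<in>#M. basis_vec (h r) 1)"
  proof (induction M)
    case (add x M)
    have "(\<Sum>r\<in>set_mset (add_mset x M). basis_vec (h r) (of_nat (count (add_mset x M) r)) :: ie)
        = (\<Sum>r\<in>insert x (set_mset M). basis_vec (h r) (of_nat (count M r)) + (if r = x then basis_vec (h x) 1 else 0))"
      by (intro sum.cong) (auto simp: single_add ac_simps)
    also have "\<dots> = (\<Sum>r\<in>insert x (set_mset M). basis_vec (h r) (of_nat (count M r))) + basis_vec (h x) 1"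
      by (simp add: sum.distrib)
    also have "(\<Sum>r\<in>insert x (set_mset M). basis_vec (h r) (of_nat (count M r)) :: ie)
       = (\<Sum>r\<in>set_mset M. basis_vec (h r) (of_nat (count M r)))"
      by (cases "x \<in># M") (simp_all add: insert_absorb not_in_iff)
    finally show ?case using add by (simp add: add.commute)
  qed simp
  finally show ?thesis .
qed

lemma bracket_plus_plus: 
  "gen_bracket (Plus (tr s)) (Plus (tr t)) = insum s t dplus - insum t s dplus"
proof -
  have 1: "Sum_any (\<lambda>r. basis_vec (Plus (tr r)) (of_nat (count (ins s t) r) - of_nat (count (ins t s) r)) :: ie)
     = Sum_any (\<lambda>r. basis_vec (Plus (tr r)) (of_nat (count (ins s t) r)) + basis_vec (Plus (tr r)) (- of_nat (count (ins t s) r)))"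
    by (simp flip: single_add)
  also have "\<dots> = Sum_any (\<lambda>r. basis_vec (Plus (tr r)) (of_nat (count (ins s t) r)))
      + Sum_any (\<lambda>r. basis_vec (Plus (tr r)) (- of_nat (count (ins t s) r)))"
    by (rule Sum_any.distrib;
        rule finite_subset[of _ "set_mset (ins s t) \<union> set_mset (ins t s)"]; force simp: single_eq_zero_iff)
  also have "Sum_any (\<lambda>r. basis_vec (Plus (tr r)) (- of_nat (count (ins t s) r)) :: ie)
      = (\<Sum>r\<in>set_mset (ins t s). - basis_vec (Plus (tr r)) (of_nat (count (ins t s) r)))"
    by (subst Sum_any.expand_superset[of "set_mset (ins t s)"]) (auto simp: single_eq_zero_iff single_uminus)
  also have "\<dots> = - Sum_any (\<lambda>r. basis_vec (Plus (tr r)) (of_nat (count (ins t s) r)))"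
    by (subst Sum_any.expand_superset[of "set_mset (ins t s)"]) (auto simp: single_eq_zero_iff sum_negf)
  finally show ?thesis
    by (subst gen_bracket.simps, subst Sum_any_tr) (simp add: beta_tr Sum_any_count insum_def)
qed

text \<open>The sum runs over the trees from which a fixed pair is cut, not over the cuts of a fixed
  tree; the grafts of \<open>s\<close> and \<open>t\<close> on each other give a finite range that
  contains its support.\<close>

lemma bracket_minus_minus:
  "gen_bracket (Minus (tr s)) (Minus (tr t)) = (\<Sum>r\<in>set_mset (ins t s) \<union> set_mset (ins s t).
     basis_vec (Minus (tr r)) (of_nat (count (cuts r) (t, s)) - of_nat (count (cuts r) (s, t))))"
proof -
  let ?A = "set_mset (ins t s) \<union> set_mset (ins s t)"
  let ?f = "\<lambda>r. basis_vec (Minus (tr r)) (of_nat (count (cuts r) (t, s)) - of_nat (count (cuts r) (s, t))) :: ie"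
  have "r \<in> ?A" if "?f r \<noteq> 0" for r
  proof (rule ccontr)
    assume "r \<notin> ?A"
    then have "count (cuts r) (t, s) = 0" "count (cuts r) (s, t) = 0"
      using cut_imp_ins not_in_iff by fastforce+
    then show False using that by simp
  qed
  then have "Sum_any ?f = sum ?f ?A"
    by (intro Sum_any.expand_superset) auto
  then show ?thesis
    by (subst gen_bracket.simps, subst Sum_any_tr) (simp only: alpha_tr)
qed

lemma bracket_minus_plus:
  assumes "s \<noteq> t"
  shows "gen_bracket (Minus (tr s)) (Plus (tr t)) = cutsum t (\<lambda>p q. if p = s then dplus q else 0)
     + (\<Sum>r\<in>snd ` set_mset (cuts s). basis_vec (Minus (tr r)) (of_nat (count (ins t r) s)))"
proof -
  have cnt: "count N (s, r) = count (image_mset snd {#x \<in># N. fst x = s#}) r" for r and N :: "(rt \<times> rt) multiset"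
    by (induction N) auto
  have sum: "(\<Sum>r\<in>#image_mset snd {#x \<in># N. fst x = s#}. dplus r)
      = (\<Sum>(p, q)\<in>#N. if p = s then dplus q else 0)" for N :: "(rt \<times> rt) multiset"
    by (induction N) auto
  have "Sum_any (\<lambda>r. basis_vec (Plus r) (of_nat (alpha (tr s) (tr t) r))) = cutsum t (\<lambda>p q. if p = s then dplus q else 0)"
    by (subst Sum_any_tr) (simp only: alpha_tr cnt[of "cuts t"] Sum_any_count sum cutsum_def)
  moreover have "Sum_any (\<lambda>r. basis_vec (Minus r) (of_nat (beta (tr s) (tr t) r)))
     = (\<Sum>r\<in>snd ` set_mset (cuts s). basis_vec (Minus (tr r)) (of_nat (count (ins t r) s)) :: ie)"
    by (subst Sum_any_tr, subst Sum_any.expand_superset[of "snd ` set_mset (cuts s)"])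
       (auto simp: beta_tr single_eq_zero_iff dest!: ins_imp_cut intro: rev_image_eqI)
  ultimately show ?thesis using assms by simp
qed

section \<open>Representations on a type\<close>

lemma ie_bracket_basis: "ie_bracket (basis_vec a 1) (basis_vec b 1) = gen_bracket a b"
  unfolding ie_bracket_def by simp

lemma ie_scale_basis: "ie_scale c (basis_vec a d) = basis_vec a (c * d)"
  by (rule poly_mapping_eqI) (simp add: lookup_ie_scale lookup_single when_def)

lemma ie_sum_keys: "(\<Sum>a\<in>Poly_Mapping.keys x. basis_vec a (Poly_Mapping.lookup x a)) = x"
  by (rule poly_mapping_eqI) (auto simp: lookup_sum lookup_single when_def in_keys_iff)

text \<open>A representation on a whole type, so that spans and subspaces of
  \<open>vector_space\<close> are available. The tensor product, which is given by a carrier, is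
  brought into this form later by a projection.\<close>

locale g_rep = vector_space scale
  for scale :: "complex \<Rightarrow> 'm::ab_group_add \<Rightarrow> 'm" +
  fixes X :: "ie \<Rightarrow> 'm \<Rightarrow> 'm"
  assumes X_add: "X (x + y) v = X x v + X y v"
    and X_scale: "X (ie_scale c x) v = scale c (X x v)"
    and X_addv: "X x (u + v) = X x u + X x v"
    and X_scalev: "X x (scale c v) = scale c (X x v)"
    and X_bracket: "X (ie_bracket x y) v = X x (X y v) - X y (X x v)"
begin

lemma X_zero [simp]: "X 0 v = 0"
  using X_add[of 0 0 v] by simp

lemma X_zerov [simp]: "X x 0 = 0"
  using X_addv[of x 0 0] by simp

lemma X_minusv: "X x (- v) = - X x v"
  using X_addv[of x v "- v"] by (simp add: eq_neg_iff_add_eq_0 add.commute)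

lemma X_diffv: "X x (u - v) = X x u - X x v"
  using X_addv[of x u "- v"] by (simp add: X_minusv)

lemma X_sum: "X (\<Sum>i\<in>I. f i) v = (\<Sum>i\<in>I. X (f i) v)"
  by (induction I rule: infinite_finite_induct) (simp_all add: X_add)

lemma X_sumv: "X x (\<Sum>i\<in>I. f i) = (\<Sum>i\<in>I. X x (f i))"
  by (induction I rule: infinite_finite_induct) (simp_all add: X_addv)

lemma X_sum_mset: "X (\<Sum>i\<in>#I. f i) v = (\<Sum>i\<in>#I. X (f i) v)"
  by (induction I) (simp_all add: X_add)

lemma X_basis: "X (basis_vec a c) v = scale c (X (basis_vec a 1) v)"
  using X_scale[of c "basis_vec a 1" v] by (simp add: ie_scale_basis)

lemma X_expand: "X x v = (\<Sum>a\<in>Poly_Mapping.keys x. scale (Poly_Mapping.lookup x a) (X (basis_vec a 1) v))"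
  by (subst (1) ie_sum_keys[of x, symmetric]) (simp only: X_sum X_basis[of _ "Poly_Mapping.lookup x _"])

abbreviation "P t \<equiv> X (dplus t)"
abbreviation "N t \<equiv> X (dminus t)"
abbreviation "D \<equiv> X dgrad"

text \<open>The negative part of the bracket consists of trees \<open>r\<close> that become
  \<open>s\<close> when \<open>t\<close> is grafted on them, and there are none if \<open>s\<close>
  is smaller than \<open>t\<close>. So the correction contains positive operators only, and the
  process can be repeated.\<close>

lemma N_P:
  assumes "rsize s < rsize t"
  shows "P t (N s v) = N s (P t v) - cutsum t (\<lambda>p q. if p = s then P q v else 0)"
proof -
  have st: "s \<noteq> t" using assms by auto
  have "count (ins t r) s = 0" for r
    using rsize_ins[of s t r] assms by (metis count_inI not_add_less1)
  then have "X (gen_bracket (Minus (tr s)) (Plus (tr t))) v = cutsum t (\<lambda>p q. if p = s then P q v else 0)"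
    unfolding bracket_minus_plus[OF st] cutsum_def
    by (simp add: X_add X_sum_mset case_prod_unfold if_distrib[of "\<lambda>x. X x v"] cong: if_cong)
  moreover have "X (gen_bracket (Minus (tr s)) (Plus (tr t))) v = N s (P t v) - P t (N s v)"
    using X_bracket[of "dminus s" "dplus t" v] by (simp only: ie_bracket_basis)
  ultimately show ?thesis by (metis diff_diff_eq2 add_diff_cancel_left')
qed

lemma D_P: "P t (D v) = D (P t v) - scale (of_nat (rsize t)) (P t v)"
proof -
  have "X (gen_bracket Dgen (Plus (tr t))) v = D (P t v) - P t (D v)"
    using X_bracket[of dgrad "dplus t" v] by (simp only: ie_bracket_basis)
  then show ?thesis using X_basis[of "Plus (tr t)" "of_nat (rsize t)" v] by (simp add: algebra_simps)
qed

lemma N_N: "N s (N t v) = N t (N s v) + (\<Sum>r\<in>set_mset (ins t s) \<union> set_mset (ins s t).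
    scale (of_nat (count (cuts r) (t, s)) - of_nat (count (cuts r) (s, t))) (N r v))"
proof -
  have "X (gen_bracket (Minus (tr s)) (Minus (tr t))) v = N s (N t v) - N t (N s v)"
    using X_bracket[of "dminus s" "dminus t" v] by (simp only: ie_bracket_basis)
  then show ?thesis
    unfolding bracket_minus_minus X_sum by (subst (asm) X_basis) (simp add: algebra_simps)
qed

section \<open>Straightening of words in the negative operators\<close>

definition word :: "rt list \<Rightarrow> 'm \<Rightarrow> 'm" where
  "word xs v = foldr (\<lambda>x. N x) xs v"

lemma word_simps [simp]: "word [] v = v" "word (x # xs) v = N x (word xs v)"
  by (simp_all add: word_def)

lemma word_add: "word xs (u + v) = word xs u + word xs v"
  by (induction xs) (simp_all add: X_addv)

lemma word_scale: "word xs (scale c v) = scale c (word xs v)"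
  by (induction xs) (simp_all add: X_scalev)

lemma word_zero [simp]: "word xs 0 = 0"
  by (induction xs) simp_all

text \<open>The filtration by length: by \<open>N_N\<close> a commutator of two letters is a
  combination of single letters, so every exchange of neighbours costs only words that are shorter
  by one letter.\<close>

definition short :: "'m \<Rightarrow> nat \<Rightarrow> 'm set" where
  "short u n = span {word zs u |zs. length zs < n}"

lemma N_short: "v \<in> short u n \<Longrightarrow> N a v \<in> short u (Suc n)"
  unfolding short_def
proof (induction rule: span_induct_alt)
  case base
  then show ?case by (simp add: span_zero)
next
  case (step c x y)
  then obtain zs where "x = word zs u" "length zs < n" by blast
  then have "N a x \<in> span {word zs u |zs. length zs < Suc n}"
    by (intro span_base) (metis (mono_tags, lifting) Suc_less_eq length_Cons mem_Collect_eq word_simps(2))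
  then show ?case using step by (simp add: X_addv X_scalev span_add span_scale)
qed

lemma word_move: "word (as @ a # bs) u - word (a # as @ bs) u \<in> short u (Suc (length as + length bs))"
proof (induction as)
  case Nil
  then show ?case by (simp add: short_def span_zero)
next
  case (Cons c cs)
  let ?n = "Suc (Suc (length cs + length bs))"
  have "N c (word (cs @ a # bs) u - word (a # cs @ bs) u) \<in> short u ?n"
    using N_short[OF Cons.IH] .
  moreover have "N c (word (a # cs @ bs) u) - N a (word (c # cs @ bs) u) \<in> short u ?n"
    unfolding word_simps N_N[of c a] add_diff_cancel_left'
    unfolding short_def
    by (intro span_sum span_scale span_base CollectI exI[of _ "_ # cs @ bs"]) auto
  ultimately have "(N c (word (cs @ a # bs) u - word (a # cs @ bs) u))
      + (N c (word (a # cs @ bs) u) - N a (word (c # cs @ bs) u)) \<in> short u ?n"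
    unfolding short_def by (rule span_add)
  then show ?case by (simp add: X_diffv)
qed

lemma word_perm: "mset xs = mset ys \<Longrightarrow> word xs u - word ys u \<in> short u (length xs)"
proof (induction xs arbitrary: ys)
  case Nil
  then show ?case by (simp add: short_def span_zero)
next
  case (Cons a xs)
  then have "a \<in> set ys" by (metis list.set_intros(1) mset_eq_setD)
  then obtain as bs where ys: "ys = as @ a # bs" by (meson split_list)
  then have m: "mset xs = mset (as @ bs)" using Cons.prems by simp
  have "N a (word xs u - word (as @ bs) u) \<in> short u (Suc (length xs))"
    using N_short[OF Cons.IH[OF m]] .
  moreover have "length xs = length as + length bs" using mset_eq_length[OF m] by simp
  then have "word ys u - word (a # as @ bs) u \<in> short u (Suc (length xs))"
    unfolding ys using word_move[of as a bs u] by simp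
  ultimately have "N a (word xs u - word (as @ bs) u) - (word ys u - word (a # as @ bs) u) \<in> short u (Suc (length xs))"
    unfolding short_def by (rule span_diff)
  then show ?case by (simp add: X_diffv)
qed

text \<open>Each multiset gets some order of its own. Any choice works, because reordering produces
  only shorter words, and \<open>word_sorted\<close> proceeds by induction on the length.\<close>

definition listing :: "rt multiset \<Rightarrow> rt list" where
  "listing s = (SOME xs. mset xs = s)"

lemma mset_listing [simp]: "mset (listing s) = s"
  unfolding listing_def by (rule someI_ex) (rule ex_mset)

lemma word_sorted: "word xs u \<in> span {word (listing s) u |s. True}"
proof (induction "length xs" arbitrary: xs rule: less_induct)
  case less
  have "short u (length xs) \<subseteq> span {word (listing s) u |s. True}"
    unfolding short_def by (rule span_minimal) (use less in \<open>auto simp: subspace_span\<close>)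
  then have "word xs u - word (listing (mset xs)) u \<in> span {word (listing s) u |s. True}"
    using word_perm[of xs "listing (mset xs)" u] by auto
  moreover have "word (listing (mset xs)) u \<in> span {word (listing s) u |s. True}"
    by (rule span_base) blast
  ultimately show ?case using span_add by fastforce
qed

end

section \<open>Whittaker vectors and extraction of coefficients\<close>

text \<open>A polynomial with a nonzero period takes one value on an infinite arithmetic progression
  and is constant. The degree drops because a shift keeps the leading coefficient.\<close>

lemma pcompose_shift_eq:
  fixes p :: "complex poly" and c :: complex
  assumes "c \<noteq> 0" "degree p \<noteq> 0"
  shows "pcompose p [:c, 1:] - p \<noteq> 0" "degree (pcompose p [:c, 1:] - p) < degree p"
proof -
  let ?q = "pcompose p [:c, 1:]"
  show "?q - p \<noteq> 0"
  proof
    assume "?q - p = 0"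
    then have q: "?q = p" by simp
    have *: "poly p (of_nat k * c) = poly p 0" for k
    proof (induction k)
      case (Suc k)
      have "poly ?q (of_nat k * c) = poly p (of_nat (Suc k) * c)"
        by (simp add: poly_pcompose algebra_simps)
      then show ?case using Suc q by simp
    qed simp
    have "range (\<lambda>k::nat. of_nat k * c) \<subseteq> {x. poly (p - [:poly p 0:]) x = 0}"
      using * by auto
    moreover have "infinite (range (\<lambda>k::nat. of_nat k * c))"
      using assms(1) by (intro range_inj_infinite injI) simp
    ultimately have "p - [:poly p 0:] = 0"
      using poly_roots_finite finite_subset by blast
    then show False using assms(2) by (metis degree_pCons_0 eq_iff_diff_eq_0)
  qed
  have dq: "degree ?q = degree p" by (simp add: degree_pcompose)
  have "coeff ?q (degree p) = coeff p (degree p)"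
    using lead_coeff_comp[of "[:c, 1:]" p] dq by simp
  then have "coeff (?q - p) (degree p) = 0" by simp
  moreover have "degree (?q - p) \<le> degree p" using dq by (metis degree_diff_le order_refl)
  ultimately show "degree (?q - p) < degree p"
    using \<open>?q - p \<noteq> 0\<close> by (metis leading_coeff_0_iff nat_less_le)
qed

lemma pcompose_shift_nonzero:
  fixes p :: "complex poly"
  assumes "p \<noteq> 0"
  shows "pcompose p [:c, 1:] \<noteq> 0"
  using assms pcompose_eq_0[of p "[:c, 1:]"] by auto

text \<open>A product of two nonzero power series in commuting variables is nonzero: comparing
  exponents in a monomial order gives a monomial that arises from a single pair.\<close>

lemma unique_decomposition:
  fixes A B :: "'a multiset set"
  assumes "A \<noteq> {}" "finite Z" "\<And>a. a \<in> A \<Longrightarrow> set_mset a \<subseteq> Z" "b0 \<in> B"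
  obtains a b where "a \<in> A" "b \<in> B" "{#x \<in># b. x \<notin> Z#} = {#x \<in># b0. x \<notin> Z#}"
    "\<And>a' b'. a' \<in> A \<Longrightarrow> b' \<in> B \<Longrightarrow> a' + b' = a + b \<Longrightarrow> a' = a"
proof -
  \<comment> \<open>An injection of \<open>Z\<close> into the natural numbers brings in their
    well-founded multiset order, so that least elements exist even in infinite sets.\<close>
  obtain g :: "'a \<Rightarrow> nat" where g: "inj_on g Z"
    using finite_imp_inj_to_nat_seg[OF assms(2)] by blast
  define in_Z where "in_Z = (\<lambda>b::'a multiset. {#x \<in># b. x \<in> Z#})"
  define out_Z where "out_Z = (\<lambda>b::'a multiset. {#x \<in># b. x \<notin> Z#})"
  define K where "K = (\<lambda>b. image_mset g (in_Z b))"
  \<comment> \<open>Letters outside \<open>Z\<close> are not compared but frozen to those of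
    \<open>b0\<close>. Elements of \<open>A\<close> contain none of them, so a sum a + b determines
    the outer letters of b.\<close>
  define B' where "B' = {b \<in> B. out_Z b = out_Z b0}"
  define ka where "ka = (LEAST k. k \<in> K ` A)"
  define kb where "kb = (LEAST k. k \<in> K ` B')"
  have "\<exists>k. k \<in> K ` A" "\<exists>k. k \<in> K ` B'" using assms(1,4) by (auto simp: B'_def)
  then have "ka \<in> K ` A" "kb \<in> K ` B'" unfolding ka_def kb_def by (auto intro: LeastI)
  then obtain a b where ab: "a \<in> A" "K a = ka" "b \<in> B'" "K b = kb" by auto
  have ka: "ka \<le> K a'" if "a' \<in> A" for a' unfolding ka_def using that by (intro Least_le) auto
  have kb: "kb \<le> K b'" if "b' \<in> B'" for b' unfolding kb_def using that by (intro Least_le) auto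
  have outA: "out_Z a' = {#}" "in_Z a' = a'" if "a' \<in> A" for a'
    using assms(3)[OF that]
    by (auto intro!: multiset_eqI simp: out_Z_def in_Z_def count_eq_zero_iff)
  have "a' = a" if a': "a' \<in> A" and b': "b' \<in> B" and eq: "a' + b' = a + b" for a' b'
  proof -
    have "out_Z (a' + b') = out_Z (a + b)" "in_Z (a' + b') = in_Z (a + b)" by (simp_all only: eq)
    then have o: "out_Z a' + out_Z b' = out_Z a + out_Z b" and i: "in_Z a' + in_Z b' = in_Z a + in_Z b"
      by (simp_all add: out_Z_def in_Z_def)
    have "b' \<in> B'" using o outA[OF a'] outA[OF ab(1)] ab(3) b' by (simp add: B'_def)
    moreover have "K a' + K b' = K a + K b"
      using arg_cong[OF i, of "image_mset g"] by (simp add: K_def)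
    ultimately have "K a' = K a"
      using ka[OF a'] kb[of b'] ab(2,4) add_le_less_mono[of "K a" "K a'" "K b" "K b'"]
        add_less_le_mono[of "K a" "K a'" "K b" "K b'"]
      by (metis add_right_cancel order_le_less less_irrefl)
    then have "image_mset g a' = image_mset g a" unfolding K_def outA[OF a'] outA[OF ab(1)] .
    moreover have "image_mset (inv_into Z g) (image_mset g x) = x" if "x \<in> A" for x
      using assms(3)[OF that] g by (auto simp: image_mset.compositionality intro!: multiset.map_ident_strong)
    ultimately show "a' = a" using a' ab(1) by metis
  qed
  then show ?thesis using that[of a b] ab(1,3) by (auto simp: B'_def out_Z_def)
qed

section \<open>Root degree and weight under cuts\<close>

lemma cutsum_Node:
  "cutsum (Node F) \<psi> = (\<Sum>c\<in>#F. \<psi> c (Node (F - {#c#})) + cutsum c (\<lambda>p q. \<psi> p (Node (add_mset q (F - {#c#})))))"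
proof -
  have "(\<Sum>(p, q)\<in>#(\<Sum>c\<in>#G. f c). \<psi> p q) = (\<Sum>c\<in>#G. \<Sum>(p, q)\<in>#f c. \<psi> p q)"
    for G :: "rt multiset" and f :: "rt \<Rightarrow> (rt \<times> rt) multiset"
    by (induction G) auto
  then show ?thesis
    by (simp add: cutsum_def cuts.simps image_mset.compositionality comp_def case_prod_unfold)
qed

lemma size_branches_cuts:
  "(p, q) \<in># cuts u \<Longrightarrow> size (branches u) \<le> Suc (size (branches q))"
proof -
  assume "(p, q) \<in># cuts u"
  then have "u \<in># ins p q" by (rule cut_imp_ins)
  then show ?thesis
  proof (induction q arbitrary: u rule: rt_induct)
    case leaf
    then show ?case by (simp add: ins_leaf)
  next
    case (attach v x)
    then show ?case by (auto simp: ins_attach)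
  qed
qed

definition weight :: "rt multiset \<Rightarrow> nat" where
  "weight F = (\<Sum>c\<in>#F. rsize c)"

lemma rsize_Node: "rsize (Node F) = Suc (weight F)"
  by (simp add: weight_def)

lemma weight_add [simp]: "weight (F + G) = weight F + weight G" "weight (add_mset c F) = rsize c + weight F"
  "weight {#} = 0"
  by (simp_all add: weight_def)

locale whittaker = g_rep scale X
  for scale :: "complex \<Rightarrow> 'm::ab_group_add \<Rightarrow> 'm" and X +
  fixes w :: 'm and \<eta> :: "rt \<Rightarrow> complex"
  assumes P_w: "P t w = scale (\<eta> t) w"
begin

text \<open>The vector p(d) w for a formal polynomial p, in Horner form. Different polynomials may a
  priori give the same vector; injectivity is derived once w \<noteq> 0 is available.\<close>

definition dpoly :: "complex poly \<Rightarrow> 'm" where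
  "dpoly p = fold_coeffs (\<lambda>a u. scale a w + D u) p 0"

lemma dpoly_0 [simp]: "dpoly 0 = 0"
  by (simp add: dpoly_def)

lemma dpoly_pCons [simp]: "dpoly (pCons a p) = scale a w + D (dpoly p)"
  by (cases "p = 0 \<and> a = 0") (auto simp: dpoly_def)

lemma dpoly_add: "dpoly (p + q) = dpoly p + dpoly q"
  by (induction p q rule: poly_induct2) (simp_all add: scale_left_distrib X_addv algebra_simps)

lemma dpoly_smult: "dpoly (smult c p) = scale c (dpoly p)"
  by (induction p) (simp_all add: scale_right_distrib X_scalev)

lemma dpoly_diff: "dpoly (p - q) = dpoly p - dpoly q"
  using dpoly_add[of "p - q" q] by simp

text \<open>By \<open>D_P\<close>, moving \<open>P t\<close> to the right replaces d by d -
  |t|.\<close>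

lemma P_dpoly: "P t (dpoly p) = scale (\<eta> t) (dpoly (pcompose p [:- of_nat (rsize t), 1:]))"
proof (induction p)
  case (pCons a p)
  let ?n = "of_nat (rsize t) :: complex" and ?q = "pcompose p [:- of_nat (rsize t), 1:]"
  have "[:- ?n, 1:] * ?q = smult (- ?n) ?q + pCons 0 ?q"
    by (simp add: algebra_simps)
  then have "dpoly ([:- ?n, 1:] * ?q) = D (dpoly ?q) - scale ?n (dpoly ?q)"
    by (simp only: dpoly_add dpoly_smult) simp
  moreover have "P t (dpoly (pCons a p)) = scale a (scale (\<eta> t) w) + (D (P t (dpoly p)) - scale ?n (P t (dpoly p)))"
    by (simp only: dpoly_pCons X_addv X_scalev P_w D_P)
  ultimately show ?case
    unfolding pcompose_pCons dpoly_add pCons.IH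
    by (simp add: X_scalev scale_right_distrib scale_right_diff_distrib mult.commute)
qed simp

text \<open>\<open>Z t xs\<close> is a sufficient condition for \<open>D_t\<^sup>+\<close> to annihilate the monomial \<open>xs\<close>: it says that
  \<open>\<eta>\<close> vanishes at every tree left over when some of the \<open>xs\<close> have been cut off from \<open>t\<close>.  Under
  \<open>Y F xs\<close>, the only contribution to the action of the tree with branches \<open>F\<close> comes from cutting
  all of the \<open>xs\<close> off at the root.\<close>

definition admissible :: "(rt \<Rightarrow> rt list \<Rightarrow> bool) \<Rightarrow> (rt multiset \<Rightarrow> rt list \<Rightarrow> bool) \<Rightarrow> bool" where
  "admissible Z Y \<longleftrightarrow>
     (\<forall>t. Z t [] \<longrightarrow> \<eta> t = 0) \<and>
     (\<forall>t x xs. Z t (x # xs) \<longrightarrow> rsize x < rsize t \<and> Z t xs) \<and>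
     (\<forall>t x xs q. Z t (x # xs) \<longrightarrow> (x, q) \<in># cuts t \<longrightarrow> Z q xs) \<and>
     (\<forall>F x xs. Y F (x # xs) \<longrightarrow> rsize x < rsize (Node F) \<and> Z (Node F) xs) \<and>
     (\<forall>F x xs c q. Y F (x # xs) \<longrightarrow> c \<in># F \<longrightarrow> (x, q) \<in># cuts c \<longrightarrow> Z (Node (add_mset q (F - {#c#}))) xs) \<and>
     (\<forall>F x xs. Y F (x # xs) \<longrightarrow> x \<in># F \<longrightarrow> Y (F - {#x#}) xs)"

lemma admissibleD:
  assumes "admissible Z Y"
  shows "\<And>t. Z t [] \<Longrightarrow> \<eta> t = 0"
    "\<And>t x xs. Z t (x # xs) \<Longrightarrow> rsize x < rsize t \<and> Z t xs"
    "\<And>t x xs q. Z t (x # xs) \<Longrightarrow> (x, q) \<in># cuts t \<Longrightarrow> Z q xs"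
    "\<And>F x xs. Y F (x # xs) \<Longrightarrow> rsize x < rsize (Node F) \<and> Z (Node F) xs"
    "\<And>F x xs c q. Y F (x # xs) \<Longrightarrow> c \<in># F \<Longrightarrow> (x, q) \<in># cuts c \<Longrightarrow>
      Z (Node (add_mset q (F - {#c#}))) xs"
    "\<And>F x xs. Y F (x # xs) \<Longrightarrow> x \<in># F \<Longrightarrow> Y (F - {#x#}) xs"
  using assms unfolding admissible_def by blast+

text \<open>Passing a letter, the operator keeps its tree or changes it to a root part of that tree.
  \<open>Z\<close> persists in both cases down to the empty word, where \<eta> vanishes.\<close>

lemma P_word_null:
  assumes "admissible Z Y"
  shows "Z t xs \<Longrightarrow> P t (word xs (dpoly p)) = 0"
proof (induction xs arbitrary: t)
  case Nil
  then show ?case using admissibleD(1)[OF assms] by (simp add: P_dpoly)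
next
  case (Cons x xs)
  have "cutsum t (\<lambda>p' q. if p' = x then P q (word xs (dpoly p)) else 0) = cutsum t (\<lambda>p q. 0)"
    unfolding cutsum_def by (intro sum_mset_cong) (use admissibleD(3)[OF assms Cons.prems] Cons.IH in auto)
  then show ?case
    using admissibleD(2)[OF assms Cons.prems] Cons.IH[of t] by (simp add: N_P)
qed

text \<open>Every letter has to be cut off at the root as a whole branch; all other contributions
  are annihilated under \<open>Z\<close>. If the letters fit into \<open>F\<close>, then
  \<open>k\<close> is, up to sign, the number of ways to pick the branches one after the other, and
  it matters only that it is nonzero.\<close>

lemma P_word_extract:
  assumes "admissible Z Y"
  shows "Y F xs \<Longrightarrow> \<exists>k. k \<noteq> 0 \<and> P (Node F) (word xs (dpoly p)) =
    (if mset xs \<subseteq># F then scale (k * \<eta> (Node (F - mset xs)))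
       (dpoly (pcompose p [:- of_nat (rsize (Node (F - mset xs))), 1:])) else 0)"
proof (induction xs arbitrary: F)
  case Nil
  show ?case using P_dpoly[of "Node F" p] by (intro exI[of _ 1]) simp
next
  case (Cons x xs)
  let ?v = "word xs (dpoly p)"
  have null: "P t ?v = 0" if "Z t xs" for t
    by (rule P_word_null[OF assms that])
  \<comment> \<open>Cuts strictly inside a branch fall under \<open>Z\<close> by the fifth condition
    of \<open>admissible\<close>.\<close>
  have inner: "cutsum c (\<lambda>p' q. if p' = x then P (Node (add_mset q (F - {#c#}))) ?v else 0) = 0" if "c \<in># F" for c
  proof -
    have "cutsum c (\<lambda>p' q. if p' = x then P (Node (add_mset q (F - {#c#}))) ?v else 0) = cutsum c (\<lambda>p q. 0)"
      unfolding cutsum_def by (intro sum_mset_cong) (use null[OF admissibleD(5)[OF assms Cons.prems that]] in auto)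
    then show ?thesis by simp
  qed
  \<comment> \<open>Cuts of a whole branch: one for each copy of \<open>x\<close> among the
    branches.\<close>
  have delta: "(\<Sum>c\<in>#G. if c = x then P (Node (F - {#c#})) ?v else 0)
      = scale (of_nat (count G x)) (P (Node (F - {#x#})) ?v)" for G
    by (induction G) (auto simp: scale_left_distrib)
  have "cutsum (Node F) (\<lambda>p' q. if p' = x then P q ?v else 0)
      = (\<Sum>c\<in>#F. if c = x then P (Node (F - {#c#})) ?v else 0)"
    unfolding cutsum_Node by (intro sum_mset_cong) (simp add: inner)
  then have step: "P (Node F) (word (x # xs) (dpoly p))
      = - scale (of_nat (count F x)) (P (Node (F - {#x#})) ?v)"
    using admissibleD(4)[OF assms Cons.prems] null[of "Node F"] by (simp add: N_P delta)
  show ?case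
  proof (cases "x \<in># F")
    case False
    then have "\<not> mset (x # xs) \<subseteq># F" using mset_subset_eqD by fastforce
    then show ?thesis using step False by (intro exI[of _ 1]) (simp add: not_in_iff)
  next
    case True
    obtain k where k: "k \<noteq> 0" "P (Node (F - {#x#})) ?v =
      (if mset xs \<subseteq># F - {#x#} then scale (k * \<eta> (Node (F - {#x#} - mset xs)))
       (dpoly (pcompose p [:- of_nat (rsize (Node (F - {#x#} - mset xs))), 1:])) else 0)"
      using Cons.IH[OF admissibleD(6)[OF assms Cons.prems True]] by blast
    have sub: "mset (x # xs) \<subseteq># F \<longleftrightarrow> mset xs \<subseteq># F - {#x#}"
      using True by (simp add: insert_subset_eq_iff)
    have dif: "F - mset (x # xs) = F - {#x#} - mset xs" by simp
    show ?thesis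
      unfolding step k(2) sub dif
      using k(1) True by (intro exI[of _ "- of_nat (count F x) * k"]) (auto simp flip: scale_minus_left)
  qed
qed

text \<open>Any monomial other than \<open>a\<close> is annihilated outright or can leave only
  branches at which \<eta> vanishes. So the polynomial of \<open>a\<close> alone survives, shifted
  and multiplied by a nonzero number.\<close>

lemma P_extract_sum:
  assumes "admissible Z Y" "finite F" "a \<in> F" "p a \<noteq> 0" "\<eta> (Node b) \<noteq> 0" "Y (a + b) (listing a)"
    and other: "\<And>s. s \<in> F \<Longrightarrow> s \<noteq> a \<Longrightarrow> Z (Node (a + b)) (listing s) \<or>
      (Y (a + b) (listing s) \<and> (\<forall>b'. s + b' = a + b \<longrightarrow> \<eta> (Node b') = 0))"
  shows "\<exists>q. q \<noteq> 0 \<and> P (Node (a + b)) (\<Sum>s\<in>F. word (listing s) (dpoly (p s))) = dpoly q"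
proof -
  have zero: "P (Node (a + b)) (word (listing s) (dpoly (p s))) = 0" if "s \<in> F" "s \<noteq> a" for s
  proof (cases "Z (Node (a + b)) (listing s)")
    case True
    then show ?thesis by (rule P_word_null[OF assms(1)])
  next
    case False
    then have Y: "Y (a + b) (listing s)" and eta: "\<And>b'. s + b' = a + b \<Longrightarrow> \<eta> (Node b') = 0"
      using other[OF that] by auto
    have "s \<subseteq># a + b \<Longrightarrow> \<eta> (Node (a + b - s)) = 0" by (rule eta) simp
    then show ?thesis using P_word_extract[OF assms(1) Y, of "p s"] by (auto split: if_splits)
  qed
  have "P (Node (a + b)) (\<Sum>s\<in>F. word (listing s) (dpoly (p s)))
      = P (Node (a + b)) (word (listing a) (dpoly (p a)))"
    unfolding X_sumv using assms(2,3) zero by (simp add: sum.remove)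
  moreover obtain k where "k \<noteq> 0" "P (Node (a + b)) (word (listing a) (dpoly (p a))) =
      scale (k * \<eta> (Node b)) (dpoly (pcompose (p a) [:- of_nat (rsize (Node b)), 1:]))"
    using P_word_extract[OF assms(1) assms(6), of "p a"] by auto
  ultimately show ?thesis
    using assms(4,5) pcompose_shift_nonzero[of "p a"]
    by (intro exI[of _ "smult (k * \<eta> (Node b)) (pcompose (p a) [:- of_nat (rsize (Node b)), 1:])"])
       (auto simp: dpoly_smult)
qed

text \<open>\<open>length xs\<close> and \<open>weight (mset xs)\<close> are reserves for the
  letters still to come: a cut lowers the root degree by at most one and the size by that of its
  letter. Under \<open>Y\<close> the degree is exact, so a letter that is passed over, or cut inside
  a branch, leaves an excess of degree, and \<open>Z\<close> holds.\<close>

lemma admissible_unbounded: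
  assumes "\<And>t. size (branches t) > m \<Longrightarrow> rsize t > R \<Longrightarrow> \<eta> t = 0"
  shows "admissible
    (\<lambda>t xs. size (branches t) > m + length xs \<and> rsize t > R + weight (mset xs))
    (\<lambda>F xs. size F = m + length xs \<and> rsize (Node F) > R + weight (mset xs))"
  unfolding admissible_def
  using assms
  apply (intro conjI allI impI)
  subgoal by simp
  subgoal by simp
  subgoal by simp
  subgoal by simp
  subgoal by (auto dest!: size_branches_cuts)
  subgoal by (auto dest!: rsize_cuts)
  subgoal by simp
  subgoal by simp
  subgoal by simp
  subgoal by (auto simp: size_Diff_singleton)
  subgoal by (drule rsize_cuts) (auto dest!: multi_member_split simp: weight_def)
  subgoal by (auto simp: size_Diff_singleton)
  subgoal by (auto dest!: multi_member_split simp: weight_def)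
  done

text \<open>Here the size decides first. Under \<open>Y\<close> it is exact, so passing over a
  letter leaves a tree that is too large, while cutting it inside a branch keeps the size exact and
  leaves an excess of root degree.\<close>

lemma admissible_bounded:
  assumes "\<And>t. rsize t > R \<Longrightarrow> \<eta> t = 0" "\<And>t. rsize t = R \<Longrightarrow> size (branches t) > m \<Longrightarrow> \<eta> t = 0" "R > 0"
  shows "admissible
    (\<lambda>t xs. rsize t > R + weight (mset xs) \<or> rsize t = R + weight (mset xs) \<and> size (branches t) > m + length xs)
    (\<lambda>F xs. rsize (Node F) = R + weight (mset xs) \<and> size F = m + length xs)"
  unfolding admissible_def
  using assms
  apply (intro conjI allI impI)
  subgoal by auto
  subgoal by auto
  subgoal by auto
  subgoal by (auto dest: rsize_cuts size_branches_cuts)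
  subgoal by simp
  subgoal by simp
  subgoal by (drule rsize_cuts) (auto dest!: multi_member_split simp: weight_def)
  subgoal by (auto dest!: multi_member_split simp: weight_def)
  subgoal by (auto simp: size_Diff_singleton)
  done

end

declare rsize.simps [simp del]

context whittaker begin

section \<open>Choice of the tree that isolates a leading monomial\<close>

lemma weight_mono_subset: "weight {#x \<in># b. Q x#} \<le> weight b"
  using multiset_partition[of b Q] by (metis le_add1 weight_add(1))

lemma weight_bounded: "(\<And>x. x \<in># b \<Longrightarrow> rsize x \<le> n) \<Longrightarrow> weight b \<le> size b * n"
  by (induction b) (auto intro: add_mono)

lemma P_reduces:
  assumes F: "finite F" "\<And>s. s \<in> F \<Longrightarrow> p s \<noteq> 0" "\<exists>s\<in>F. s \<noteq> {#}"
    and bounded: "\<exists>M. \<forall>t. M \<le> size (branches t) \<longrightarrow> \<eta> t = 0" and nz: "\<exists>t. \<eta> t \<noteq> 0"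
  shows "\<exists>t q. q \<noteq> 0 \<and> \<eta> t = 0 \<and> P t (\<Sum>s\<in>F. word (listing s) (dpoly (p s))) = dpoly q"
proof -
  define Z where "Z = \<Union> (set_mset ` F)"
  have Zfin: "finite Z" using F(1) by (simp add: Z_def)
  have FZ: "set_mset s \<subseteq> Z" if "s \<in> F" for s using that by (auto simp: Z_def)
  obtain s0 where s0: "s0 \<in> F" "s0 \<noteq> {#}" using F(3) by blast
  show ?thesis
  \<comment> \<open>For \<eta> to vanish at the chosen tree, some quantity must exceed its maximum
    there: the size if sizes are bounded, the root degree of large trees if they are not.\<close>
  proof (cases "\<exists>R. \<forall>t. \<eta> t \<noteq> 0 \<longrightarrow> rsize t \<le> R")
    case True
    then obtain R0 where R0: "\<And>t. \<eta> t \<noteq> 0 \<Longrightarrow> rsize t \<le> R0" by blast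
    define R where "R = Max {rsize t |t. \<eta> t \<noteq> 0}"
    have finR: "finite {rsize t |t. \<eta> t \<noteq> 0}"
      by (rule finite_subset[of _ "{..R0}"]) (use R0 in blast, simp)
    have "R \<in> {rsize t |t. \<eta> t \<noteq> 0}" unfolding R_def using finR nz by (intro Max_in) auto
    then obtain t1 where t1: "\<eta> t1 \<noteq> 0" "rsize t1 = R" by blast
    have RM: "rsize t \<le> R" if "\<eta> t \<noteq> 0" for t unfolding R_def using finR that by (intro Max_ge) auto
    obtain M where M: "\<And>t. \<eta> t \<noteq> 0 \<Longrightarrow> size (branches t) < M" using bounded by (meson not_le)
    define m where "m = Max {size (branches t) |t. \<eta> t \<noteq> 0 \<and> rsize t = R}"
    have finm: "finite {size (branches t) |t. \<eta> t \<noteq> 0 \<and> rsize t = R}"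
      by (rule finite_subset[of _ "{..<M}"]) (use M in blast, simp)
    have "m \<in> {size (branches t) |t. \<eta> t \<noteq> 0 \<and> rsize t = R}"
      unfolding m_def using finm t1 by (intro Max_in) auto
    then obtain t2 where t2: "\<eta> t2 \<noteq> 0" "rsize t2 = R" "size (branches t2) = m" by blast
    have mM: "size (branches t) \<le> m" if "\<eta> t \<noteq> 0" "rsize t = R" for t
      unfolding m_def using finm that by (intro Max_ge) auto
    define W where "W = Max (weight ` F)"
    have WF: "weight s \<le> W" if "s \<in> F" for s unfolding W_def using F(1) that by simp
    define k where "k = Max (size ` {s \<in> F. weight s = W})"
    have kF: "size s \<le> k" if "s \<in> F" "weight s = W" for s unfolding k_def using F(1) that by simp
    \<comment> \<open>Leading monomials have the largest weight and, among those, the largest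
      length, in the order in which size and root degree of the trees in \<open>B\<close> were
      maximized.\<close>
    define A where "A = {s \<in> F. weight s = W \<and> size s = k}"
    define B where "B = {b. \<eta> (Node b) \<noteq> 0 \<and> rsize (Node b) = R \<and> size b = m}"
    have "W \<in> weight ` F" unfolding W_def using F(1) s0 by (intro Max_in) auto
    then have "{s \<in> F. weight s = W} \<noteq> {}" by auto
    then have "k \<in> size ` {s \<in> F. weight s = W}" unfolding k_def using F(1) by (intro Max_in) auto
    then have "A \<noteq> {}" by (auto simp: A_def)
    moreover have "set_mset a \<subseteq> Z" if "a \<in> A" for a using that FZ by (auto simp: A_def)
    moreover have "branches t2 \<in> B" using t2 by (cases t2) (auto simp: B_def)
    ultimately obtain a b where ab: "a \<in> A" "b \<in> B"
      "\<And>a' b'. a' \<in> A \<Longrightarrow> b' \<in> B \<Longrightarrow> a' + b' = a + b \<Longrightarrow> a' = a"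
      using unique_decomposition[of A Z "branches t2" B] Zfin by metis
    have Rpos: "R > 0" using t1 by auto
    have v1: "\<eta> t = 0" if "rsize t > R" for t
      using RM[of t] that by (cases "\<eta> t = 0") simp_all
    have v2: "\<eta> t = 0" if "rsize t = R" "size (branches t) > m" for t
      using mM[of t] that by (cases "\<eta> t = 0") simp_all
    have "admissible
    (\<lambda>t xs. rsize t > R + weight (mset xs) \<or> rsize t = R + weight (mset xs) \<and> size (branches t) > m + length xs)
    (\<lambda>F xs. rsize (Node F) = R + weight (mset xs) \<and> size F = m + length xs)" (is "admissible ?Z ?Y")
      using v1 v2 Rpos by (rule admissible_bounded)
    moreover have len: "length (listing s) = size s" for s by (metis mset_listing size_mset)
    have sz: "rsize (Node (a + b)) = R + W" "size (a + b) = m + k"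
      using ab(1,2) by (auto simp: A_def B_def rsize_Node)
    have "\<exists>q. q \<noteq> 0 \<and> P (Node (a + b)) (\<Sum>s\<in>F. word (listing s) (dpoly (p s))) = dpoly q"
    proof (rule P_extract_sum[of ?Z ?Y])
      show "admissible ?Z ?Y" by fact
      show "finite F" "a \<in> F" "p a \<noteq> 0" "\<eta> (Node b) \<noteq> 0" using F ab by (auto simp: A_def B_def)
      show "?Y (a + b) (listing a)" using sz ab(1) by (simp add: len A_def)
      fix s assume s: "s \<in> F" "s \<noteq> a"
      show "?Z (Node (a + b)) (listing s) \<or> (?Y (a + b) (listing s) \<and> (\<forall>b'. s + b' = a + b \<longrightarrow> \<eta> (Node b') = 0))"
      proof (cases "weight s = W \<and> size s = k")
        case True
        have "\<eta> (Node b') = 0" if "s + b' = a + b" for b'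
        proof (rule ccontr)
          assume "\<eta> (Node b') \<noteq> 0"
          moreover have "rsize (Node b') = R" "size b' = m"
            using sz True unfolding that[symmetric] by (simp_all add: rsize_Node)
          ultimately have "b' \<in> B" by (simp add: B_def)
          then show False using ab(3)[OF _ _ that] s True by (simp add: A_def)
        qed
        then show ?thesis using True sz by (simp add: len)
      next
        case False
        then have "weight s < W \<or> weight s = W \<and> size s < k"
          using WF[OF s(1)] kF[OF s(1)] by auto
        then show ?thesis using sz by (auto simp: len)
      qed
    qed
    \<comment> \<open>The tree \<open>Node (a + b)\<close> has size R + W, beyond the maximum R, so
      \<eta> vanishes there.\<close>
    moreover have "0 < W"
    proof -
      obtain x s' where "s0 = add_mset x s'" using s0(2) by (cases s0) auto
      then have "rsize x \<le> W" using WF[OF s0(1)] by simp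
      then show ?thesis using rsize_pos[of x] by linarith
    qed
    then have "\<eta> (Node (a + b)) = 0" using v1[of "Node (a + b)"] sz(1) by simp
    ultimately show ?thesis by blast
  next
    case False
    obtain M where M: "\<And>t. \<eta> t \<noteq> 0 \<Longrightarrow> size (branches t) < M" using bounded by (meson not_le)
    \<comment> \<open>Root degrees attained by arbitrarily large trees with \<eta> \<noteq> 0;
      root-boundedness makes this set finite.\<close>
    define J where "J = {j. \<forall>L. \<exists>b. size b = j \<and> \<eta> (Node b) \<noteq> 0 \<and> rsize (Node b) > L}"
    have JM: "J \<subseteq> {..<M}" using M by (fastforce simp: J_def)
    then have Jfin: "finite J" using finite_subset by blast
    \<comment> \<open>Each degree outside \<open>J\<close> has its own bound on the size, and only
      degrees below M occur, so one bound serves for all.\<close>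
    have "\<exists>L. \<forall>j. j \<notin> J \<longrightarrow> (\<forall>b. size b = j \<longrightarrow> \<eta> (Node b) \<noteq> 0 \<longrightarrow> rsize (Node b) \<le> L)"
    proof -
      have "\<forall>j. \<exists>L. j \<notin> J \<longrightarrow> (\<forall>b. size b = j \<longrightarrow> \<eta> (Node b) \<noteq> 0 \<longrightarrow> rsize (Node b) \<le> L)"
        unfolding J_def by (simp, meson not_le)
      then obtain L where L: "\<And>j b. j \<notin> J \<Longrightarrow> size b = j \<Longrightarrow> \<eta> (Node b) \<noteq> 0 \<Longrightarrow> rsize (Node b) \<le> L j" by metis
      have "rsize (Node b) \<le> Max (L ` {..<M})" if "size b = j" "j \<notin> J" "\<eta> (Node b) \<noteq> 0" for j b
        using L[OF that(2,1,3)] M[OF that(3)] that(1)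
        by (intro order_trans[OF _ Max_ge[of _ "L j"]]) auto
      then show ?thesis by blast
    qed
    then obtain R where R: "\<And>b. size b \<notin> J \<Longrightarrow> \<eta> (Node b) \<noteq> 0 \<Longrightarrow> rsize (Node b) \<le> R" by blast
    have "J \<noteq> {}"
    proof
      assume "J = {}"
      then have "\<eta> t \<noteq> 0 \<Longrightarrow> rsize t \<le> R" for t using R[of "branches t"] by simp
      then show False using False by blast
    qed
    define m where "m = Max J"
    have mJ: "m \<in> J" unfolding m_def using Jfin \<open>J \<noteq> {}\<close> by (rule Max_in)
    have mR: "\<eta> t = 0" if "size (branches t) > m" "rsize t > R" for t
    proof (rule ccontr)
      assume "\<eta> t \<noteq> 0"
      then have "size (branches t) \<in> J" using R[of "branches t"] that(2) by (cases t) force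
      then have "size (branches t) \<le> m" unfolding m_def using Jfin by (intro Max_ge)
      then show False using that(1) by simp
    qed
    define k where "k = Max (size ` F)"
    have kF: "size s \<le> k" if "s \<in> F" for s unfolding k_def using F(1) that by simp
    define W where "W = Max (weight ` F)"
    have WF: "weight s \<le> W" if "s \<in> F" for s unfolding W_def using F(1) that by simp
    have kpos: "k > 0" using kF[OF s0(1)] s0(2) nonempty_has_size[of s0] by linarith
    define n where "n = Max (insert 0 (rsize ` Z))"
    have nZ: "rsize x \<le> n" if "x \<in> Z" for x unfolding n_def using Zfin that by simp
    \<comment> \<open>Length alone ranks the monomials here; sizes are taken care of by the margin
      in the choice of \<open>b0\<close>.\<close>
    define A where "A = {s \<in> F. size s = k}"
    define B where "B = {b. \<eta> (Node b) \<noteq> 0 \<and> size b = m}"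
    \<comment> \<open>Replacing \<open>b0\<close> by \<open>b\<close> below preserves only the
      letters outside \<open>Z\<close>. The other letters of \<open>b0\<close> are at most m in
      number, of size at most n each, so \<open>m * n\<close> bounds the loss and R + W
      remains.\<close>
    obtain b0 where b0: "size b0 = m" "\<eta> (Node b0) \<noteq> 0" "rsize (Node b0) > m * n + R + W"
      using mJ unfolding J_def by blast
    have "k \<in> size ` F" unfolding k_def using F(1) s0 by (intro Max_in) auto
    then have "A \<noteq> {}" by (auto simp: A_def)
    moreover have "set_mset a \<subseteq> Z" if "a \<in> A" for a using that FZ by (auto simp: A_def)
    moreover have "b0 \<in> B" using b0 by (auto simp: B_def)
    ultimately obtain a b where ab: "a \<in> A" "b \<in> B" "{#x \<in># b. x \<notin> Z#} = {#x \<in># b0. x \<notin> Z#}"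
      "\<And>a' b'. a' \<in> A \<Longrightarrow> b' \<in> B \<Longrightarrow> a' + b' = a + b \<Longrightarrow> a' = a"
      using unique_decomposition[of A Z b0 B] Zfin by metis
    have "weight {#x \<in># b0. x \<in> Z#} \<le> size {#x \<in># b0. x \<in> Z#} * n"
      by (rule weight_bounded) (use nZ in auto)
    also have "\<dots> \<le> m * n" using b0(1) size_filter_mset_lesseq[of "\<lambda>x. x \<in> Z" b0] by simp
    finally have "weight {#x \<in># b0. x \<notin> Z#} + m * n \<ge> weight b0"
      using multiset_partition[of b0 "\<lambda>x. x \<in> Z"] weight_add(1)
      by (metis add.commute add_le_cancel_left)
    moreover have "weight {#x \<in># b0. x \<notin> Z#} \<le> weight b"
      using weight_mono_subset[of "\<lambda>x. x \<notin> Z" b] ab(3) by simp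
    ultimately have big: "rsize (Node b) > R + W" using b0(3) by (simp add: rsize_Node)
    have "admissible
    (\<lambda>t xs. size (branches t) > m + length xs \<and> rsize t > R + weight (mset xs))
    (\<lambda>F xs. size F = m + length xs \<and> rsize (Node F) > R + weight (mset xs))" (is "admissible ?Z ?Y")
      using mR by (rule admissible_unbounded)
    moreover have len: "length (listing s) = size s" for s by (metis mset_listing size_mset)
    have sz: "rsize (Node (a + b)) > R + W" "size (a + b) = m + k"
      using ab(1,2) big by (auto simp: A_def B_def rsize_Node)
    have "\<exists>q. q \<noteq> 0 \<and> P (Node (a + b)) (\<Sum>s\<in>F. word (listing s) (dpoly (p s))) = dpoly q"
    proof (rule P_extract_sum[of ?Z ?Y])
      show "admissible ?Z ?Y" by fact
      show "finite F" "a \<in> F" "p a \<noteq> 0" "\<eta> (Node b) \<noteq> 0" using F ab by (auto simp: A_def B_def)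
      have Wx: "rsize (Node (a + b)) > R + weight s" if "s \<in> F" for s
        using sz(1) WF[OF that] by linarith
      show "?Y (a + b) (listing a)" using sz(2) Wx[of a] ab(1) by (simp add: len A_def)
      fix s assume s: "s \<in> F" "s \<noteq> a"
      show "?Z (Node (a + b)) (listing s) \<or> (?Y (a + b) (listing s) \<and> (\<forall>b'. s + b' = a + b \<longrightarrow> \<eta> (Node b') = 0))"
      proof (cases "size s = k")
        case True
        have "\<eta> (Node b') = 0" if "s + b' = a + b" for b'
        proof (rule ccontr)
          assume "\<eta> (Node b') \<noteq> 0"
          moreover have "size b' = m"
            using sz(2) True unfolding that[symmetric] by simp
          ultimately have "b' \<in> B" by (simp add: B_def)
          then show False using ab(4)[OF _ _ that] s True by (simp add: A_def)
        qed
        then show ?thesis using True sz(2) Wx[OF s(1)] by (simp add: len)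
      next
        case False
        then have "size s < k" using kF[OF s(1)] by simp
        then show ?thesis using sz(2) Wx[OF s(1)] by (simp add: len)
      qed
    qed
    moreover have "\<eta> (Node (a + b)) = 0" using mR[of "Node (a + b)"] sz kpos by (simp)
    ultimately show ?thesis by blast
  qed
qed

end

context whittaker begin

section \<open>The submodule generated by the Whittaker vector\<close>

text \<open>It is singled out because the ambient type may contain vectors that \<open>w\<close>
  does not generate.\<close>

inductive_set cyc :: "'m set" where
  base: "w \<in> cyc"
| add: "u \<in> cyc \<Longrightarrow> v \<in> cyc \<Longrightarrow> u + v \<in> cyc"
| smul: "v \<in> cyc \<Longrightarrow> scale c v \<in> cyc"
| act: "v \<in> cyc \<Longrightarrow> X x v \<in> cyc"

definition words :: "'m set" where
  "words = span {word xs (dpoly p) |xs p. True}"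

lemma word_words: "word xs (dpoly p) \<in> words"
  unfolding words_def by (rule span_base) blast

lemma N_words: "v \<in> words \<Longrightarrow> N a v \<in> words"
  unfolding words_def
proof (induction rule: span_induct_alt)
  case base
  then show ?case by (simp add: span_zero)
next
  case (step c x y)
  then obtain zs p where "x = word zs (dpoly p)" by blast
  then have "N a x \<in> span {word xs (dpoly p) |xs p. True}"
    using word_words[of "a # zs" p] by (simp add: words_def)
  then show ?case using step by (simp add: X_addv X_scalev span_add span_scale)
qed

lemma X_dpoly_words: "X x (dpoly p) \<in> words"
proof -
  have "X (basis_vec a 1) (dpoly p) \<in> words" for a
  proof (cases a)
    case Dgen
    then show ?thesis using word_words[of "[]" "pCons 0 p"] by simp
  next
    case (Plus r)
    then show ?thesis
      using P_dpoly[of "code r" p] word_words[of "[]"] span_scale by (simp add: words_def)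
  next
    case (Minus r)
    then show ?thesis using word_words[of "[code r]" p] by simp
  qed
  then show ?thesis
    unfolding X_expand[of x] words_def by (intro span_sum span_scale) (simp add: words_def)
qed

text \<open>Moving \<open>x\<close> past the first letter leaves a commutator, again an element of
  the Lie algebra, acting on the shorter word; hence the induction for all \<open>x\<close> at
  once.\<close>

lemma X_word_words: "X x (word xs (dpoly p)) \<in> words"
proof (induction xs arbitrary: x)
  case Nil
  then show ?case by (simp add: X_dpoly_words)
next
  case (Cons y xs)
  have "X x (word (y # xs) (dpoly p)) = N y (X x (word xs (dpoly p)))
      + X (ie_bracket x (dminus y)) (word xs (dpoly p))"
    by (simp add: X_bracket)
  then show ?case
    using N_words[OF Cons] Cons span_add unfolding words_def by metis
qed

lemma X_words: "v \<in> words \<Longrightarrow> X x v \<in> words"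
  unfolding words_def
proof (induction rule: span_induct_alt)
  case base
  then show ?case by (simp add: span_zero)
next
  case (step c u y)
  then have "X x u \<in> span {word xs (dpoly p) |xs p. True}"
    using X_word_words[of x] by (auto simp: words_def)
  then show ?case using step by (simp add: X_addv X_scalev span_add span_scale)
qed

lemma cyc_words: "v \<in> cyc \<Longrightarrow> v \<in> words"
proof (induction rule: cyc.induct)
  case base
  then show ?case using word_words[of "[]" "[:1:]"] by simp
next
  case (add u v)
  then show ?case unfolding words_def by (intro span_add)
next
  case (smul v c)
  then show ?case unfolding words_def by (intro span_scale)
next
  case (act v x)
  then show ?case by (intro X_words)
qed

lemma words_expand:
  assumes "v \<in> words"
  obtains F p where "finite F" "\<And>s. s \<in> F \<Longrightarrow> p s \<noteq> 0"
    "v = (\<Sum>s\<in>F. word (listing s) (dpoly (p s)))"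
proof -
  let ?M = "{word (listing s) (dpoly p) |s p. True}"
  have "words \<subseteq> span ?M"
    unfolding words_def
  proof (rule span_minimal)
    show "{word xs (dpoly p) |xs p. True} \<subseteq> span ?M"
    proof clarify
      fix xs p
      have "span {word (listing s) (dpoly p) |s. True} \<subseteq> span ?M" by (rule span_mono) blast
      then show "word xs (dpoly p) \<in> span ?M" using word_sorted[of xs "dpoly p"] by blast
    qed
  qed (rule subspace_span)
  then have "v \<in> span ?M" using assms by blast
  then have "\<exists>p. finite {s. p s \<noteq> 0} \<and> v = (\<Sum>s | p s \<noteq> 0. word (listing s) (dpoly (p s)))"
  proof (induction rule: span_induct_alt)
    case base
    then show ?case by (intro exI[of _ "\<lambda>_. 0"]) simp
  next
    case (step c x y)
    then obtain s0 p0 where x: "x = word (listing s0) (dpoly p0)" by blast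
    obtain q where q: "finite {s. q s \<noteq> 0}" "y = (\<Sum>s | q s \<noteq> 0. word (listing s) (dpoly (q s)))"
      using step by blast
    define q' where "q' = (\<lambda>s. if s = s0 then q s + smult c p0 else q s)"
    let ?T = "insert s0 {s. q s \<noteq> 0}"
    have sub: "{s. q' s \<noteq> 0} \<subseteq> ?T" by (auto simp: q'_def)
    have fT: "finite ?T" using q(1) by simp
    have "(\<Sum>s | q' s \<noteq> 0. word (listing s) (dpoly (q' s))) = (\<Sum>s\<in>?T. word (listing s) (dpoly (q' s)))"
      using fT sub by (intro sum.mono_neutral_left) auto
    also have "\<dots> = (\<Sum>s\<in>?T. word (listing s) (dpoly (q s)) + (if s = s0 then scale c x else 0))"
      by (intro sum.cong) (auto simp: q'_def x dpoly_add dpoly_smult word_add word_scale)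
    also have "\<dots> = scale c x + (\<Sum>s\<in>?T. word (listing s) (dpoly (q s)))"
      using fT by (simp add: sum.distrib add.commute del: sum.insert)
    also have "(\<Sum>s\<in>?T. word (listing s) (dpoly (q s))) = y"
      unfolding q(2) using fT by (intro sum.mono_neutral_right) auto
    finally show ?case using finite_subset[OF sub fT] by metis
  qed
  then show ?thesis using that[of "{s. p s \<noteq> 0}" p for p] by blast
qed

definition invariant :: "'m set \<Rightarrow> bool" where
  "invariant S \<longleftrightarrow> subspace S \<and> (\<forall>x. \<forall>v\<in>S. X x v \<in> S)"

text \<open>Used for submodules, and with \<open>S = {0}\<close> as well, where it says that
  \<open>dpoly\<close> is injective if \<open>w\<close> is nonzero.\<close>

lemma dpoly_reaches:
  assumes "invariant S" "\<eta> t \<noteq> 0"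
  shows "dpoly q \<in> S \<Longrightarrow> q \<noteq> 0 \<Longrightarrow> w \<in> S"
proof (induction "degree q" arbitrary: q rule: less_induct)
  case less
  have S: "subspace S" using assms(1) by (simp add: invariant_def)
  show ?case
  proof (cases "degree q = 0")
    case True
    then obtain c where c: "q = [:c:]" "c \<noteq> 0" using less.prems(2) degree_eq_zeroE by (metis pCons_0_0)
    then have "scale c w \<in> S" using less.prems(1) by simp
    then have "scale (inverse c) (scale c w) \<in> S" using S subspace_scale by blast
    then show ?thesis using c(2) by simp
  next
    case False
    let ?n = "of_nat (rsize t) :: complex"
    let ?q = "pcompose q [:- ?n, 1:] - q"
    have n: "- ?n \<noteq> 0" using rsize_pos[of t] by (simp del: rsize_pos)
    have "P t (dpoly q) - scale (\<eta> t) (dpoly q) \<in> S"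
      using assms(1) less.prems(1) S by (intro subspace_diff subspace_scale) (auto simp: invariant_def)
    also have "P t (dpoly q) - scale (\<eta> t) (dpoly q) = scale (\<eta> t) (dpoly ?q)"
      by (simp add: P_dpoly dpoly_diff scale_right_diff_distrib)
    finally have "scale (inverse (\<eta> t)) (scale (\<eta> t) (dpoly ?q)) \<in> S" using S subspace_scale by blast
    then have "dpoly ?q \<in> S" using assms(2) by simp
    then show ?thesis using less.hyps pcompose_shift_eq[OF n False] by blast
  qed
qed

context
  assumes bounded: "\<exists>M. \<forall>t. M \<le> size (branches t) \<longrightarrow> \<eta> t = 0"
    and nz: "\<exists>t. \<eta> t \<noteq> 0"
begin

lemma dpoly_case: "F \<subseteq> {{#}} \<Longrightarrow> \<exists>q. (\<Sum>s\<in>F. word (listing s) (dpoly (p s))) = dpoly q"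
proof -
  assume "F \<subseteq> {{#}}"
  moreover have "listing {#} = []" by (metis mset_listing mset_zero_iff)
  ultimately show ?thesis by (cases "F = {}") (auto simp: subset_singleton_iff intro: exI[of _ 0])
qed

theorem invariant_contains:
  assumes "invariant S" "v \<in> S" "v \<in> cyc" "v \<noteq> 0"
  shows "w \<in> S"
proof -
  obtain F p where F: "finite F" "\<And>s. s \<in> F \<Longrightarrow> p s \<noteq> 0"
    "v = (\<Sum>s\<in>F. word (listing s) (dpoly (p s)))" using words_expand[OF cyc_words[OF assms(3)]] by blast
  obtain t where t: "\<eta> t \<noteq> 0" using nz by blast
  have "\<exists>q. q \<noteq> 0 \<and> dpoly q \<in> S"
  proof (cases "F \<subseteq> {{#}}")
    case True
    then obtain q where "v = dpoly q" using dpoly_case[OF True, of p] unfolding F(3)[symmetric] by metis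
    then show ?thesis using assms(2,4) by (intro exI[of _ q]) auto
  next
    case False
    then have ne: "\<exists>s\<in>F. s \<noteq> {#}" by blast
    have "\<exists>t q. q \<noteq> 0 \<and> \<eta> t = 0 \<and> P t v = dpoly q"
      unfolding F(3) by (rule P_reduces[OF F(1) _ ne bounded nz]) (rule F(2))
    then obtain t q where "q \<noteq> 0" "P t v = dpoly q" by blast
    then show ?thesis using assms(1,2) unfolding invariant_def by metis
  qed
  then show ?thesis using dpoly_reaches[OF assms(1) t] by blast
qed

text \<open>The tree found by \<open>P_reduces\<close> satisfies \<eta> t = 0, so its operator kills
  a Whittaker vector, although the result should be q(d) w with q \<noteq> 0: no letters can occur
  in v. For a vector q(d) w the Whittaker condition says that q is invariant under a shift, hence
  constant.\<close>

theorem whittaker_vector_unique: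
  assumes "v \<in> cyc" "\<And>t. P t v = scale (\<eta> t) v" "w \<noteq> 0"
  shows "\<exists>c. v = scale c w"
proof -
  obtain F p where F: "finite F" "\<And>s. s \<in> F \<Longrightarrow> p s \<noteq> 0"
    "v = (\<Sum>s\<in>F. word (listing s) (dpoly (p s)))" using words_expand[OF cyc_words[OF assms(1)]] by blast
  obtain t where t: "\<eta> t \<noteq> 0" using nz by blast
  have "invariant {0}" by (simp add: invariant_def)
  then have indep: "q = 0" if "dpoly q = 0" for q
    using dpoly_reaches[of "{0}" t q] t that assms(3) by auto
  have sub: "F \<subseteq> {{#}}"
  proof (rule ccontr)
    assume "\<not> F \<subseteq> {{#}}"
    then have ne: "\<exists>s\<in>F. s \<noteq> {#}" by blast
    have "\<exists>t q. q \<noteq> 0 \<and> \<eta> t = 0 \<and> P t v = dpoly q"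
      unfolding F(3) by (rule P_reduces[OF F(1) _ ne bounded nz]) (rule F(2))
    then obtain t q where "q \<noteq> 0" "\<eta> t = 0" "P t v = dpoly q" by blast
    then show False using assms(2)[of t] indep by simp
  qed
  then obtain q where q: "v = dpoly q" using dpoly_case[OF sub, of p] unfolding F(3)[symmetric] by metis
  have "degree q = 0"
  proof (rule ccontr)
    assume d: "degree q \<noteq> 0"
    let ?n = "of_nat (rsize t) :: complex"
    have n: "- ?n \<noteq> 0" using rsize_pos[of t] by (simp del: rsize_pos)
    have "scale (\<eta> t) (dpoly (pcompose q [:- ?n, 1:] - q)) = 0"
      using assms(2)[of t] unfolding q P_dpoly by (simp add: dpoly_diff scale_right_diff_distrib)
    then have "dpoly (pcompose q [:- ?n, 1:] - q) = 0" using t scale_eq_0_iff by blast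
    then have "pcompose q [:- ?n, 1:] - q = 0" by (rule indep)
    then show False using pcompose_shift_eq(1)[OF n d] by blast
  qed
  then obtain c where "q = [:c:]" using degree_eq_zeroE by blast
  then show ?thesis unfolding q by auto
qed

end

end

section \<open>Free and enveloping algebras\<close>

lemma poly_mapping_sum_keys: "(\<Sum>a\<in>Poly_Mapping.keys x. Poly_Mapping.single a (Poly_Mapping.lookup x a)) = x"
  by (rule poly_mapping_eqI) (auto simp: lookup_sum lookup_single when_def in_keys_iff)

lemma poly_mapping_single_induct [case_names single add]:
  fixes p :: "'a \<Rightarrow>\<^sub>0 'b::comm_monoid_add"
  assumes "\<And>m c. Q (Poly_Mapping.single m c)" "\<And>p q. Q p \<Longrightarrow> Q q \<Longrightarrow> Q (p + q)"
  shows "Q p"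
proof -
  have "Q (\<Sum>a\<in>K. Poly_Mapping.single a (Poly_Mapping.lookup p a))" if "finite K" for K
    using that
  proof induction
    case empty
    show ?case using assms(1)[of undefined 0] by simp
  next
    case (insert a K)
    then show ?case using assms by simp
  qed
  then show ?thesis using poly_mapping_sum_keys[of p] by (metis finite_keys)
qed

lemma letters_plus [simp]: "letters (u + v) = letters u @ letters v" "letters 0 = []"
  by (simp_all add: plus_fmon_def zero_fmon_def)

lemma free_eval_superset:
  "finite K \<Longrightarrow> Poly_Mapping.keys p \<subseteq> K \<Longrightarrow>
    free_eval \<eta> p = (\<Sum>w\<in>K. Poly_Mapping.lookup p w * prod_list (map \<eta> (letters w)))"
  unfolding free_eval_def by (rule sum.mono_neutral_left) (auto simp: in_keys_iff)

lemma free_eval_add: "free_eval \<eta> (p + q) = free_eval \<eta> p + free_eval \<eta> q"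
proof -
  let ?K = "Poly_Mapping.keys p \<union> Poly_Mapping.keys q"
  have "finite ?K" by simp
  then show ?thesis
    using free_eval_superset[of ?K p \<eta>] free_eval_superset[of ?K q \<eta>]
      free_eval_superset[of ?K "p + q" \<eta>] keys_add[of p q]
    by (simp add: lookup_add distrib_right sum.distrib)
qed

lemma free_eval_single: "free_eval \<eta> (Poly_Mapping.single w c) = c * prod_list (map \<eta> (letters w))"
  using free_eval_superset[of "{w}" "Poly_Mapping.single w c"] by (simp add: lookup_single)

lemma free_eval_zero [simp]: "free_eval \<eta> 0 = 0"
  by (simp add: free_eval_def)

lemma free_eval_diff: "free_eval \<eta> (p - q) = free_eval \<eta> p - free_eval \<eta> q"
  using free_eval_add[of \<eta> "p - q" q] by simp

lemma free_eval_mult: "free_eval \<eta> (p * q) = free_eval \<eta> p * free_eval \<eta> q"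
proof (induction p rule: poly_mapping_single_induct)
  case (single m c)
  show ?case
    by (induction q rule: poly_mapping_single_induct)
       (simp_all add: mult_single free_eval_single free_eval_add distrib_left)
next
  case (add p q)
  then show ?case by (simp add: distrib_right free_eval_add)
qed

lemma free_eval_fgen [simp]: "free_eval \<eta> (fgen x) = \<eta> x"
  by (simp add: fgen_def free_eval_single)

lemma free_eval_fconst [simp]: "free_eval \<eta> (fconst c) = c"
  by (simp add: fconst_def free_eval_single)

lemma fconst_simps:
  "fconst (a + b) = fconst a + fconst b" "fconst (a * b) = fconst a * fconst b" "fconst 1 = 1" "fconst 0 = 0"
  by (simp_all add: fconst_def single_add mult_single)

lemma fconst_commute: "fconst c * p = p * fconst c"
proof (induction p rule: poly_mapping_single_induct)
  case (single m d)
  then show ?case by (simp add: fconst_def mult_single mult.commute)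
next
  case (add p q)
  then show ?case by (simp add: distrib_left distrib_right)
qed

lemma single_Cons: "Poly_Mapping.single (FMon (x # xs)) c = fgen x * Poly_Mapping.single (FMon xs) c"
  by (simp add: fgen_def mult_single plus_fmon_def)

lemma single_Nil: "Poly_Mapping.single (FMon []) c = fconst c"
  by (simp add: fconst_def zero_fmon_def)

lemma free_algebra_simps [simp]:
  "carrier (free_algebra L) = {p. \<forall>w\<in>Poly_Mapping.keys p. set (letters w) \<subseteq> L}"
  "monoid.mult (free_algebra L) = (*)" "monoid.one (free_algebra L) = 1"
  "ring.zero (free_algebra L) = 0" "ring.add (free_algebra L) = (+)"
  by (simp_all add: free_algebra_def)

lemma ring_free_algebra: "ring (free_algebra L)"
proof (rule ringI)
  let ?C = "{p :: 'a fmon \<Rightarrow>\<^sub>0 complex. \<forall>w\<in>Poly_Mapping.keys p. set (letters w) \<subseteq> L}"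
  have closed: "p + q \<in> ?C" "p * q \<in> ?C" "- p \<in> ?C" "0 \<in> ?C" "1 \<in> ?C" if "p \<in> ?C" "q \<in> ?C" for p q
  proof -
    show "p + q \<in> ?C" using that keys_add[of p q] by blast
    show "p * q \<in> ?C"
    proof clarify
      fix w x assume w: "w \<in> Poly_Mapping.keys (p * q)" "x \<in> set (letters w)"
      then obtain a b where "w = a + b" "a \<in> Poly_Mapping.keys p" "b \<in> Poly_Mapping.keys q"
        using keys_mult[of p q] by blast
      then show "x \<in> L" using that w(2) by auto
    qed
    show "- p \<in> ?C" using that by simp
    show "0 \<in> ?C" by simp
    have "Poly_Mapping.keys (1 :: 'a fmon \<Rightarrow>\<^sub>0 complex) \<subseteq> {0}" by simp
    then show "1 \<in> ?C" by auto
  qed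
  show "abelian_group (free_algebra L)"
  proof (rule abelian_groupI)
    show "\<exists>y\<in>carrier (free_algebra L). y \<oplus>\<^bsub>free_algebra L\<^esub> x = \<zero>\<^bsub>free_algebra L\<^esub>"
      if "x \<in> carrier (free_algebra L)" for x
      using closed(3)[of x x] that by (intro bexI[of _ "- x"]) auto
    show "x \<oplus>\<^bsub>free_algebra L\<^esub> y \<in> carrier (free_algebra L)"
      if "x \<in> carrier (free_algebra L)" "y \<in> carrier (free_algebra L)" for x y
      unfolding free_algebra_simps by (rule closed) (use that in \<open>simp_all only: free_algebra_simps\<close>)
    show "\<zero>\<^bsub>free_algebra L\<^esub> \<in> carrier (free_algebra L)" by simp
  qed (simp_all add: add.assoc add.commute)
  show "monoid (free_algebra L)"
  proof (rule monoidI)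
    show "x \<otimes>\<^bsub>free_algebra L\<^esub> y \<in> carrier (free_algebra L)"
      if "x \<in> carrier (free_algebra L)" "y \<in> carrier (free_algebra L)" for x y
      unfolding free_algebra_simps by (rule closed) (use that in \<open>simp_all only: free_algebra_simps\<close>)
    show "\<one>\<^bsub>free_algebra L\<^esub> \<in> carrier (free_algebra L)"
      unfolding free_algebra_simps by (rule closed[of 0 0]) simp_all
  qed (simp_all add: mult.assoc)
qed (simp_all add: distrib_left distrib_right)

lemma a_minus_free_algebra:
  "p \<in> carrier (free_algebra L) \<Longrightarrow> \<ominus>\<^bsub>free_algebra L\<^esub> p = - p"
proof -
  assume p: "p \<in> carrier (free_algebra L)"
  interpret ring "free_algebra L" by (rule ring_free_algebra)
  have "- p \<in> carrier (free_algebra L)" using p by simp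
  then show ?thesis using p minus_equality[of "- p" p] by simp
qed

lemma free_algebra_closed:
  assumes "p \<in> carrier (free_algebra L)" "q \<in> carrier (free_algebra L)"
  shows "p + q \<in> carrier (free_algebra L)" "p * q \<in> carrier (free_algebra L)"
    "p - q \<in> carrier (free_algebra L)" "- p \<in> carrier (free_algebra L)"
proof -
  interpret ring "free_algebra L" by (rule ring_free_algebra)
  show "p + q \<in> carrier (free_algebra L)" "p * q \<in> carrier (free_algebra L)"
    "p - q \<in> carrier (free_algebra L)" "- p \<in> carrier (free_algebra L)"
    using a_closed[OF assms] m_closed[OF assms] minus_closed[OF assms] a_inv_closed[OF assms(1)]
      a_minus_free_algebra[OF assms(1)] a_minus_free_algebra[OF assms(2)]
    by (simp_all add: a_minus_def del: free_algebra_simps(1))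
qed

lemma zero_carrier: "0 \<in> carrier (free_algebra L)"
  by simp

lemma fconst_carrier: "fconst c \<in> carrier (free_algebra L)"
  by (simp add: fconst_def)

lemma fgen_carrier: "x \<in> L \<Longrightarrow> fgen x \<in> carrier (free_algebra L)"
  by (simp add: fgen_def)

lemma ideal_free_algebraI:
  assumes "I \<subseteq> carrier (free_algebra L)" "0 \<in> I" "\<And>p q. p \<in> I \<Longrightarrow> q \<in> I \<Longrightarrow> p + q \<in> I" "\<And>p. p \<in> I \<Longrightarrow> - p \<in> I"
    "\<And>p q. p \<in> I \<Longrightarrow> q \<in> carrier (free_algebra L) \<Longrightarrow> q * p \<in> I"
    "\<And>p q. p \<in> I \<Longrightarrow> q \<in> carrier (free_algebra L) \<Longrightarrow> p * q \<in> I"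
  shows "ideal I (free_algebra L)"
proof (rule idealI[OF ring_free_algebra])
  interpret ring "free_algebra L" by (rule ring_free_algebra)
  show "subgroup I (add_monoid (free_algebra L))"
  proof (rule subgroup.intro)
    show "inv\<^bsub>add_monoid (free_algebra L)\<^esub> x \<in> I" if "x \<in> I" for x
      using a_minus_free_algebra[of x L] assms(1,4) that unfolding a_inv_def by auto
  qed (use assms in auto)
qed (use assms in simp_all)

lemma env_relations_carrier:
  assumes "\<And>x y. x \<in> L \<Longrightarrow> y \<in> L \<Longrightarrow> x + y \<in> L" "\<And>c x. x \<in> L \<Longrightarrow> sc c x \<in> L"
    "\<And>x y. x \<in> L \<Longrightarrow> y \<in> L \<Longrightarrow> br x y \<in> L"
  shows "env_relations sc br L \<subseteq> carrier (free_algebra L)"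
  unfolding env_relations_def using assms
  by (auto simp del: free_algebra_simps(1) intro!: free_algebra_closed fgen_carrier fconst_carrier)

section \<open>Evaluating the free algebra in a representation\<close>

context g_rep
begin

definition ev :: "(ie fmon \<Rightarrow>\<^sub>0 complex) \<Rightarrow> 'm \<Rightarrow> 'm" where
  "ev p v = (\<Sum>m\<in>Poly_Mapping.keys p. scale (Poly_Mapping.lookup p m) (foldr X (letters m) v))"

lemma ev_superset:
  "finite K \<Longrightarrow> Poly_Mapping.keys p \<subseteq> K \<Longrightarrow>
    ev p v = (\<Sum>m\<in>K. scale (Poly_Mapping.lookup p m) (foldr X (letters m) v))"
  unfolding ev_def by (rule sum.mono_neutral_left) (auto simp: in_keys_iff)

lemma ev_add: "ev (p + q) v = ev p v + ev q v"
proof -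
  let ?K = "Poly_Mapping.keys p \<union> Poly_Mapping.keys q"
  have "finite ?K" by simp
  then show ?thesis
    using ev_superset[of ?K p v] ev_superset[of ?K q v] ev_superset[of ?K "p + q" v] keys_add[of p q]
    by (simp add: lookup_add scale_left_distrib sum.distrib)
qed

lemma ev_single: "ev (Poly_Mapping.single m c) v = scale c (foldr X (letters m) v)"
  using ev_superset[of "{m}" "Poly_Mapping.single m c"] by (simp add: lookup_single)

lemma ev_zero [simp]: "ev 0 v = 0"
  by (simp add: ev_def)

lemma ev_diff: "ev (p - q) v = ev p v - ev q v"
  using ev_add[of "p - q" q v] by simp

lemma ev_minus: "ev (- q) v = - ev q v"
  using ev_diff[of 0 q v] by simp

lemma foldr_scale: "foldr X xs (scale c v) = scale c (foldr X xs v)"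
  by (induction xs) (simp_all add: X_scalev)

lemma foldr_add: "foldr X xs (u + v) = foldr X xs u + foldr X xs v"
  by (induction xs) (simp_all add: X_addv)

lemma ev_addv: "ev p (u + v) = ev p u + ev p v"
  by (simp add: ev_def foldr_add scale_right_distrib sum.distrib)

lemma ev_scalev: "ev p (scale c v) = scale c (ev p v)"
  by (simp add: ev_def foldr_scale scale_sum_right mult.commute)

lemma ev_zerov [simp]: "ev p 0 = 0"
  using ev_scalev[of p 0 0] by simp

lemma ev_mult: "ev (p * q) v = ev p (ev q v)"
proof (induction p rule: poly_mapping_single_induct)
  case (single m c)
  show ?case
    by (induction q rule: poly_mapping_single_induct)
       (simp_all add: mult_single ev_single ev_add distrib_left ev_addv foldr_scale)
next
  case (add p q)
  then show ?case by (simp add: distrib_right ev_add)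
qed

lemma ev_fgen [simp]: "ev (fgen x) v = X x v"
  by (simp add: fgen_def ev_single)

lemma ev_fconst [simp]: "ev (fconst c) v = scale c v"
  by (simp add: fconst_def ev_single)

text \<open>The elements that act as zero on the whole representation form an ideal containing the
  relations, so the action descends to the enveloping algebra.\<close>

lemma ev_env_ideal: "p \<in> env_ideal ie_scale ie_bracket UNIV \<Longrightarrow> ev p v = 0"
proof -
  interpret ring "free_algebra (UNIV :: ie set)" by (rule ring_free_algebra)
  let ?I = "{p. \<forall>v. ev p v = 0}"
  have "ideal ?I (free_algebra UNIV)"
    by (rule ideal_free_algebraI) (auto simp: ev_add ev_minus ev_mult)
  moreover have "env_relations ie_scale ie_bracket UNIV \<subseteq> ?I"
    by (auto simp: env_relations_def ev_diff ev_mult X_add X_scale X_bracket)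
  ultimately have "env_ideal ie_scale ie_bracket UNIV \<subseteq> ?I"
    unfolding env_ideal_def by (rule genideal_minimal)
  then show "p \<in> env_ideal ie_scale ie_bracket UNIV \<Longrightarrow> ev p v = 0" by blast
qed

end

section \<open>The positive subalgebra\<close>

lemma n_plus_add: "x \<in> n_plus \<Longrightarrow> y \<in> n_plus \<Longrightarrow> x + y \<in> n_plus"
  unfolding n_plus_def by (rule ie.span_add)

lemma n_plus_scale: "x \<in> n_plus \<Longrightarrow> ie_scale c x \<in> n_plus"
  unfolding n_plus_def by (rule ie.span_scale)

lemma dplus_n_plus: "dplus t \<in> n_plus"
  unfolding n_plus_def by (rule ie.span_base) blast

lemma n_plus_induct [consumes 1, case_names zero step]:
  assumes "x \<in> n_plus" "Q 0"
    "\<And>c t y. y \<in> n_plus \<Longrightarrow> Q y \<Longrightarrow> Q (ie_scale c (dplus t) + y)"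
  shows "Q x"
proof -
  have "x \<in> n_plus \<and> Q x"
    using assms(1) unfolding n_plus_def
  proof (induction rule: ie.span_induct_alt)
    case base
    show ?case using assms(2) by (simp add: ie.span_zero)
  next
    case (step c x y)
    then obtain t where "x = basis_vec (Plus t) 1" by blast
    then have x: "x = dplus (code t)" by simp
    have y: "y \<in> n_plus" using step unfolding n_plus_def by blast
    then have "Q (ie_scale c x + y)" unfolding x using step by (intro assms(3)) auto
    then show ?case
      using n_plus_add[OF n_plus_scale[OF dplus_n_plus[of "code t"]] y, of c] unfolding x n_plus_def by blast
  qed
  then show ?thesis ..
qed

lemma n_plus_keys: "x \<in> n_plus \<Longrightarrow> Poly_Mapping.keys x \<subseteq> range Plus"
  unfolding n_plus_def
proof (induction rule: ie.span_induct_alt)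
  case base
  then show ?case by simp
next
  case (step c x y)
  have "Poly_Mapping.keys (ie_scale c x) \<subseteq> Poly_Mapping.keys x"
    by (auto simp: in_keys_iff lookup_ie_scale)
  then have "Poly_Mapping.keys (ie_scale c x + y) \<subseteq> Poly_Mapping.keys x \<union> Poly_Mapping.keys y"
    using keys_add[of "ie_scale c x" y] by blast
  moreover have "Poly_Mapping.keys x \<subseteq> range Plus" using step by auto
  ultimately show ?case using step by blast
qed

lemma n_plus_sum_mset: "(\<Sum>r\<in>#M. dplus r) \<in> n_plus"
  by (induction M) (auto simp: n_plus_def ie.span_zero intro!: n_plus_add[unfolded n_plus_def] dplus_n_plus[unfolded n_plus_def])

lemma n_plus_minus: "x \<in> n_plus \<Longrightarrow> y \<in> n_plus \<Longrightarrow> x - y \<in> n_plus"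
  unfolding n_plus_def by (rule ie.span_diff)

lemma n_plus_bracket: "x \<in> n_plus \<Longrightarrow> y \<in> n_plus \<Longrightarrow> ie_bracket x y \<in> n_plus"
proof -
  assume x: "x \<in> n_plus" and y: "y \<in> n_plus"
  have g: "gen_bracket a b \<in> n_plus" if ab: "a \<in> Poly_Mapping.keys x" "b \<in> Poly_Mapping.keys y" for a b
  proof -
    have "a \<in> range Plus" "b \<in> range Plus" using ab n_plus_keys[OF x] n_plus_keys[OF y] by blast+
    then obtain s t where "a = Plus (tr s)" "b = Plus (tr t)" by (metis imageE tr_code)
    then show ?thesis using n_plus_minus[OF n_plus_sum_mset n_plus_sum_mset] bracket_plus_plus
      by (simp add: insum_def del: gen_bracket.simps)
  qed
  show ?thesis
    unfolding ie_bracket_def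
    by (subst n_plus_def, intro ie.span_sum ie.span_scale, fold n_plus_def) (rule g)
qed

section \<open>The contragredient representation on functions of trees\<close>

definition fscale :: "complex \<Rightarrow> (rt \<Rightarrow> complex) \<Rightarrow> rt \<Rightarrow> complex" where
  "fscale c f = (\<lambda>u. c * f u)"

primrec gact :: "ie_gen \<Rightarrow> (rt \<Rightarrow> complex) \<Rightarrow> rt \<Rightarrow> complex" where
  "gact Dgen f = (\<lambda>u. - of_nat (rsize u) * f u)"
| "gact (Plus t) f = (\<lambda>u. - insum (code t) u f)"
| "gact (Minus s) f = (\<lambda>u. - cutsum u (\<lambda>p q. if p = code s then f q else 0))"

definition tree_act :: "ie \<Rightarrow> (rt \<Rightarrow> complex) \<Rightarrow> rt \<Rightarrow> complex" where
  "tree_act x f = (\<lambda>u. \<Sum>a\<in>Poly_Mapping.keys x. Poly_Mapping.lookup x a * gact a f u)"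

lemma tree_act_superset:
  "finite K \<Longrightarrow> Poly_Mapping.keys x \<subseteq> K \<Longrightarrow> tree_act x f u = (\<Sum>a\<in>K. Poly_Mapping.lookup x a * gact a f u)"
  unfolding tree_act_def by (rule sum.mono_neutral_left) (auto simp: in_keys_iff)

lemma tree_act_add: "tree_act (x + y) f = tree_act x f + tree_act y f"
proof
  fix u
  let ?K = "Poly_Mapping.keys x \<union> Poly_Mapping.keys y"
  have "finite ?K" by simp
  then show "tree_act (x + y) f u = (tree_act x f + tree_act y f) u"
    using tree_act_superset[of ?K x f u] tree_act_superset[of ?K y f u]
      tree_act_superset[of ?K "x + y" f u] keys_add[of x y]
    by (simp add: lookup_add distrib_right sum.distrib)
qed

lemma tree_act_scale: "tree_act (ie_scale c x) f = fscale c (tree_act x f)"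
proof
  fix u
  have "Poly_Mapping.keys (ie_scale c x) \<subseteq> Poly_Mapping.keys x"
    by (auto simp: in_keys_iff lookup_ie_scale)
  then show "tree_act (ie_scale c x) f u = fscale c (tree_act x f) u"
    using tree_act_superset[of "Poly_Mapping.keys x" "ie_scale c x" f u]
    by (simp add: lookup_ie_scale fscale_def tree_act_def sum_distrib_left mult.assoc)
qed

lemma tree_act_basis: "tree_act (basis_vec a c) f u = c * gact a f u"
  using tree_act_superset[of "{a}" "basis_vec a c" f u] by (simp add: lookup_single)

lemma tree_act_zero [simp]: "tree_act 0 f = 0"
  by (simp add: tree_act_def fun_eq_iff)

lemma tree_act_minus: "tree_act (- x) f = - tree_act x f"
  using tree_act_add[of x "- x" f] by (simp add: eq_neg_iff_add_eq_0 add.commute)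

lemma tree_act_diff: "tree_act (x - y) f = tree_act x f - tree_act y f"
  using tree_act_add[of x "- y" f] by (simp add: tree_act_minus)

lemma tree_act_sum: "tree_act (\<Sum>i\<in>I. g i) f u = (\<Sum>i\<in>I. tree_act (g i) f u)"
  by (induction I rule: infinite_finite_induct) (simp_all add: tree_act_add)

lemma tree_act_sum_mset: "tree_act (\<Sum>i\<in>#I. g i) f u = (\<Sum>i\<in>#I. tree_act (g i) f u)"
  by (induction I) (simp_all add: tree_act_add)

lemma cutsum_cmult: "cutsum u (\<lambda>p q. c * \<psi> p q) = c * (cutsum u \<psi> :: complex)"
  by (simp add: cutsum_def case_prod_unfold sum_mset_distrib_left)

lemma cutsum_uminus: "cutsum u (\<lambda>p q. - \<psi> p q) = - (cutsum u \<psi> :: complex)"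
  using cutsum_cmult[of u "-1"] by simp

lemma cutsum_cong: "(\<And>p q. (p, q) \<in># cuts u \<Longrightarrow> \<phi> p q = \<psi> p q) \<Longrightarrow> cutsum u \<phi> = cutsum u \<psi>"
  unfolding cutsum_def by (intro sum_mset_cong) auto

lemma insum_cong: "(\<And>a. a \<in># ins t u \<Longrightarrow> \<phi> a = \<psi> a) \<Longrightarrow> insum t u \<phi> = insum t u \<psi>"
  unfolding insum_def by (intro sum_mset_cong) auto

lemma insum_plus: "insum t u (f + g) = insum t u f + (insum t u g :: complex)"
  by (simp add: plus_fun_def insum_add)

lemma gact_add: "gact a (f + g) = gact a f + gact a g"
proof (cases a)
  case (Minus s)
  have "cutsum u (\<lambda>p q. if p = code s then f q + g q else 0) =
      cutsum u (\<lambda>p q. (if p = code s then f q else 0) + (if p = code s then g q else 0))" for u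
    by (rule cutsum_cong) simp
  then show ?thesis by (simp add: Minus fun_eq_iff cutsum_add cong: if_cong)
qed (simp_all add: fun_eq_iff insum_plus algebra_simps)

lemma gact_scale: "gact a (fscale c f) = fscale c (gact a f)"
proof (cases a)
  case (Minus s)
  have "cutsum u (\<lambda>p q. if p = code s then c * f q else 0) =
      cutsum u (\<lambda>p q. c * (if p = code s then f q else 0))" for u
    by (rule cutsum_cong) simp
  then show ?thesis by (simp add: Minus fun_eq_iff fscale_def cutsum_cmult cong: if_cong)
qed (simp_all add: fun_eq_iff insum_cmult fscale_def algebra_simps)

text \<open>Trades the coefficients of a bracket, indexed by trees, for a sum over the cuts of
  \<open>u\<close>, the form in which the quadratic identities are stated.\<close>

lemma sum_count_cutsum:
  assumes "finite A" "\<And>r. g r \<noteq> 0 \<Longrightarrow> r \<in> A"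
  shows "(\<Sum>r\<in>A. g r * cutsum u (\<lambda>p q. if p = r then f q else 0)) = cutsum u (\<lambda>p q. g p * (f q :: complex))"
proof -
  have "(\<Sum>r\<in>A. g r * (\<Sum>(p, q)\<in>#N. if p = r then f q else 0)) = (\<Sum>(p, q)\<in>#N. g p * f q)" for N
  proof (induction N)
    case (add x N)
    have "(\<Sum>r\<in>A. g r * (if fst x = r then f (snd x) else 0)) = g (fst x) * f (snd x)"
      using assms by (auto simp: if_distrib[of "\<lambda>y. _ * y"] sum.delta' cong: if_cong)
    then show ?case using add by (simp add: case_prod_unfold distrib_left sum.distrib)
  qed simp
  then show ?thesis by (simp add: cutsum_def)
qed

lemma count_cuts_cutsum: "of_nat (count (cuts r) (s, t)) * c = cutsum r (\<lambda>a b. if a = s \<and> b = t then c else (0 :: complex))"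
proof -
  have "of_nat (count N (s, t)) * c = (\<Sum>(a, b)\<in>#N. if a = s \<and> b = t then c else (0 :: complex))" for N
    by (induction N) (auto simp: distrib_right split: if_splits)
  then show ?thesis by (simp add: cutsum_def)
qed

lemma count_ins_insum: "of_nat (count (ins t p) s) * c = insum t p (\<lambda>r. if r = s then c else (0 :: complex))"
proof -
  have "of_nat (count N s) * c = (\<Sum>r\<in>#N. if r = s then c else (0 :: complex))" for N
    by (induction N) (auto simp: distrib_right)
  then show ?thesis by (simp add: insum_def)
qed

section \<open>The commutation relations on functions of trees\<close>

lemma gact_plus_plus:
  "tree_act (gen_bracket (Plus (tr s)) (Plus (tr t))) f u =
     gact (Plus (tr s)) (gact (Plus (tr t)) f) u - gact (Plus (tr t)) (gact (Plus (tr s)) f) u"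
proof -
  have "tree_act (insum s t dplus) f u = insum s t (\<lambda>r. - insum r u f)" for s t
    unfolding insum_def[of s t] by (simp add: tree_act_sum_mset tree_act_basis)
  then show ?thesis
    using pre_Lie[of t u s f] unfolding bracket_plus_plus
    by (simp add: tree_act_diff insum_uminus algebra_simps)
qed

lemma gact_minus_minus:
  "tree_act (gen_bracket (Minus (tr s)) (Minus (tr t))) f u =
     gact (Minus (tr s)) (gact (Minus (tr t)) f) u - gact (Minus (tr t)) (gact (Minus (tr s)) f) u"
proof -
  let ?g = "\<lambda>r. of_nat (count (cuts r) (t, s)) - of_nat (count (cuts r) (s, t)) :: complex"
  let ?\<psi> = "\<lambda>p p' q. if p = s \<and> p' = t then f q else 0"
  have gA: "r \<in> set_mset (ins t s) \<union> set_mset (ins s t)" if "?g r \<noteq> 0" for r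
  proof (rule ccontr)
    assume "r \<notin> set_mset (ins t s) \<union> set_mset (ins s t)"
    then have "count (cuts r) (t, s) = 0" "count (cuts r) (s, t) = 0"
      using cut_imp_ins not_in_iff by fastforce+
    then show False using that by simp
  qed
  have "tree_act (gen_bracket (Minus (tr s)) (Minus (tr t))) f u =
      - (\<Sum>r\<in>set_mset (ins t s) \<union> set_mset (ins s t). ?g r * cutsum u (\<lambda>p q. if p = r then f q else 0))"
    unfolding bracket_minus_minus tree_act_sum by (simp add: tree_act_basis sum_negf)
  also have "\<dots> = - cutsum u (\<lambda>p q. ?g p * f q)"
    by (subst sum_count_cutsum[OF _ gA]) simp_all
  also have "cutsum u (\<lambda>p q. ?g p * f q) =
     cutsum u (\<lambda>r q. cutsum r (\<lambda>a b. ?\<psi> b a q)) - cutsum u (\<lambda>r q. cutsum r (\<lambda>a b. ?\<psi> a b q))"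
  proof -
    have "cutsum u (\<lambda>p q. ?g p * f q) + cutsum u (\<lambda>r q. cutsum r (\<lambda>a b. ?\<psi> a b q))
       = cutsum u (\<lambda>r q. cutsum r (\<lambda>a b. ?\<psi> b a q))"
      unfolding cutsum_add[symmetric]
      by (rule cutsum_cong) (simp add: left_diff_distrib count_cuts_cutsum conj_commute)
    then show ?thesis by (simp add: eq_diff_eq)
  qed
  finally have L: "tree_act (gen_bracket (Minus (tr s)) (Minus (tr t))) f u =
     cutsum u (\<lambda>r q. cutsum r (\<lambda>a b. ?\<psi> a b q)) - cutsum u (\<lambda>r q. cutsum r (\<lambda>a b. ?\<psi> b a q))" by simp
  have dist: "(if P then - c else 0) = - (if P then c else (0::complex))" for P c by simp
  have nest: "(if P then cutsum q (\<lambda>a b. if Q a then f b else 0) else 0) = cutsum q (\<lambda>a b. if P \<and> Q a then f b else 0)"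
    for P Q q by (simp add: cutsum_def case_prod_unfold)
  have 1: "gact (Minus (tr s)) (gact (Minus (tr t)) f) u = cutsum u (\<lambda>p q. cutsum q (?\<psi> p))"
    by (simp add: dist cutsum_uminus nest)
  have 2: "gact (Minus (tr t)) (gact (Minus (tr s)) f) u = cutsum u (\<lambda>p q. cutsum q (\<lambda>p'. ?\<psi> p' p))"
    by (simp add: dist cutsum_uminus nest conj_commute)
  show ?thesis
    unfolding L 1 2 using cutsum_cutsum[of u ?\<psi>] by (simp add: algebra_simps)
qed

lemma ins_neq: "a \<in># ins t u \<Longrightarrow> a \<noteq> t"
  using rsize_ins[of a t u] rsize_pos[of u] by (auto simp del: rsize_pos)

lemma cuts_neq: "(p, q) \<in># cuts u \<Longrightarrow> p \<noteq> u"
  using rsize_cuts[of p q u] rsize_pos[of q] by (auto simp del: rsize_pos)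

text \<open>The terms on the right of \<open>cutsum_insum\<close> are, in order, the product in the
  other order, the negative part of the bracket, its positive part, and d.\<close>

lemma gact_minus_plus:
  "tree_act (gen_bracket (Minus (tr s)) (Plus (tr t))) f u =
     gact (Minus (tr s)) (gact (Plus (tr t)) f) u - gact (Plus (tr t)) (gact (Minus (tr s)) f) u"
proof -
  let ?\<psi> = "\<lambda>p q. if p = s then f q else 0"
  have dist: "(if P then - c else 0) = - (if P then c else (0::complex))" for P c by simp
  have nest: "(if P then insum a b g else 0) = insum a b (\<lambda>x. if P then g x else (0::complex))"
    for P a b g by (simp add: insum_def)
  have "gact (Minus (tr s)) (gact (Plus (tr t)) f) u = cutsum u (\<lambda>p q. insum t q (?\<psi> p))"
    by (simp add: dist cutsum_uminus nest)
  moreover have "gact (Plus (tr t)) (gact (Minus (tr s)) f) u = insum t u (\<lambda>a. cutsum a ?\<psi>)"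
    by (simp add: insum_uminus)
  ultimately have R: "gact (Minus (tr s)) (gact (Plus (tr t)) f) u - gact (Plus (tr t)) (gact (Minus (tr s)) f) u
     = - cutsum u (\<lambda>p q. insum t p (\<lambda>r. ?\<psi> r q)) - cutsum t (\<lambda>p q. insum q u (?\<psi> p))
       - of_nat (rsize u) * ?\<psi> t u"
    using cutsum_insum[of t u ?\<psi>] by simp
  show ?thesis
  proof (cases "s = t")
    case True
    \<comment> \<open>For s = t both sums vanish, since a graft of \<open>t\<close> is larger than
      \<open>t\<close> and a part cut from \<open>t\<close> is smaller; the vertex count alone
      remains, matching the bracket d.\<close>
    have "cutsum u (\<lambda>p q. insum t p (\<lambda>r. ?\<psi> r q)) = cutsum u (\<lambda>p q. insum t p (\<lambda>r. 0))"
      using True ins_neq by (intro cutsum_cong insum_cong) auto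
    moreover have "cutsum t (\<lambda>p q. insum q u (?\<psi> p)) = cutsum t (\<lambda>p q. insum q u (\<lambda>r. 0))"
      using True cuts_neq by (intro cutsum_cong insum_cong) auto
    ultimately show ?thesis unfolding R using True by (simp add: tree_act_basis insum_def cutsum_def case_prod_unfold)
  next
    case False
    have "tree_act (cutsum t (\<lambda>p q. if p = s then dplus q else 0)) f u = cutsum t (\<lambda>p q. - insum q u (?\<psi> p))"
      unfolding cutsum_def case_prod_unfold tree_act_sum_mset
      by (intro sum_mset_cong) (simp add: tree_act_basis insum_def)
    moreover have "tree_act (\<Sum>r\<in>snd ` set_mset (cuts s). basis_vec (Minus (tr r)) (of_nat (count (ins t r) s))) f u
       = - (\<Sum>r\<in>snd ` set_mset (cuts s). of_nat (count (ins t r) s) * cutsum u (\<lambda>p q. if p = r then f q else 0))"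
      unfolding tree_act_sum by (simp add: tree_act_basis sum_negf)
    moreover have "\<dots> = - cutsum u (\<lambda>p q. of_nat (count (ins t p) s) * f q)"
    proof -
      have "r \<in> snd ` set_mset (cuts s)" if "of_nat (count (ins t r) s) \<noteq> (0 :: complex)" for r
        using that ins_imp_cut[of s t r] by (force simp: count_eq_zero_iff)
      then show ?thesis by (subst sum_count_cutsum) simp_all
    qed
    ultimately show ?thesis
      unfolding R bracket_minus_plus[OF False] tree_act_add plus_fun_apply
      using False by (simp add: cutsum_uminus count_ins_insum)
  qed
qed

lemma gact_Dgen_Plus:
  "tree_act (basis_vec (Plus (tr t)) (of_nat (rsize t))) f u =
     gact Dgen (gact (Plus (tr t)) f) u - gact (Plus (tr t)) (gact Dgen f) u"
proof -
  have "insum t u (\<lambda>a. of_nat (rsize a) * f a) = insum t u (\<lambda>a. of_nat (rsize t + rsize u) * f a)"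
    by (rule insum_cong) (simp add: rsize_ins)
  then have I: "insum t u (\<lambda>a. of_nat (rsize a) * f a) = of_nat (rsize t + rsize u) * insum t u f"
    by (simp only: insum_cmult)
  have "gact Dgen (gact (Plus (tr t)) f) u - gact (Plus (tr t)) (gact Dgen f) u
     = of_nat (rsize u) * insum t u f - of_nat (rsize t + rsize u) * insum t u f"
    by (simp add: insum_uminus I)
  then show ?thesis by (simp add: tree_act_basis algebra_simps)
qed

lemma gact_Dgen_Minus:
  "tree_act (basis_vec (Minus (tr s)) (- of_nat (rsize s))) f u =
     gact Dgen (gact (Minus (tr s)) f) u - gact (Minus (tr s)) (gact Dgen f) u"
proof -
  let ?c = "cutsum u (\<lambda>p q. if p = s then f q else 0)"
  have "cutsum u (\<lambda>p q. if p = s then - (of_nat (rsize q) * f q) else 0)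
      = cutsum u (\<lambda>p q. (of_nat (rsize s) - of_nat (rsize u)) * (if p = s then f q else 0))"
    by (rule cutsum_cong) (auto dest!: rsize_cuts simp: algebra_simps)
  then have J: "cutsum u (\<lambda>p q. if p = s then - (of_nat (rsize q) * f q) else 0)
      = (of_nat (rsize s) - of_nat (rsize u)) * ?c"
    by (simp only: cutsum_cmult)
  have "gact Dgen (gact (Minus (tr s)) f) u - gact (Minus (tr s)) (gact Dgen f) u
     = of_nat (rsize u) * ?c + (of_nat (rsize s) - of_nat (rsize u)) * ?c"
    by (simp add: J)
  then show ?thesis by (simp add: tree_act_basis algebra_simps)
qed

lemma gact_bracket: "tree_act (gen_bracket a b) f u = gact a (gact b f) u - gact b (gact a f) u"
proof -
  have T: "\<exists>s. t = tr s" for t by (metis tr_code)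
  show ?thesis
  proof (cases a; cases b)
    assume "a = Dgen" "b = Dgen"
    then show ?thesis by simp
  next
    fix t assume ab: "a = Dgen" "b = Plus t"
    obtain s where "t = tr s" using T by blast
    then show ?thesis using ab gact_Dgen_Plus[of s f u] by simp
  next
    fix t assume ab: "a = Dgen" "b = Minus t"
    obtain s where "t = tr s" using T by blast
    then show ?thesis using ab gact_Dgen_Minus[of s f u] by simp
  next
    fix t assume ab: "a = Plus t" "b = Dgen"
    obtain s where "t = tr s" using T by blast
    then show ?thesis using ab gact_Dgen_Plus[of s f u] by (simp add: tree_act_basis)
  next
    fix t assume ab: "a = Minus t" "b = Dgen"
    obtain s where "t = tr s" using T by blast
    then show ?thesis using ab gact_Dgen_Minus[of s f u] by (simp add: tree_act_basis)
  next
    fix s t assume ab: "a = Plus s" "b = Plus t"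
    obtain s' t' where "s = tr s'" "t = tr t'" using T by blast
    then show ?thesis using ab gact_plus_plus[of s' t' f u] by simp
  next
    fix s t assume ab: "a = Minus s" "b = Minus t"
    obtain s' t' where "s = tr s'" "t = tr t'" using T by blast
    then show ?thesis using ab gact_minus_minus[of s' t' f u] by simp
  next
    fix s t assume ab: "a = Minus s" "b = Plus t"
    obtain s' t' where "s = tr s'" "t = tr t'" using T by blast
    then show ?thesis using ab gact_minus_plus[of s' t' f u] by simp
  next
    fix s t assume ab: "a = Plus s" "b = Minus t"
    obtain s' t' where st: "s = tr s'" "t = tr t'" using T by blast
    have "gen_bracket a b = - gen_bracket b a" using ab by simp
    then show ?thesis using ab st gact_minus_plus[of t' s' f u] by (simp add: tree_act_minus del: gen_bracket.simps)
  qed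
qed

lemma gact_sum: "gact a (\<lambda>u. \<Sum>i\<in>I. c i * g i u) = (\<lambda>u. \<Sum>i\<in>I. c i * gact a (g i) u)"
proof (induction I rule: infinite_finite_induct)
  case (insert i I)
  have "(\<lambda>u. \<Sum>i\<in>insert i I. c i * g i u) = fscale (c i) (g i) + (\<lambda>u. \<Sum>i\<in>I. c i * g i u)"
    using insert by (simp add: fscale_def fun_eq_iff)
  then show ?case using insert by (simp add: gact_add gact_scale) (simp add: fscale_def fun_eq_iff)
next
  case empty
  show ?case using gact_scale[of a 0 "\<lambda>u. 0"] by (simp add: fscale_def)
next
  case (infinite I)
  then show ?case using gact_scale[of a 0 "\<lambda>u. 0"] by (simp add: fscale_def)
qed

lemma tree_act_addv: "tree_act x (f + g) = tree_act x f + tree_act x g"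
  by (simp add: tree_act_def gact_add fun_eq_iff sum.distrib distrib_left)

lemma tree_act_scalev: "tree_act x (fscale c f) = fscale c (tree_act x f)"
  by (simp add: tree_act_def gact_scale) (simp add: fscale_def fun_eq_iff sum_distrib_left algebra_simps)

lemma tree_act_bracket: "tree_act (ie_bracket x y) f = tree_act x (tree_act y f) - tree_act y (tree_act x f)"
proof
  fix u
  let ?K = "Poly_Mapping.keys" and ?l = "Poly_Mapping.lookup"
  have "tree_act (ie_bracket x y) f u
      = (\<Sum>a\<in>?K x. \<Sum>b\<in>?K y. ?l x a * ?l y b * (gact a (gact b f) u - gact b (gact a f) u))"
    unfolding ie_bracket_def tree_act_sum tree_act_scale fscale_def gact_bracket ..
  also have "\<dots> = (\<Sum>a\<in>?K x. \<Sum>b\<in>?K y. ?l x a * ?l y b * gact a (gact b f) u)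
      - (\<Sum>b\<in>?K y. \<Sum>a\<in>?K x. ?l x a * ?l y b * gact b (gact a f) u)"
    by (subst (2) sum.swap) (simp add: right_diff_distrib sum_subtractf)
  also have "(\<Sum>a\<in>?K x. \<Sum>b\<in>?K y. ?l x a * ?l y b * gact a (gact b f) u) = tree_act x (tree_act y f) u"
    unfolding tree_act_def gact_sum by (simp add: sum_distrib_left mult.assoc)
  also have "(\<Sum>b\<in>?K y. \<Sum>a\<in>?K x. ?l x a * ?l y b * gact b (gact a f) u) = tree_act y (tree_act x f) u"
    unfolding tree_act_def gact_sum by (simp add: sum_distrib_left mult.assoc mult.left_commute)
  finally show "tree_act (ie_bracket x y) f u = (tree_act x (tree_act y f) - tree_act y (tree_act x f)) u"
    by simp
qed

lemma g_rep_tree_functions: "g_rep fscale tree_act"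
proof
  fix a b :: complex and f g :: "rt \<Rightarrow> complex"
  show "fscale a (f + g) = fscale a f + fscale a g" by (simp add: fscale_def fun_eq_iff algebra_simps)
  show "fscale (a + b) f = fscale a f + fscale b f" by (simp add: fscale_def fun_eq_iff algebra_simps)
  show "fscale a (fscale b f) = fscale (a * b) f" by (simp add: fscale_def mult.assoc)
  show "fscale 1 f = f" by (simp add: fscale_def)
qed (rule tree_act_add tree_act_scale tree_act_addv tree_act_scalev tree_act_bracket)+

lemma whitf_whittaker:
  assumes "\<And>s t. insum s t \<eta> = insum t s \<eta>"
  shows "tree_act (dplus t) (whitf \<eta>) = fscale (\<eta> t) (whitf \<eta>)"
  using insum_whitf[OF assms, of t] by (simp add: fun_eq_iff tree_act_basis fscale_def)

section \<open>The tensor product\<close>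

abbreviation Ig :: "(ie fmon \<Rightarrow>\<^sub>0 complex) set" where
  "Ig \<equiv> env_ideal ie_scale ie_bracket UNIV"

abbreviation In :: "(ie fmon \<Rightarrow>\<^sub>0 complex) set" where
  "In \<equiv> env_ideal ie_scale ie_bracket n_plus"

abbreviation Ucls :: "(ie fmon \<Rightarrow>\<^sub>0 complex) \<Rightarrow> ie env" where
  "Ucls \<equiv> env_class ie_scale ie_bracket UNIV"

abbreviation Ncls :: "(ie fmon \<Rightarrow>\<^sub>0 complex) \<Rightarrow> ie env" where
  "Ncls \<equiv> env_class ie_scale ie_bracket n_plus"

lemma ideal_Ig: "ideal Ig (free_algebra UNIV)"
  unfolding env_ideal_def
  by (rule ring.genideal_ideal[OF ring_free_algebra env_relations_carrier]) simp_all

lemma Ig_rel: "env_relations ie_scale ie_bracket UNIV \<subseteq> Ig"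
  unfolding env_ideal_def
  by (rule ring.genideal_self[OF ring_free_algebra env_relations_carrier]) simp_all

lemma ideal_In: "ideal In (free_algebra n_plus)"
  unfolding env_ideal_def
  by (rule ring.genideal_ideal[OF ring_free_algebra env_relations_carrier])
     (simp_all add: n_plus_add n_plus_scale n_plus_bracket)

lemma ideal_free_algebraD:
  assumes "ideal I (free_algebra L)"
  shows "I \<subseteq> carrier (free_algebra L)" "0 \<in> I" "\<And>p q. p \<in> I \<Longrightarrow> q \<in> I \<Longrightarrow> p + q \<in> I" "\<And>p. p \<in> I \<Longrightarrow> - p \<in> I"
    "\<And>p q. p \<in> I \<Longrightarrow> q \<in> carrier (free_algebra L) \<Longrightarrow> q * p \<in> I"
    "\<And>p q. p \<in> I \<Longrightarrow> q \<in> carrier (free_algebra L) \<Longrightarrow> p * q \<in> I"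
proof -
  interpret ideal I "free_algebra L" by fact
  show sub: "I \<subseteq> carrier (free_algebra L)" by (rule a_subset)
  show "0 \<in> I" using additive_subgroup.zero_closed[OF additive_subgroup_axioms] by simp
  show "p + q \<in> I" if "p \<in> I" "q \<in> I" for p q
    using additive_subgroup.a_closed[OF additive_subgroup_axioms that] by simp
  show "- p \<in> I" if "p \<in> I" for p
    using additive_subgroup.a_inv_closed[OF additive_subgroup_axioms that] a_minus_free_algebra[of p L] sub that
    by (auto simp del: free_algebra_simps(1))
  show "q * p \<in> I" if "p \<in> I" "q \<in> carrier (free_algebra L)" for p q using I_l_closed[OF that] by simp
  show "p * q \<in> I" if "p \<in> I" "q \<in> carrier (free_algebra L)" for p q using I_r_closed[OF that] by simp
qed

lemmas Ig_closed = ideal_free_algebraD(2-6)[OF ideal_Ig, simplified]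

lemma env_class_eq: "env_class sc br L p = (\<lambda>i. i + p) ` env_ideal sc br L"
  unfolding env_class_def a_r_coset_def' by auto

lemma coset_eq_iff:
  fixes I :: "'a::ab_group_add set"
  assumes "0 \<in> I" "\<And>a b. a \<in> I \<Longrightarrow> b \<in> I \<Longrightarrow> a + b \<in> I" "\<And>a. a \<in> I \<Longrightarrow> - a \<in> I"
  shows "(\<lambda>i. i + p) ` I = (\<lambda>i. i + q) ` I \<longleftrightarrow> p - q \<in> I"
proof
  assume "(\<lambda>i. i + p) ` I = (\<lambda>i. i + q) ` I"
  then have "0 + p \<in> (\<lambda>i. i + q) ` I" using assms(1) by blast
  then show "p - q \<in> I" by auto
next
  assume pq: "p - q \<in> I"
  then have qp: "q - p \<in> I" using assms(3)[OF pq] by simp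
  have "i + p \<in> (\<lambda>i. i + q) ` I" if "i \<in> I" for i
    using assms(2)[OF that pq] by (intro image_eqI[of _ _ "i + (p - q)"]) auto
  moreover have "i + q \<in> (\<lambda>i. i + p) ` I" if "i \<in> I" for i
    using assms(2)[OF that qp] by (intro image_eqI[of _ _ "i + (q - p)"]) auto
  ultimately show "(\<lambda>i. i + p) ` I = (\<lambda>i. i + q) ` I" by auto
qed

lemma Ucls_eq_iff: "Ucls p = Ucls q \<longleftrightarrow> p - q \<in> Ig"
  unfolding env_class_eq by (rule coset_eq_iff[OF Ig_closed(1-3)])

lemma U_g_simps:
  "carrier U_g = range Ucls" "Ucls p \<otimes>\<^bsub>U_g\<^esub> Ucls q = Ucls (p * q)" "Ucls p \<oplus>\<^bsub>U_g\<^esub> Ucls q = Ucls (p + q)"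
proof -
  interpret ideal Ig "free_algebra UNIV" by (rule ideal_Ig)
  show "carrier U_g = range Ucls"
    unfolding env_def FactRing_def A_RCOSETS_def' env_class_def by auto
  show "Ucls p \<otimes>\<^bsub>U_g\<^esub> Ucls q = Ucls (p * q)"
    using rcoset_mult_add[of p q] unfolding env_def FactRing_def env_class_def by simp
  show "Ucls p \<oplus>\<^bsub>U_g\<^esub> Ucls q = Ucls (p + q)"
    using a_rcos_sum[of p q] unfolding env_def FactRing_def env_class_def by simp
qed

lemma U_n_plus_carrier: "carrier U_n_plus = Ncls ` carrier (free_algebra n_plus)"
  unfolding env_def FactRing_def A_RCOSETS_def' env_class_def by auto

lemma env_relations_n_plus: "env_relations ie_scale ie_bracket n_plus \<subseteq> carrier (free_algebra n_plus)"
  by (rule env_relations_carrier) (simp_all add: n_plus_add n_plus_scale n_plus_bracket)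

text \<open>This is what makes \<open>env_incl\<close> single-valued on classes.\<close>

lemma In_subset_Ig: "In \<subseteq> Ig"
proof -
  interpret ring "free_algebra n_plus" by (rule ring_free_algebra)
  have "ideal (Ig \<inter> carrier (free_algebra n_plus)) (free_algebra n_plus)"
    by (rule ideal_free_algebraI) (use free_algebra_closed zero_carrier Ig_closed in \<open>auto simp del: free_algebra_simps(1)\<close>)
  moreover have "env_relations ie_scale ie_bracket n_plus \<subseteq> Ig \<inter> carrier (free_algebra n_plus)"
  proof (intro Int_greatest)
    have "env_relations ie_scale ie_bracket n_plus \<subseteq> env_relations ie_scale ie_bracket UNIV"
      unfolding env_relations_def by blast
    then show "env_relations ie_scale ie_bracket n_plus \<subseteq> Ig" using Ig_rel by blast
  qed (rule env_relations_n_plus)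
  ultimately have "In \<subseteq> Ig \<inter> carrier (free_algebra n_plus)"
    unfolding env_ideal_def[of _ _ n_plus] by (rule genideal_minimal)
  then show ?thesis by blast
qed

lemma env_incl_Ncls: "env_incl ie_scale ie_bracket UNIV (Ncls q) = Ucls q"
proof -
  have "Ucls p = Ucls q" if "p \<in> Ncls q" for p
    unfolding Ucls_eq_iff using that In_subset_Ig by (auto simp: env_class_eq)
  moreover have "q \<in> Ncls q"
    unfolding env_class_eq using ideal_free_algebraD(2)[OF ideal_In] by force
  ultimately show ?thesis unfolding env_incl_def by blast
qed

lemma U_right_act_eq: "U_right_act (Ucls p) (Ncls q) = Ucls (p * q)"
  unfolding U_right_act_def env_incl_Ncls U_g_simps(2) ..

lemma character_basics:
  assumes "lie_character ie_scale ie_bracket n_plus \<eta>"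
  shows "\<And>x y. x \<in> n_plus \<Longrightarrow> y \<in> n_plus \<Longrightarrow> \<eta> (x + y) = \<eta> x + \<eta> y"
    "\<And>c x. x \<in> n_plus \<Longrightarrow> \<eta> (ie_scale c x) = c * \<eta> x"
    "\<And>x y. x \<in> n_plus \<Longrightarrow> y \<in> n_plus \<Longrightarrow> \<eta> (ie_bracket x y) = 0"
  using assms unfolding lie_character_def by blast+

text \<open>The kernel of evaluation is an ideal, and it contains the relations because \<eta> is
  linear and kills brackets.\<close>

lemma free_eval_In:
  assumes "lie_character ie_scale ie_bracket n_plus \<eta>" "p \<in> In"
  shows "free_eval \<eta> p = 0"
proof -
  interpret ring "free_algebra n_plus" by (rule ring_free_algebra)
  note ch = character_basics[OF assms(1)]
  let ?J = "{p \<in> carrier (free_algebra n_plus). free_eval \<eta> p = 0}"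
  have neg: "free_eval \<eta> (- p) = - free_eval \<eta> p" for p
    using free_eval_diff[of \<eta> 0 p] by simp
  have "ideal ?J (free_algebra n_plus)"
    by (rule ideal_free_algebraI)
       (use free_algebra_closed zero_carrier in \<open>auto simp del: free_algebra_simps(1) simp: free_eval_add free_eval_mult neg\<close>)
  moreover note env_relations_n_plus
  moreover have "free_eval \<eta> r = 0" if "r \<in> env_relations ie_scale ie_bracket n_plus" for r
    using that ch unfolding env_relations_def by (auto simp: free_eval_diff free_eval_mult)
  ultimately have "ideal ?J (free_algebra n_plus)" "env_relations ie_scale ie_bracket n_plus \<subseteq> ?J"
    by blast+
  then have "In \<subseteq> ?J"
    unfolding env_ideal_def[of _ _ n_plus] by (rule genideal_minimal)
  then show ?thesis using assms(2) by blast
qed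

lemma char_act_eq:
  assumes "lie_character ie_scale ie_bracket n_plus \<eta>"
  shows "char_act \<eta> (Ncls q) z = free_eval \<eta> q * z"
proof -
  have "free_eval \<eta> ` Ncls q = {free_eval \<eta> q}"
    unfolding env_class_eq using free_eval_In[OF assms] ideal_free_algebraD(2)[OF ideal_In]
    by (force simp: free_eval_add)
  then show ?thesis unfolding char_act_def by simp
qed

section \<open>The tensor product through representatives\<close>

context
  fixes \<eta> :: "ie \<Rightarrow> complex"
  assumes character: "lie_character ie_scale ie_bracket n_plus \<eta>"
begin

abbreviation "tcarr \<equiv> carrier U_g \<times> (UNIV :: complex set)"
abbreviation "tgroup \<equiv> free_Abelian_group tcarr"

text \<open>The tensor relations in terms of representatives in the free algebras, so that later
  arguments compute with noncommutative polynomials instead of cosets.\<close>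

definition trel :: "(ie env \<times> complex \<Rightarrow>\<^sub>0 int) set" where
  "trel = {frag_of (Ucls (p + q), z) - frag_of (Ucls p, z) - frag_of (Ucls q, z) |p q z. True} \<union>
     {frag_of (Ucls p, y + z) - frag_of (Ucls p, y) - frag_of (Ucls p, z) |p y z. True} \<union>
     {frag_of (Ucls (p * q), z) - frag_of (Ucls p, free_eval \<eta> q * z) |p q z. q \<in> carrier (free_algebra n_plus)}"

abbreviation "tker \<equiv> generate tgroup trel"

lemma trel_eq: "tensor_relations U_g complex_ring (carrier U_n_plus) U_right_act (char_act \<eta>) = trel"
proof -
  have "{frag_of (a \<oplus>\<^bsub>U_g\<^esub> a', b) - frag_of (a, b) - frag_of (a', b) | a a' b.
        a \<in> carrier U_g \<and> a' \<in> carrier U_g \<and> b \<in> carrier complex_ring}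
     = {frag_of (Ucls (p + q), z) - frag_of (Ucls p, z) - frag_of (Ucls q, z) |p q z. True}"
    unfolding U_g_simps(1) complex_ring_def by (auto simp: U_g_simps(3)) (metis U_g_simps(3) rangeI)+
  moreover have "{frag_of (a, b \<oplus>\<^bsub>complex_ring\<^esub> b') - frag_of (a, b) - frag_of (a, b') | a b b'.
        a \<in> carrier U_g \<and> b \<in> carrier complex_ring \<and> b' \<in> carrier complex_ring}
     = {frag_of (Ucls p, y + z) - frag_of (Ucls p, y) - frag_of (Ucls p, z) |p y z. True}"
    unfolding U_g_simps(1) complex_ring_def by auto
  moreover have "{frag_of (U_right_act a r, b) - frag_of (a, char_act \<eta> r b) | a r b.
        a \<in> carrier U_g \<and> r \<in> carrier U_n_plus \<and> b \<in> carrier complex_ring}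
     = {frag_of (Ucls (p * q), z) - frag_of (Ucls p, free_eval \<eta> q * z) |p q z. q \<in> carrier (free_algebra n_plus)}"
    unfolding U_g_simps(1) U_n_plus_carrier complex_ring_def
    by (auto simp: U_right_act_eq char_act_eq[OF character] simp del: free_algebra_simps(1))
       (metis U_right_act_eq char_act_eq[OF character] image_eqI rangeI)+
  ultimately show ?thesis unfolding tensor_relations_def trel_def by simp
qed

lemma keys_frag_diff: "Poly_Mapping.keys a \<subseteq> S \<Longrightarrow> Poly_Mapping.keys b \<subseteq> S \<Longrightarrow> Poly_Mapping.keys (a - b) \<subseteq> S"
  for a b :: "'a \<Rightarrow>\<^sub>0 int"
  using keys_diff[of a b] by blast

lemma frag_carrier: "frag_of (Ucls p, z) \<in> carrier tgroup"
  unfolding U_g_simps(1) by simp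

lemma tgroup_diff: "a \<in> carrier tgroup \<Longrightarrow> b \<in> carrier tgroup \<Longrightarrow> a - b \<in> carrier tgroup"
  using keys_frag_diff[of a tcarr b] by simp

lemma trel_carrier: "trel \<subseteq> carrier tgroup"
  unfolding trel_def
  by (intro subsetI, elim UnE CollectE exE conjE) (simp_all only: tgroup_diff frag_carrier)

lemma tker_subgroup: "subgroup tker tgroup"
  by (rule group.generate_is_subgroup[OF group_free_Abelian_group trel_carrier])

lemma tker_closed:
  "0 \<in> tker" "a \<in> tker \<Longrightarrow> b \<in> tker \<Longrightarrow> a + b \<in> tker" "a \<in> tker \<Longrightarrow> - a \<in> tker"
  "a \<in> tker \<Longrightarrow> b \<in> tker \<Longrightarrow> a - b \<in> tker" "a \<in> tker \<Longrightarrow> Poly_Mapping.keys a \<subseteq> tcarr"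
proof -
  interpret subgroup tker tgroup by (rule tker_subgroup)
  have k: "Poly_Mapping.keys a \<subseteq> tcarr" if "a \<in> tker" for a using mem_carrier[OF that] by simp
  have neg: "- a \<in> tker" if "a \<in> tker" for a
    using subgroup.m_inv_closed[OF subgroup_axioms that]
      inv_free_Abelian_group[OF k[OF that]] by simp
  have add: "a + b \<in> tker" if "a \<in> tker" "b \<in> tker" for a b using m_closed[OF that] by simp
  show "0 \<in> tker" using one_closed by simp
  show "a \<in> tker \<Longrightarrow> b \<in> tker \<Longrightarrow> a + b \<in> tker" by (rule add)
  show "a \<in> tker \<Longrightarrow> - a \<in> tker" by (rule neg)
  show "a \<in> tker \<Longrightarrow> b \<in> tker \<Longrightarrow> a - b \<in> tker" using add[of a "- b"] neg[of b] by simp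
  show "a \<in> tker \<Longrightarrow> Poly_Mapping.keys a \<subseteq> tcarr" by (rule k)
qed

definition tcls :: "(ie env \<times> complex \<Rightarrow>\<^sub>0 int) \<Rightarrow> whit" where
  "tcls x = tker #>\<^bsub>tgroup\<^esub> x"

lemma tcls_def': "tcls x = (\<lambda>n. n + x) ` tker"
  unfolding tcls_def r_coset_def by auto

lemma tcls_eq_iff: "tcls x = tcls y \<longleftrightarrow> x - y \<in> tker"
  unfolding tcls_def' by (rule coset_eq_iff[OF tker_closed(1-3)])

lemma whit_tensor_eq: "whit_tensor \<eta> = tgroup Mod tker"
  unfolding whit_tensor_def tensor_product_def tensor_kernel_def trel_eq
  by (simp add: complex_ring_def)

lemma whit_tensor_simps:
  "carrier (whit_tensor \<eta>) = tcls ` carrier tgroup"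
  "\<one>\<^bsub>whit_tensor \<eta>\<^esub> = tcls 0"
  "x \<in> carrier tgroup \<Longrightarrow> y \<in> carrier tgroup \<Longrightarrow> tcls x \<otimes>\<^bsub>whit_tensor \<eta>\<^esub> tcls y = tcls (x + y)"
proof -
  interpret normal tker tgroup
    by (rule comm_group.subgroup_imp_normal[OF abelian_free_Abelian_group tker_subgroup])
  show "carrier (whit_tensor \<eta>) = tcls ` carrier tgroup"
    unfolding whit_tensor_eq FactGroup_def RCOSETS_def tcls_def by auto
  show "\<one>\<^bsub>whit_tensor \<eta>\<^esub> = tcls 0"
    unfolding whit_tensor_eq FactGroup_def tcls_def' by simp
  show "x \<in> carrier tgroup \<Longrightarrow> y \<in> carrier tgroup \<Longrightarrow> tcls x \<otimes>\<^bsub>whit_tensor \<eta>\<^esub> tcls y = tcls (x + y)"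
    unfolding whit_tensor_eq FactGroup_def tcls_def using rcos_sum[of x y] by simp
qed

text \<open>The class of p \<otimes> 1. Scalars in the second factor move to the left as constants
  of the smaller enveloping algebra (\<open>tcls_frag\<close>), so these classes exhaust the module,
  and elements of the free algebra can stand for its vectors.\<close>

definition elt :: "(ie fmon \<Rightarrow>\<^sub>0 complex) \<Rightarrow> whit" where
  "elt p = tcls (frag_of (Ucls p, 1))"

lemma trel_tker: "r \<in> trel \<Longrightarrow> r \<in> tker"
  by (rule generate.incl)

lemma tker_add: "frag_of (Ucls (p + q), z) - frag_of (Ucls p, z) - frag_of (Ucls q, z) \<in> tker"
  by (rule trel_tker) (unfold trel_def, blast)

lemma tker_act:
  "q \<in> carrier (free_algebra n_plus) \<Longrightarrow> frag_of (Ucls (p * q), z) - frag_of (Ucls p, free_eval \<eta> q * z) \<in> tker"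
  by (rule trel_tker) (unfold trel_def, blast)

lemma tcls_frag: "tcls (frag_of (Ucls p, z)) = elt (p * fconst z)"
proof -
  have "frag_of (Ucls (p * fconst z), 1) - frag_of (Ucls p, z) \<in> tker"
    using tker_act[OF fconst_carrier, of p z 1] by simp
  then show ?thesis unfolding elt_def tcls_eq_iff using tker_closed(3) by fastforce
qed

lemma elt_add: "elt p \<otimes>\<^bsub>whit_tensor \<eta>\<^esub> elt q = elt (p + q)"
proof -
  have "frag_of (Ucls p, 1) + frag_of (Ucls q, 1) - frag_of (Ucls (p + q), 1) \<in> tker"
    using tker_closed(3)[OF tker_add[of p q 1]] by (simp add: algebra_simps)
  then show ?thesis
    unfolding elt_def whit_tensor_simps(3)[OF frag_carrier frag_carrier] tcls_eq_iff .
qed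

lemma elt_zero: "elt 0 = tcls 0"
proof -
  have "frag_of (Ucls 0, 1) \<in> tker"
    using tker_closed(3)[OF tker_add[of 0 0 1]] by simp
  then show ?thesis unfolding elt_def tcls_eq_iff by simp
qed

lemma elt_fgen: "x \<in> n_plus \<Longrightarrow> elt (p * fgen x) = elt (p * fconst (\<eta> x))"
  using tker_act[OF fgen_carrier, of x p 1] unfolding tcls_frag[symmetric]
  by (simp add: elt_def tcls_eq_iff)

lemma elt_Ig: "p - q \<in> Ig \<Longrightarrow> elt p = elt q"
  unfolding elt_def using Ucls_eq_iff by metis

lemma elt_surj:
  assumes "x \<in> carrier tgroup"
  shows "tcls x \<in> range elt"
proof -
  have "Poly_Mapping.keys x \<subseteq> tcarr" using assms by simp
  then have "\<exists>p. x - frag_of (Ucls p, 1) \<in> tker"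
  proof (induction rule: frag_induction)
    case zero
    have "tcls 0 = elt 0" by (rule elt_zero[symmetric])
    then show ?case unfolding elt_def tcls_eq_iff by blast
  next
    case (one a)
    then obtain p z where "a = (Ucls p, z)" unfolding U_g_simps(1) by auto
    then have "tcls (frag_of a) = elt (p * fconst z)" by (simp add: tcls_frag)
    then show ?case unfolding elt_def tcls_eq_iff by blast
  next
    case (diff a b)
    then obtain p q where p: "a - frag_of (Ucls p, 1) \<in> tker" and q: "b - frag_of (Ucls q, 1) \<in> tker"
      by blast
    \<comment> \<open>Additivity at (p - q) + q = p absorbs the minus sign.\<close>
    have "(a - frag_of (Ucls p, 1)) - (b - frag_of (Ucls q, 1))
        + (frag_of (Ucls (p - q + q), 1) - frag_of (Ucls (p - q), 1) - frag_of (Ucls q, 1)) \<in> tker"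
      by (rule tker_closed(2)[OF tker_closed(4)[OF p q] tker_add])
    then have "(a - b) - frag_of (Ucls (p - q), 1) \<in> tker" by (simp add: algebra_simps)
    then show ?case by blast
  qed
  then show ?thesis unfolding elt_def using tcls_eq_iff by blast
qed

abbreviation tmap :: "(ie fmon \<Rightarrow>\<^sub>0 complex) \<Rightarrow> (ie env \<times> complex \<Rightarrow>\<^sub>0 int) \<Rightarrow> (ie env \<times> complex \<Rightarrow>\<^sub>0 int)" where
  "tmap r \<equiv> frag_extend (\<lambda>(a, b). frag_of (Ucls r \<otimes>\<^bsub>U_g\<^esub> a, b))"

text \<open>Left multiplication commutes with the right action, so each relation goes to one of the
  same family.\<close>

lemma tmap_trel: "x \<in> trel \<Longrightarrow> tmap r x \<in> trel"
proof -
  assume "x \<in> trel"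
  then consider p q z where "x = frag_of (Ucls (p + q), z) - frag_of (Ucls p, z) - frag_of (Ucls q, z)"
    | p y z where "x = frag_of (Ucls p, y + z) - frag_of (Ucls p, y) - frag_of (Ucls p, z)"
    | p q z where "x = frag_of (Ucls (p * q), z) - frag_of (Ucls p, free_eval \<eta> q * z)" "q \<in> carrier (free_algebra n_plus)"
    unfolding trel_def by blast
  then show ?thesis
  proof cases
    case 1
    then have "tmap r x = frag_of (Ucls (r * p + r * q), z) - frag_of (Ucls (r * p), z) - frag_of (Ucls (r * q), z)"
      by (simp add: frag_extend_diff U_g_simps(2) distrib_left)
    then show ?thesis unfolding trel_def by blast
  next
    case 2
    then have "tmap r x = frag_of (Ucls (r * p), y + z) - frag_of (Ucls (r * p), y) - frag_of (Ucls (r * p), z)"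
      by (simp add: frag_extend_diff U_g_simps(2))
    then show ?thesis unfolding trel_def by blast
  next
    case 3
    then have "tmap r x = frag_of (Ucls ((r * p) * q), z) - frag_of (Ucls (r * p), free_eval \<eta> q * z)"
      by (simp add: frag_extend_diff U_g_simps(2) mult.assoc)
    then show ?thesis using 3(2) unfolding trel_def by blast
  qed
qed

lemma tmap_tker: "x \<in> tker \<Longrightarrow> tmap r x \<in> tker"
proof (induction rule: generate.induct)
  case one
  then show ?case using tker_closed(1) by simp
next
  case (incl h)
  then show ?case using tmap_trel trel_tker by blast
next
  case (inv h)
  then have "inv\<^bsub>tgroup\<^esub> h = - h"
    using tker_closed(5)[OF trel_tker[OF inv]] by (intro inv_free_Abelian_group)
  then show ?case
    using tker_closed(3)[OF trel_tker[OF tmap_trel[OF inv]]] by (simp add: frag_extend_minus)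
next
  case (eng h1 h2)
  then show ?case using tker_closed(2) by (simp add: frag_extend_add)
qed

lemma whit_U_act_elt: "whit_U_act \<eta> (Ucls r) (elt p) = elt (r * p)"
proof -
  have "whit_U_act \<eta> (Ucls r) (elt p) = (\<Union>x\<in>elt p. tcls (tmap r x))"
    unfolding whit_U_act_def tensor_map_left_def tensor_kernel_def trel_eq tcls_def
    by (simp add: complex_ring_def)
  moreover have "tcls (tmap r x) = elt (r * p)" if x: "x \<in> elt p" for x
  proof -
    obtain n where n: "n \<in> tker" "x = n + frag_of (Ucls p, 1)"
      using x unfolding elt_def tcls_def' by blast
    then have "tmap r x = tmap r n + frag_of (Ucls (r * p), 1)"
      by (simp add: frag_extend_add U_g_simps(2))
    then show ?thesis unfolding elt_def tcls_eq_iff using tmap_tker[OF n(1)] by simp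
  qed
  moreover have "frag_of (Ucls p, 1) \<in> elt p"
    unfolding elt_def tcls_def' using tker_closed(1) by force
  ultimately show ?thesis by blast
qed

lemma whit_module_simps:
  "carrier (whit_module \<eta>) = range elt"
  "elt p \<oplus>\<^bsub>whit_module \<eta>\<^esub> elt q = elt (p + q)"
  "\<zero>\<^bsub>whit_module \<eta>\<^esub> = elt 0"
  "c \<odot>\<^bsub>whit_module \<eta>\<^esub> elt p = elt (fconst c * p)"
  "whit_act \<eta> x (elt p) = elt (fgen x * p)"
proof -
  have "tcls ` carrier tgroup = range elt"
    using elt_surj frag_carrier unfolding elt_def by blast
  then show "carrier (whit_module \<eta>) = range elt"
    by (simp add: whit_module_def whit_tensor_simps(1))
qed (simp_all add: whit_module_def whit_act_def elt_add elt_zero whit_tensor_simps(2) whit_U_act_elt)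

lemma elt_eq_iff: "elt p = elt q \<longleftrightarrow> elt (p - q) = elt 0"
proof
  assume "elt p = elt q"
  then show "elt (p - q) = elt 0" using elt_add[of p "- q"] elt_add[of q "- q"] by simp
next
  assume "elt (p - q) = elt 0"
  then show "elt p = elt q" using elt_add[of "p - q" q] elt_add[of 0 q] by simp
qed

lemma elt_mult_left: "elt p = elt q \<Longrightarrow> elt (r * p) = elt (r * q)"
  using whit_U_act_elt by metis

end

section \<open>The standard Whittaker module\<close>

interpretation tree_functions: g_rep fscale tree_act
  by (rule g_rep_tree_functions)

context
  fixes \<eta> :: "ie \<Rightarrow> complex"
  assumes character: "lie_character ie_scale ie_bracket n_plus \<eta>"
begin

abbreviation eta :: "rt \<Rightarrow> complex" where "eta t \<equiv> \<eta> (dplus t)"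

section \<open>A functional that detects the generator\<close>

lemma character_zero: "\<eta> 0 = 0"
  using character_basics(2)[OF character, of 0 0] ie.span_zero unfolding n_plus_def by simp

lemma character_sum_mset: "\<eta> (\<Sum>r\<in>#M. dplus r) = (\<Sum>r\<in>#M. eta r)"
  by (induction M)
     (simp_all add: character_zero character_basics(1)[OF character dplus_n_plus n_plus_sum_mset])

text \<open>A character kills the bracket of two positive generators, so both halves of it have the
  same value. This is the condition under which the recursion for \<open>whitf\<close> is
  consistent.\<close>

lemma eta_symmetric: "insum s t eta = insum t s eta"
proof -
  have "\<eta> (ie_bracket (dplus s) (dplus t)) = 0"
    by (rule character_basics(3)[OF character dplus_n_plus dplus_n_plus])
  then have z: "\<eta> (insum s t dplus - insum t s dplus) = 0"
    by (simp only: ie_bracket_basis bracket_plus_plus)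
  have m: "insum s t dplus \<in> n_plus" for s t unfolding insum_def by (rule n_plus_sum_mset)
  have "\<eta> (insum s t dplus - insum t s dplus) + \<eta> (insum t s dplus) = \<eta> (insum s t dplus)"
    using character_basics(1)[OF character n_plus_minus[OF m m] m, of s t t s t s] by simp
  then have "\<eta> (insum t s dplus) = \<eta> (insum s t dplus)" using z by simp
  then show ?thesis unfolding insum_def character_sum_mset by simp
qed

lemma character_step: "y \<in> n_plus \<Longrightarrow> \<eta> (ie_scale c (dplus t) + y) = c * eta t + \<eta> y"
  using character_basics(1)[OF character n_plus_scale[OF dplus_n_plus]]
    character_basics(2)[OF character dplus_n_plus] by simp

lemma tree_act_whitf: "x \<in> n_plus \<Longrightarrow> tree_act x (whitf eta) = fscale (\<eta> x) (whitf eta)"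
proof (induction rule: n_plus_induct)
  case zero
  show ?case by (simp add: character_zero fscale_def fun_eq_iff)
next
  case (step c t y)
  then show ?case
    unfolding tree_act_add tree_act_scale whitf_whittaker[of eta, OF eta_symmetric] character_step[OF step(1)]
    by (simp add: fscale_def fun_eq_iff algebra_simps)
qed

lemma ev_whitf:
  assumes "q \<in> carrier (free_algebra n_plus)"
  shows "tree_functions.ev q (whitf eta) = fscale (free_eval \<eta> q) (whitf eta)"
proof -
  have word: "foldr tree_act xs (whitf eta) = fscale (prod_list (map \<eta> xs)) (whitf eta)" if "set xs \<subseteq> n_plus" for xs
    using that
    by (induction xs)
       (simp_all add: tree_functions.X_scalev tree_act_whitf tree_functions.scale_scale mult.commute)
  have "tree_functions.ev q (whitf eta) = (\<Sum>m\<in>Poly_Mapping.keys q.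
      fscale (Poly_Mapping.lookup q m) (fscale (prod_list (map \<eta> (letters m))) (whitf eta)))"
    unfolding tree_functions.ev_def using assms by (intro sum.cong) (auto simp: word)
  then show ?thesis
    by (simp add: free_eval_def tree_functions.scale_sum_left)
qed

text \<open>Evaluating the dual Whittaker vector at \<open>leaf\<close> induces a functional on the tensor product
  which witnesses that the generator of the module does not vanish.\<close>

definition leaf_value :: "ie env \<times> complex \<Rightarrow> complex" where
  "leaf_value k = snd k * tree_functions.ev (SOME p. Ucls p = fst k) (whitf eta) leaf"

definition leaf_functional :: "(ie env \<times> complex \<Rightarrow>\<^sub>0 int) \<Rightarrow> complex" where
  "leaf_functional x = (\<Sum>k\<in>Poly_Mapping.keys x. of_int (Poly_Mapping.lookup x k) * leaf_value k)"

lemma leaf_value_Ucls: "leaf_value (Ucls p, z) = z * tree_functions.ev p (whitf eta) leaf"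
proof -
  have "Ucls (SOME q. Ucls q = Ucls p) = Ucls p" by (rule someI[of _ p]) simp
  then have "tree_functions.ev ((SOME q. Ucls q = Ucls p) - p) (whitf eta) = 0"
    unfolding Ucls_eq_iff by (rule tree_functions.ev_env_ideal)
  then show ?thesis by (simp add: leaf_value_def tree_functions.ev_diff)
qed

lemma leaf_functional_superset:
  "finite K \<Longrightarrow> Poly_Mapping.keys x \<subseteq> K \<Longrightarrow>
    leaf_functional x = (\<Sum>k\<in>K. of_int (Poly_Mapping.lookup x k) * leaf_value k)"
  unfolding leaf_functional_def by (rule sum.mono_neutral_left) (auto simp: in_keys_iff)

lemma leaf_functional_diff: "leaf_functional (x - y) = leaf_functional x - leaf_functional y"
proof -
  let ?K = "Poly_Mapping.keys x \<union> Poly_Mapping.keys y"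
  have "finite ?K" by simp
  then show ?thesis
    using leaf_functional_superset[of ?K x] leaf_functional_superset[of ?K y]
      leaf_functional_superset[of ?K "x - y"] keys_diff[of x y]
    by (simp add: lookup_minus left_diff_distrib sum_subtractf)
qed

lemma leaf_functional_frag [simp]: "leaf_functional (frag_of k) = leaf_value k"
  using leaf_functional_superset[of "{k}" "frag_of k"] by simp

lemma leaf_functional_0 [simp]: "leaf_functional 0 = 0"
  by (simp add: leaf_functional_def)

text \<open>The first two families of relations hold by linearity, the balancing relation because
  \<open>ev_whitf\<close> turns right factors from the positive part into scalars.\<close>

lemma leaf_functional_tker: "x \<in> generate tgroup (trel \<eta>) \<Longrightarrow> leaf_functional x = 0"
proof -
  have rel: "leaf_functional h = 0" if "h \<in> trel \<eta>" for h
    using that unfolding trel_def[OF character]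
    by (elim UnE CollectE exE conjE;
        simp only: leaf_functional_diff leaf_functional_frag leaf_value_Ucls tree_functions.ev_add
          tree_functions.ev_mult ev_whitf tree_functions.ev_scalev plus_fun_apply;
        simp add: fscale_def algebra_simps)
  have neg: "leaf_functional (- x) = - leaf_functional x" for x
    using leaf_functional_diff[of 0 x] by simp
  have add: "leaf_functional (x + y) = leaf_functional x + leaf_functional y" for x y
    using leaf_functional_diff[of x "- y"] neg[of y] by simp
  assume "x \<in> generate tgroup (trel \<eta>)"
  then show ?thesis
  proof (induction rule: generate.induct)
    case (inv h)
    have "Poly_Mapping.keys h \<subseteq> tcarr"
      by (rule tker_closed(5)[OF character generate.incl[OF inv]])
    then have "inv\<^bsub>tgroup\<^esub> h = - h" by (rule inv_free_Abelian_group)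
    then show ?case using rel[OF inv] neg by simp
  qed (simp_all add: rel add)
qed

lemma elt_one_neq_zero: "elt \<eta> 1 \<noteq> elt \<eta> 0"
proof
  assume "elt \<eta> 1 = elt \<eta> 0"
  then have "frag_of (Ucls 1, 1) - frag_of (Ucls 0, 1) \<in> generate tgroup (trel \<eta>)"
    unfolding elt_def[OF character] tcls_eq_iff[OF character] .
  then have "leaf_functional (frag_of (Ucls 1, 1) - frag_of (Ucls 0, 1)) = 0"
    by (rule leaf_functional_tker)
  then have "tree_functions.ev (fconst 1) (whitf eta) leaf = 0"
    by (simp add: leaf_functional_diff leaf_value_Ucls fconst_simps(3) del: tree_functions.ev_fconst)
  then show False by (simp add: fscale_def whitf_leaf)
qed

section \<open>The module as a representation on a type\<close>

abbreviation "M \<equiv> whit_module \<eta>"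
abbreviation "el \<equiv> elt \<eta>"

lemmas M_simps = whit_module_simps[OF character]

definition fscal :: "complex \<Rightarrow> (ie fmon \<Rightarrow>\<^sub>0 complex) \<Rightarrow> ie fmon \<Rightarrow>\<^sub>0 complex" where
  "fscal c p = fconst c * p"

lemma vector_space_fscal: "vector_space fscal"
  by unfold_locales (simp_all add: fscal_def fconst_simps algebra_simps)

lemma el_eq_iff: "el p = el q \<longleftrightarrow> el (p - q) = el 0"
  by (rule elt_eq_iff[OF character])

lemma el_mult_left: "el p = el q \<Longrightarrow> el (r * p) = el (r * q)"
  by (rule elt_mult_left[OF character])

lemma el_add_cong: "el p = el p' \<Longrightarrow> el q = el q' \<Longrightarrow> el (p + q) = el (p' + q')"
  by (metis M_simps(2))

lemma el_Ig: "p - q \<in> Ig \<Longrightarrow> el p = el q"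
  by (rule elt_Ig[OF character])

text \<open>A linear projection of the free algebra along the kernel of \<open>el\<close>: it realises the module
  on a whole type, so that the results on \<open>whittaker\<close> apply.\<close>

lemma projection_exists:
  "\<exists>\<pi>. (\<forall>p q. \<pi> (p + q) = \<pi> p + \<pi> q) \<and> (\<forall>c p. \<pi> (fscal c p) = fscal c (\<pi> p)) \<and>
     (\<forall>p. el (\<pi> p) = el p) \<and> (\<forall>p q. el p = el q \<longrightarrow> \<pi> p = \<pi> q)"
proof -
  interpret F: vector_space fscal by (rule vector_space_fscal)
  interpret FF: vector_space_pair fscal fscal ..
  let ?K = "{p. el p = el 0}"
  have sub: "F.subspace ?K"
  proof (rule F.subspaceI)
    show "x + y \<in> ?K" if "x \<in> ?K" "y \<in> ?K" for x y
      using el_add_cong[of x 0 y 0] that by simp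
    show "fscal c x \<in> ?K" if "x \<in> ?K" for c x
      using el_mult_left[of x 0 "fconst c"] that by (simp add: fscal_def)
  qed simp
  have "Vector_Spaces.linear fscal fscal id"
    by unfold_locales simp_all
  \<comment> \<open>A left inverse of the identity on \<open>?K\<close> with values in
    \<open>?K\<close> is a linear projection onto \<open>?K\<close>; \<open>\<pi>\<close> is the
    complementary projection.\<close>
  then obtain g where g: "g ` UNIV \<subseteq> ?K" "Vector_Spaces.linear fscal fscal g" "\<forall>v\<in>?K. g (id v) = v"
    using FF.linear_exists_left_inverse_on[OF _ sub, of id] by auto
  interpret g: Vector_Spaces.linear fscal fscal g by (rule g(2))
  define \<pi> where "\<pi> = (\<lambda>p. p - g p)"
  have gK: "el (g p) = el 0" for p using g(1) by auto
  have 1: "\<pi> (p + q) = \<pi> p + \<pi> q" for p q by (simp add: \<pi>_def g.add)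
  have 2: "\<pi> (fscal c p) = fscal c (\<pi> p)" for c p
    by (simp add: \<pi>_def g.scale F.scale_right_diff_distrib)
  have 3: "el (\<pi> p) = el p" for p
  proof -
    have "el p = el (\<pi> p)" unfolding el_eq_iff[of p "\<pi> p"] using gK by (simp add: \<pi>_def)
    then show ?thesis ..
  qed
  have 4: "\<pi> p = \<pi> q" if "el p = el q" for p q
  proof -
    have "p - q \<in> ?K" using that el_eq_iff[of p q] by simp
    then have "g (p - q) = p - q" using g(3) by auto
    then show ?thesis by (simp add: \<pi>_def g.diff algebra_simps)
  qed
  show ?thesis using 1 2 3 4 by blast
qed

lemma Ig_relations:
  "fgen (x + y) - fgen x - fgen y \<in> Ig" "fgen (ie_scale c x) - fconst c * fgen x \<in> Ig"
  "fgen x * fgen y - fgen y * fgen x - fgen (ie_bracket x y) \<in> Ig"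
  by (rule subsetD[OF Ig_rel], unfold env_relations_def, blast)+

lemma el_relations:
  "el (fgen (x + y) * p) = el (fgen x * p + fgen y * p)"
  "el (fgen (ie_scale c x) * p) = el (fconst c * fgen x * p)"
  "el (fgen (ie_bracket x y) * p) = el (fgen x * fgen y * p - fgen y * fgen x * p)"
proof -
  note r = Ig_closed(5)[where q = p]
  show "el (fgen (x + y) * p) = el (fgen x * p + fgen y * p)"
    by (rule el_Ig) (use r[OF Ig_relations(1)[of x y]] in \<open>simp add: algebra_simps\<close>)
  show "el (fgen (ie_scale c x) * p) = el (fconst c * fgen x * p)"
    by (rule el_Ig) (use r[OF Ig_relations(2)[of c x]] in \<open>simp add: algebra_simps\<close>)
  have "el (fgen x * fgen y * p - fgen y * fgen x * p) = el (fgen (ie_bracket x y) * p)"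
    by (rule el_Ig) (use r[OF Ig_relations(3)[of x y]] in \<open>simp add: algebra_simps\<close>)
  then show "el (fgen (ie_bracket x y) * p) = el (fgen x * fgen y * p - fgen y * fgen x * p)" ..
qed

text \<open>\<open>\<pi> p\<close> depends only on \<open>el p\<close>, so the action computed in
  the free algebra and projected back satisfies the relations exactly, not just modulo the
  kernel.\<close>

lemma projected_action_g_rep:
  assumes "\<And>p q. \<pi> (p + q) = \<pi> p + \<pi> q" "\<And>c p. \<pi> (fscal c p) = fscal c (\<pi> p)"
    "\<And>p. el (\<pi> p) = el p" "\<And>p q. el p = el q \<Longrightarrow> \<pi> p = \<pi> q"
  shows "g_rep fscal (\<lambda>x p. \<pi> (fgen x * p))"
proof -
  interpret F: vector_space fscal by (rule vector_space_fscal)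
  have diff: "\<pi> (p - q) = \<pi> p - \<pi> q" for p q using assms(1)[of "p - q" q] by simp
  have proj: "\<pi> (q * \<pi> p) = \<pi> (q * p)" for p q by (intro assms(4) el_mult_left assms(3))
  show ?thesis
  proof
    fix x y u v c
    show "\<pi> (fgen (x + y) * v) = \<pi> (fgen x * v) + \<pi> (fgen y * v)"
      using assms(4)[OF el_relations(1)] by (simp add: assms(1))
    show "\<pi> (fgen (ie_scale c x) * v) = fscal c (\<pi> (fgen x * v))"
      using assms(4)[OF el_relations(2)[of c x v]] assms(2)[of c "fgen x * v"]
      by (simp only: fscal_def mult.assoc)
    show "\<pi> (fgen x * (u + v)) = \<pi> (fgen x * u) + \<pi> (fgen x * v)"
      by (simp add: distrib_left assms(1))
    have "fgen x * fscal c v = fscal c (fgen x * v)"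
      unfolding fscal_def by (metis fconst_commute mult.assoc)
    then show "\<pi> (fgen x * fscal c v) = fscal c (\<pi> (fgen x * v))" by (simp add: assms(2))
    show "\<pi> (fgen (ie_bracket x y) * v) = \<pi> (fgen x * \<pi> (fgen y * v)) - \<pi> (fgen y * \<pi> (fgen x * v))"
      using assms(4)[OF el_relations(3)] by (simp add: proj diff mult.assoc)
  qed
qed

lemma el_whittaker: "x \<in> n_plus \<Longrightarrow> el (fgen x * fconst c) = el (fconst (\<eta> x) * fconst c)"
  using elt_fgen[OF character, of x "fconst c"] by (simp add: fconst_commute[of c])

section \<open>Module axioms on the carrier\<close>

lemma M_carrier: "m \<in> carrier M \<Longrightarrow> \<exists>p. m = el p"
  using M_simps(1) by blast

lemma abelian_group_M: "abelian_group M"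
proof (rule abelian_groupI)
  fix x y z assume "x \<in> carrier M" "y \<in> carrier M" "z \<in> carrier M"
  then obtain p q r where "x = el p" "y = el q" "z = el r" using M_carrier by metis
  then show "x \<oplus>\<^bsub>M\<^esub> y \<in> carrier M" "x \<oplus>\<^bsub>M\<^esub> y = y \<oplus>\<^bsub>M\<^esub> x" "\<zero>\<^bsub>M\<^esub> \<oplus>\<^bsub>M\<^esub> x = x"
    "x \<oplus>\<^bsub>M\<^esub> y \<oplus>\<^bsub>M\<^esub> z = x \<oplus>\<^bsub>M\<^esub> (y \<oplus>\<^bsub>M\<^esub> z)"
    by (simp_all add: M_simps ac_simps)
next
  show "\<zero>\<^bsub>M\<^esub> \<in> carrier M" by (simp add: M_simps)
  fix x assume "x \<in> carrier M"
  then obtain p where "x = el p" using M_carrier by metis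
  then show "\<exists>y\<in>carrier M. y \<oplus>\<^bsub>M\<^esub> x = \<zero>\<^bsub>M\<^esub>"
    by (intro bexI[of _ "el (- p)"]) (simp_all add: M_simps)
qed

lemma a_minus_el: "el p \<ominus>\<^bsub>M\<^esub> el q = el (p - q)"
proof -
  interpret abelian_group M by (rule abelian_group_M)
  have "\<ominus>\<^bsub>M\<^esub> el q = el (- q)"
    by (rule minus_equality) (simp_all add: M_simps)
  then show ?thesis unfolding a_minus_def by (simp add: M_simps)
qed

lemma complex_ring_simps [simp]:
  "carrier complex_ring = UNIV" "monoid.mult complex_ring = (*)" "monoid.one complex_ring = 1"
  "ring.zero complex_ring = 0" "ring.add complex_ring = (+)"
  by (simp_all add: complex_ring_def)

lemma cring_complex_ring: "cring complex_ring"
proof (rule cringI)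
  show "abelian_group complex_ring"
  proof (rule abelian_groupI)
    show "\<exists>y\<in>carrier complex_ring. y \<oplus>\<^bsub>complex_ring\<^esub> x = \<zero>\<^bsub>complex_ring\<^esub>" for x :: complex
      by (rule bexI[of _ "- x"]) simp_all
  qed (simp_all add: add.assoc add.commute)
  show "comm_monoid complex_ring"
    by (rule comm_monoidI) (simp_all add: mult.assoc mult.commute)
qed (simp add: distrib_right)

lemma module_M: "Module.module complex_ring M"
proof (rule moduleI[OF cring_complex_ring abelian_group_M])
  fix a b :: complex and x y assume "x \<in> carrier M" "y \<in> carrier M"
  then obtain p q where "x = el p" "y = el q" using M_carrier by metis
  then show "a \<odot>\<^bsub>M\<^esub> (x \<oplus>\<^bsub>M\<^esub> y) = a \<odot>\<^bsub>M\<^esub> x \<oplus>\<^bsub>M\<^esub> a \<odot>\<^bsub>M\<^esub> y"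
    by (simp add: M_simps distrib_left)
next
  fix a b :: complex and x assume "x \<in> carrier M"
  then obtain p where "x = el p" using M_carrier by metis
  then show "a \<odot>\<^bsub>M\<^esub> x \<in> carrier M" "\<one>\<^bsub>complex_ring\<^esub> \<odot>\<^bsub>M\<^esub> x = x"
    "(a \<oplus>\<^bsub>complex_ring\<^esub> b) \<odot>\<^bsub>M\<^esub> x = a \<odot>\<^bsub>M\<^esub> x \<oplus>\<^bsub>M\<^esub> b \<odot>\<^bsub>M\<^esub> x"
    "(a \<otimes>\<^bsub>complex_ring\<^esub> b) \<odot>\<^bsub>M\<^esub> x = a \<odot>\<^bsub>M\<^esub> (b \<odot>\<^bsub>M\<^esub> x)"
    by (simp_all add: M_simps fconst_simps distrib_right mult.assoc)
qed

lemma lie_module_M: "lie_module ie_scale ie_bracket M (whit_act \<eta>)"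
  unfolding lie_module_def
proof (intro conjI allI ballI module_M)
  fix x y c m m' assume "m \<in> carrier M"
  then obtain p where m: "m = el p" using M_carrier by metis
  show "whit_act \<eta> x m \<in> carrier M" by (simp add: m M_simps)
  show "whit_act \<eta> x (c \<odot>\<^bsub>M\<^esub> m) = c \<odot>\<^bsub>M\<^esub> whit_act \<eta> x m"
    by (simp add: m M_simps) (metis fconst_commute mult.assoc)
  show "whit_act \<eta> (x + y) m = whit_act \<eta> x m \<oplus>\<^bsub>M\<^esub> whit_act \<eta> y m"
    by (simp add: m M_simps el_relations(1))
  show "whit_act \<eta> (ie_scale c x) m = c \<odot>\<^bsub>M\<^esub> whit_act \<eta> x m"
    by (simp add: m M_simps el_relations(2) mult.assoc)
  show "whit_act \<eta> (ie_bracket x y) m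
      = whit_act \<eta> x (whit_act \<eta> y m) \<ominus>\<^bsub>M\<^esub> whit_act \<eta> y (whit_act \<eta> x m)"
    by (simp add: m M_simps a_minus_el el_relations(3) mult.assoc)
  assume "m' \<in> carrier M"
  then obtain q where m': "m' = el q" using M_carrier by metis
  show "whit_act \<eta> x (m \<oplus>\<^bsub>M\<^esub> m') = whit_act \<eta> x m \<oplus>\<^bsub>M\<^esub> whit_act \<eta> x m'"
    by (simp add: m m' M_simps distrib_left)
qed

lemma el_generates:
  assumes "el 1 \<in> S" "\<And>u v. u \<in> S \<Longrightarrow> v \<in> S \<Longrightarrow> u \<oplus>\<^bsub>M\<^esub> v \<in> S"
    "\<And>c v. v \<in> S \<Longrightarrow> c \<odot>\<^bsub>M\<^esub> v \<in> S" "\<And>x v. v \<in> S \<Longrightarrow> whit_act \<eta> x v \<in> S"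
  shows "el p \<in> S"
proof (induction p rule: poly_mapping_single_induct)
  case (single m c)
  have "el (Poly_Mapping.single (FMon xs) c) \<in> S" for xs
  proof (induction xs)
    case Nil
    show ?case unfolding single_Nil using assms(3)[OF assms(1), of c] by (simp add: M_simps)
  next
    case (Cons x xs)
    then show ?case unfolding single_Cons using assms(4)[OF Cons, of x] by (simp add: M_simps)
  qed
  then show ?case by (cases m) simp
next
  case (add p q)
  then show ?case using assms(2)[OF add] by (simp add: M_simps)
qed

section \<open>One-dimensionality and simplicity\<close>

context
  assumes nonzero: "\<exists>x\<in>n_plus. \<eta> x \<noteq> 0" and bounded: "root_bounded \<eta>"
begin

lemma eta_nonzero: "\<exists>t. eta t \<noteq> 0"
proof (rule ccontr)
  assume z: "\<not> ?thesis"
  have "\<eta> x = 0" if "x \<in> n_plus" for x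
    using that
  proof (induction rule: n_plus_induct)
    case (step c t y)
    then show ?case using z unfolding character_step[OF step(1)] by simp
  qed (rule character_zero)
  then show False using nonzero by blast
qed

lemma eta_bounded: "\<exists>m. \<forall>t. m \<le> size (branches t) \<longrightarrow> eta t = 0"
  using bounded unfolding root_bounded_def by (metis rdeg_tr)

theorem whit_module_main:
  "one_dimensional M (whittaker_vectors n_plus \<eta> M (whit_act \<eta>)) \<and>
   simple_lie_module ie_scale ie_bracket M (whit_act \<eta>)"
proof -
  obtain \<pi> where \<pi>: "\<And>p q. \<pi> (p + q) = \<pi> p + \<pi> q" "\<And>c p. \<pi> (fscal c p) = fscal c (\<pi> p)"
    "\<And>p. el (\<pi> p) = el p" "\<And>p q. el p = el q \<Longrightarrow> \<pi> p = \<pi> q"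
    using projection_exists by blast
  define A where "A = (\<lambda>x p. \<pi> (fgen x * p))"
  have gr: "g_rep fscal A"
    unfolding A_def by (rule projected_action_g_rep) (use \<pi> in blast)+
  have proj: "\<pi> (q * \<pi> p) = \<pi> (q * p)" for p q by (intro \<pi>(4) el_mult_left \<pi>(3))
  have wh: "A x (\<pi> 1) = fscal (\<eta> x) (\<pi> 1)" if "x \<in> n_plus" for x
    using \<pi>(4)[OF el_whittaker[OF that, of 1]] \<pi>(2)[of "\<eta> x" 1] by (simp add: A_def proj fconst_simps fscal_def)
  have "whittaker fscal A (\<pi> 1) eta"
    by (intro whittaker.intro[OF gr] whittaker_axioms.intro wh dplus_n_plus)
  then interpret W: whittaker fscal A "\<pi> 1" eta .
  have \<pi>0: "\<pi> 0 = 0" using \<pi>(1)[of 0 0] by simp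
  have \<pi>_zero: "\<pi> p = 0 \<longleftrightarrow> el p = el 0" for p
    using \<pi>(3)[of p] \<pi>(4)[of p 0] \<pi>0 by metis
  have w_nz: "\<pi> 1 \<noteq> 0"
    unfolding \<pi>_zero by (rule elt_one_neq_zero)
  \<comment> \<open>Every vector in the range of \<open>\<pi>\<close> is reached from
    \<open>\<pi> 1\<close>, letter by letter, as the results on \<open>cyc\<close> demand.\<close>
  have cyc: "\<pi> p \<in> W.cyc" for p
  proof (induction p rule: poly_mapping_single_induct)
    case (single m c)
    have "\<pi> (Poly_Mapping.single (FMon xs) c) \<in> W.cyc" for xs
    proof (induction xs)
      case Nil
      have "\<pi> (fconst c) = fscal c (\<pi> 1)" using \<pi>(2)[of c 1] by (simp add: fscal_def)
      then show ?case unfolding single_Nil by (simp only: W.cyc.smul[OF W.cyc.base])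
    next
      case (Cons x xs)
      have "\<pi> (Poly_Mapping.single (FMon (x # xs)) c) = A x (\<pi> (Poly_Mapping.single (FMon xs) c))"
        by (simp add: A_def single_Cons proj)
      then show ?case by (simp only: W.cyc.act[OF Cons])
    qed
    then show ?case by (cases m) simp
  next
    case (add p q)
    then show ?case using W.cyc.add by (simp add: \<pi>(1))
  qed
  have simple: "S = {\<zero>\<^bsub>M\<^esub>} \<or> S = carrier M" if S: "lie_submodule M (whit_act \<eta>) S" for S
  proof (rule disjCI)
    assume ne: "S \<noteq> carrier M"
    interpret submodule S complex_ring M using S by (simp add: lie_submodule_def)
    have sub: "S \<subseteq> carrier M" and zero: "el 0 \<in> S" and add: "\<And>u v. u \<in> S \<Longrightarrow> v \<in> S \<Longrightarrow> u \<oplus>\<^bsub>M\<^esub> v \<in> S"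
      using subset one_closed m_closed by (simp_all add: M_simps)
    have sm: "c \<odot>\<^bsub>M\<^esub> v \<in> S" if "v \<in> S" for c v using smult_closed[of c v] that by simp
    have act: "whit_act \<eta> x v \<in> S" if "v \<in> S" for x v using S that by (simp add: lie_submodule_def)
    \<comment> \<open>The preimage of the submodule in the free algebra, which includes the kernel
      of \<open>el\<close>.\<close>
    have inv: "W.invariant {v. el v \<in> S}"
      unfolding W.invariant_def
    proof (intro conjI W.subspaceI allI ballI)
      fix x y v c
      show "0 \<in> {v. el v \<in> S}" using zero by simp
      show "x + y \<in> {v. el v \<in> S}" if "x \<in> {v. el v \<in> S}" "y \<in> {v. el v \<in> S}"
        using add[of "el x" "el y"] that by (simp add: M_simps)
      show "fscal c x \<in> {v. el v \<in> S}" if "x \<in> {v. el v \<in> S}"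
        using sm[of "el x" c] that by (simp add: M_simps fscal_def)
    next
      fix x v assume "v \<in> {v. el v \<in> S}"
      then show "A x v \<in> {v. el v \<in> S}"
        using act[of "el v" x] by (simp add: A_def M_simps \<pi>(3))
    qed
    \<comment> \<open>The test is made on \<open>\<pi> p\<close>, since p itself can be nonzero
      while its class vanishes.\<close>
    have "el p = el 0" if p: "el p \<in> S" for p
    proof (rule ccontr)
      assume "el p \<noteq> el 0"
      then have "\<pi> p \<noteq> 0" "\<pi> p \<in> {v. el v \<in> S}" using \<pi>_zero p \<pi>(3) by auto
      then have "\<pi> 1 \<in> {v. el v \<in> S}"
        using W.invariant_contains[OF eta_bounded eta_nonzero inv _ cyc] by blast
      then have "el 1 \<in> S" by (simp add: \<pi>(3))
      then have "el q \<in> S" for q by (rule el_generates[OF _ add sm act])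
      then have "range el \<subseteq> S" by (intro image_subsetI)
      then have "S = carrier M" using sub unfolding M_simps(1) by (intro equalityI)
      then show False using ne by contradiction
    qed
    then have "S \<subseteq> {el 0}" using sub unfolding M_simps(1) by blast
    then show "S = {\<zero>\<^bsub>M\<^esub>}" using zero unfolding M_simps(3) by blast
  qed
  have "carrier M \<noteq> {\<zero>\<^bsub>M\<^esub>}"
    using elt_one_neq_zero unfolding M_simps(1,3) by (metis range_eqI singletonD)
  then have part2: "simple_lie_module ie_scale ie_bracket M (whit_act \<eta>)"
    unfolding simple_lie_module_def using lie_module_M simple by blast
  let ?W = "{c \<odot>\<^bsub>M\<^esub> el 1 |c. True}"
  have W: "whittaker_vectors n_plus \<eta> M (whit_act \<eta>) = ?W"
  proof (intro equalityI subsetI)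
    fix v assume v: "v \<in> whittaker_vectors n_plus \<eta> M (whit_act \<eta>)"
    then obtain p where p: "v = el p" using M_carrier unfolding whittaker_vectors_def by blast
    have "A (dplus t) (\<pi> p) = fscal (eta t) (\<pi> p)" for t
    proof -
      have e: "el (fgen (dplus t) * p) = el (fconst (eta t) * p)"
        using v dplus_n_plus unfolding whittaker_vectors_def p by (auto simp: M_simps)
      show ?thesis using \<pi>(4)[OF e] \<pi>(2)[of "eta t" p] by (simp add: A_def proj fscal_def)
    qed
    then obtain c where "\<pi> p = fscal c (\<pi> 1)"
      using W.whittaker_vector_unique[OF eta_bounded eta_nonzero cyc _ w_nz] by blast
    then have "\<pi> p = \<pi> (fconst c * 1)" using \<pi>(2)[of c 1] by (simp add: fscal_def)
    then have "el p = el (fconst c * 1)" using \<pi>(3) by metis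
    then show "v \<in> ?W" unfolding p by (auto simp: M_simps)
  next
    fix v assume "v \<in> ?W"
    then obtain c where v: "v = el (fconst c)" by (auto simp: M_simps)
    then show "v \<in> whittaker_vectors n_plus \<eta> M (whit_act \<eta>)"
      unfolding whittaker_vectors_def by (auto simp: M_simps el_whittaker)
  qed
  have "submodule ?W complex_ring M"
  proof (rule module.submoduleI[OF module_M])
    show "?W \<subseteq> carrier M" by (auto simp: M_simps)
    show "\<zero>\<^bsub>M\<^esub> \<in> ?W"
      by (auto simp: M_simps intro: exI[of _ 0] simp: fconst_simps)
    interpret abelian_group M by (rule abelian_group_M)
    show "\<ominus>\<^bsub>M\<^esub> a \<in> ?W" if aW: "a \<in> ?W" for a
    proof -
      obtain c where a: "a = el (fconst c)" using aW by (auto simp: M_simps)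
      have "fconst (- c) + fconst c = (0 :: ie fmon \<Rightarrow>\<^sub>0 complex)"
        by (simp flip: fconst_simps(1) add: fconst_simps(4))
      then have "\<ominus>\<^bsub>M\<^esub> a = el (fconst (- c))"
        unfolding a by (intro minus_equality) (simp_all add: M_simps)
      then show ?thesis by (auto simp: M_simps)
    qed
    show "a \<oplus>\<^bsub>M\<^esub> b \<in> ?W"
      if aW: "a \<in> ?W" "b \<in> ?W" for a b
    proof -
      obtain c d where "a = el (fconst c)" "b = el (fconst d)" using aW by (auto simp: M_simps)
      then have "a \<oplus>\<^bsub>M\<^esub> b = (c + d) \<odot>\<^bsub>M\<^esub> el 1" by (simp add: M_simps fconst_simps)
      then show ?thesis by blast
    qed
    show "a \<odot>\<^bsub>M\<^esub> x \<in> ?W"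
      if aW: "a \<in> carrier complex_ring" "x \<in> ?W" for a x
    proof -
      obtain c where "x = el (fconst c)" using aW by (auto simp: M_simps)
      then have "a \<odot>\<^bsub>M\<^esub> x = (a * c) \<odot>\<^bsub>M\<^esub> el 1" by (simp add: M_simps fconst_simps)
      then show ?thesis by blast
    qed
  qed
  moreover have "el 1 = 1 \<odot>\<^bsub>M\<^esub> el 1" by (simp add: M_simps fconst_simps)
  then have "el 1 \<in> ?W" by blast
  moreover have "el 1 \<noteq> \<zero>\<^bsub>M\<^esub>" using elt_one_neq_zero by (simp add: M_simps)
  ultimately have "one_dimensional M ?W"
    unfolding one_dimensional_def by blast
  then show ?thesis using part2 unfolding W ..
qed

end

end

theorem theorem3p18:
  fixes \<eta> :: "ie \<Rightarrow> complex"
  assumes "lie_character ie_scale ie_bracket n_plus \<eta>"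
    and "\<exists>x\<in>n_plus. \<eta> x \<noteq> 0"
    and "root_bounded \<eta>"
  shows "one_dimensional (whit_module \<eta>)
           (whittaker_vectors n_plus \<eta> (whit_module \<eta>) (whit_act \<eta>)) \<and>
         simple_lie_module ie_scale ie_bracket (whit_module \<eta>) (whit_act \<eta>)"
  using assms by (rule whit_module_main)

end
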